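(* Let $X$ be one of the classes $W^r_{r-1}(M)$, $W^r_{r-2}(M)$, $W^r_{r-1,r-2}(M,N)$. Let $n\in\mathbb N$, let $0\le u_1<u_2<\dots<u_{2n}<2\pi$, $u=(u_1,\dots,u_{2n})$, and let $\tau\in[0,2\pi)$. Let $\phi=\phi(X,u;\cdot)$ be an $X$-ideal spline with $2n$ knots which vanishes at $u_1,\dots,u_{2n}$, and let $\Delta_{2n}$ be the partition formed by its knots. For $v=(v_1,\dots,v_{2n})\in\mathbb R^{2n}$ let $s(X',u,v;\cdot)$ be the (unique) spline in $S(X',\Delta_{2n})$ with $s(X',u,v;u_k)=v_k$, $k=1,\dots,2n$. Then $$E(X,u,\tau)=|\phi(X,u;\tau)|,$$ and the method $\tilde\Phi(v_1,\dots,v_{2n})=s(X',u,v;\tau)$ is a best recovery method, i.e. $e(X,u,\tilde\Phi,\tau)=E(X,u,\tau)$.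
   Context: All functions are real-valued and $2\pi$-periodic on $\mathbb R$. For $m\ge 1$, $L^m_\infty$ is the set of $2\pi$-periodic functions $f$ such that $f^{(m-1)}$ is (locally) absolutely continuous and $f^{(m)}\in L_\infty$; $\|\cdot\|_\infty$ is the (essential) sup norm. $M,N>0$ are fixed. Classes: for $r\ge 2$, $W^r_{r-1}(M)=\{x\in L^r_\infty:\|x^{(r)}\|_\infty\le 1,\ \|x^{(r-1)}\|_\infty\le M\}$; for $r\ge 3$, $W^r_{r-2}(M)=\{x\in L^r_\infty:\|x^{(r)}\|_\infty\le 1,\ \|x^{(r-2)}\|_\infty\le M\}$ and $W^r_{r-1,r-2}(M,N)=\{x\in L^r_\infty:\|x^{(r)}\|_\infty\le1,\ \|x^{(r-1)}\|_\infty\le N,\ \|x^{(r-2)}\|_\infty\le M\}$. Ideal splines. A function $x\in X$ is an $X$-ideal spline with ($2n$) knots $t_1<t_2<\dots<t_{2n+1}:=t_1+2\pi$ if for each $k=1,\dots,2n$ there are $\varepsilon_k\in\{1,-1\}$ and $\alpha_k\in[0,t_{k+1}-t_k]$ (and, for $X=W^r_{r-1,r-2}(M,N)$, also $\beta_k\in[0,\alpha_k]$) such that: - if $X=W^r_{r-1}(M)$: $x^{(r)}=\varepsilon_k$ on $(t_k,t_k+\alpha_k)$; $x^{(r)}=0$ and $x^{(r-1)}=\varepsilon_kM$ on $(t_k+\alpha_k,t_{k+1})$; - if $X=W^r_{r-2}(M)$: $x^{(r)}=\varepsilon_k$ on $(t_k,t_k+\alpha_k/2)$; $x^{(r)}=-\varepsilon_k$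 on $(t_k+\alpha_k/2,t_k+\alpha_k)$; $x^{(r)}=0$ and $x^{(r-2)}=\varepsilon_kM$ on $(t_k+\alpha_k,t_{k+1})$; - if $X=W^r_{r-1,r-2}(M,N)$: $x^{(r)}=\varepsilon_k$ on $(t_k,t_k+\beta_k/2)$; $x^{(r)}=0$ and $x^{(r-1)}=\varepsilon_kN$ on $(t_k+\beta_k/2,t_k+\alpha_k-\beta_k/2)$; $x^{(r)}=-\varepsilon_k$ on $(t_k+\alpha_k-\beta_k/2,t_k+\alpha_k)$; $x^{(r)}=0$ and $x^{(r-2)}=\varepsilon_kM$ on $(t_k+\alpha_k,t_{k+1})$. For every $u$ as in the claim, an $X$-ideal spline with $2n$ knots vanishing at $u_1,\dots,u_{2n}$ exists; $\phi(X,u;\cdot)$ denotes such a spline. The space $S(X',\Delta_{2n})$, where $X'=\{x':x\in X\}$. Let $t_1<t_2<\dots<t_{2n+1}=t_1+2\pi$ be the knots of the $X$-ideal spline $\phi=\phi(X,u;\cdot)$, and let $\alpha_k\in[0,t_{k+1}-t_k]$ (and, for $X=W^r_{r-1,r-2}(M,N)$, $\beta_k\in[0,\alpha_k]$), $k=1,\dots,2n$, be the numbers with which $x=\phi$ satisfies the conditions defining an $X$-ideal spline with these knots; indices are taken cyclically ($t_{k+2n}=t_k+2\pi$, etc.). Then $S(X',\Delta_{2n})$ is the set of $s\in L^{r-1}_\infty$ such that, for all $k=1,\dots,2n$: - if $X=W^r_{r-1}(M)$: $s^{(r-1)}=c_k$ on $(t_k,t_k+\alpha_k)$ for some $c_k\in\mathbb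 R$, and $s^{(r-1)}=0$ on $(t_k+\alpha_k,t_{k+1})$; - if $X=W^r_{r-2}(M)$: for some $c_k^1,c_k^2\in\mathbb R$, $s^{(r-1)}=c_k^1$ on $(t_k,t_k+\alpha_k/2)$, $s^{(r-1)}=c_k^2$ on $(t_k+\alpha_k/2,t_k+\alpha_k)$, $s^{(r-1)}=0$ on $(t_k+\alpha_k,t_{k+1})$; moreover $s^{(r-2)}(t_k)=0$ whenever $|\phi^{(r-2)}(t_k)|=M$, and $c_k^2=c_{k+1}^1$ whenever $|\phi^{(r-2)}(t_{k+1})|<M$; - if $X=W^r_{r-1,r-2}(M,N)$: for some $c_k^1,c_k^2\in\mathbb R$, $s^{(r-1)}=c_k^1$ on $(t_k,t_k+\beta_k/2)$, $s^{(r-1)}=c_k^2$ on $(t_k+\alpha_k-\beta_k/2,t_k+\alpha_k)$, $s^{(r-1)}=0$ on $(t_k+\beta_k/2,t_k+\alpha_k-\beta_k/2)$ and on $(t_k+\alpha_k,t_{k+1})$; moreover $s^{(r-2)}(t_k)=0$ whenever $|\phi^{(r-2)}(t_k)|=M$, and $c_k^2=c_{k+1}^1$ whenever $|\phi^{(r-2)}(t_{k+1})|<M$. For every $v\in\mathbb R^{2n}$ there is exactly one $s\in S(X',\Delta_{2n})$ with $s(u_k)=v_k$, $k=1,\dots,2n$. Recovery problem. A recovery method is an arbitrary function $\Phi:\mathbb R^{2n}\to\mathbb R$; its error is $e(X,u,\Phi,\tau)=\sup_{x\in X}|x(\tau)-\Phi(x(u_1),\dots,x(u_{2n}))|$; the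 best error is $E(X,u,\tau)=\inf_\Phi e(X,u,\Phi,\tau)$.
   Formalization: For W^r_{r-2}(M) and W^r_{r-1,r-2}(M,N), ideal splines are also required to satisfy ε_{k+1} = -ε_k (cyclically) whenever |x^{(r-2)}(t_{k+1})| < M; without this, Euler splines with twice as many sign changes are admitted and the claim fails. *)

theory Defs
  imports "HOL-Probability.Probability"
begin

abbreviation nderiv :: "nat \<Rightarrow> (real \<Rightarrow> real) \<Rightarrow> real \<Rightarrow> real"
  where "nderiv k f \<equiv> (deriv ^^ k) f"

text \<open>
  The constant deriv returns an unspecified value where the derivative does not exist, so
  existence of derivatives is always stated separately from their values.
\<close>

definition abs_continuous_on_interval :: "real \<Rightarrow> real \<Rightarrow> (real \<Rightarrow> real) \<Rightarrow> bool" where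
  "abs_continuous_on_interval a b f \<longleftrightarrow>
     (\<forall>e>0. \<exists>d>0. \<forall>D :: (real \<times> real) set.
        finite D \<and> (\<forall>(x, y)\<in>D. a \<le> x \<and> x \<le> y \<and> y \<le> b) \<and>
        disjoint_family_on (\<lambda>(x, y). {x<..<y}) D \<and> (\<Sum>(x, y)\<in>D. y - x) < d
        \<longrightarrow> (\<Sum>(x, y)\<in>D. \<bar>f y - f x\<bar>) < e)"

definition locally_abs_continuous :: "(real \<Rightarrow> real) \<Rightarrow> bool" where
  "locally_abs_continuous f \<longleftrightarrow> (\<forall>a b. abs_continuous_on_interval a b f)"

definition sup_norm :: "(real \<Rightarrow> real) \<Rightarrow> ereal" where
  "sup_norm f = esssup lebesgue (\<lambda>y. ereal \<bar>f y\<bar>)"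

text \<open>
  The space of functions with bounded \<open>m\<close>-th derivative (used for \<open>m \<ge> 1\<close>).  The almost
  everywhere differentiability clause is a consequence of absolute continuity; it only records
  that the \<open>m\<close>-th derivative is a genuine almost everywhere defined function.
\<close>

definition L_inf :: "nat \<Rightarrow> (real \<Rightarrow> real) set" where
  "L_inf m = {f. (\<forall>y. f (y + 2 * pi) = f y) \<and>
      (\<forall>j < m - 1. \<forall>y. nderiv j f field_differentiable (at y)) \<and>
      locally_abs_continuous (nderiv (m - 1) f) \<and>
      (AE y in lebesgue. nderiv (m - 1) f field_differentiable (at y)) \<and>
      sup_norm (nderiv m f) < \<infinity>}"

text \<open>
  The three kinds of classes, as \<open>W1 r M\<close> = \<open>W\<^sup>r\<^sub>r\<^sub>-\<^sub>1(M)\<close>, \<open>W2 r M\<close> = \<open>W\<^sup>r\<^sub>r\<^sub>-\<^sub>2(M)\<close> and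
  \<open>W12 r M N\<close> = the class with both constraints, where \<open>N\<close> bounds the derivative of order
  \<open>r - 1\<close> and \<open>M\<close> the one of order \<open>r - 2\<close>.
\<close>

datatype fun_class = W1 nat real | W2 nat real | W12 nat real real

fun admissible :: "fun_class \<Rightarrow> bool" where
  "admissible (W1 r M) \<longleftrightarrow> r \<ge> 2 \<and> M > 0"
| "admissible (W2 r M) \<longleftrightarrow> r \<ge> 3 \<and> M > 0"
| "admissible (W12 r M N) \<longleftrightarrow> r \<ge> 3 \<and> M > 0 \<and> N > 0"

fun class_set :: "fun_class \<Rightarrow> (real \<Rightarrow> real) set" where
  "class_set (W1 r M) =
     {x \<in> L_inf r. sup_norm (nderiv r x) \<le> 1 \<and> sup_norm (nderiv (r - 1) x) \<le> ereal M}"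
| "class_set (W2 r M) =
     {x \<in> L_inf r. sup_norm (nderiv r x) \<le> 1 \<and> sup_norm (nderiv (r - 2) x) \<le> ereal M}"
| "class_set (W12 r M N) =
     {x \<in> L_inf r. sup_norm (nderiv r x) \<le> 1 \<and> sup_norm (nderiv (r - 1) x) \<le> ereal N \<and>
        sup_norm (nderiv (r - 2) x) \<le> ereal M}"

text \<open>The \<open>m\<close>-th derivative (\<open>m \<ge> 1\<close>) exists and equals \<open>c\<close> on \<open>A\<close>.\<close>

definition top_deriv_on :: "nat \<Rightarrow> (real \<Rightarrow> real) \<Rightarrow> real \<Rightarrow> real set \<Rightarrow> bool" where
  "top_deriv_on m f c A \<longleftrightarrow> (\<forall>y\<in>A. (nderiv (m - 1) f has_real_derivative c) (at y))"

text \<open>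
  The three block conditions on the \<open>k\<close>-th interval: \<open>p < q\<close> are consecutive knots and \<open>e\<close>,
  \<open>a\<close>, \<open>b\<close> the sign and the parameters belonging to that interval.
\<close>

fun ideal_block :: "fun_class \<Rightarrow> (real \<Rightarrow> real) \<Rightarrow> real \<Rightarrow> real \<Rightarrow> real \<Rightarrow> real \<Rightarrow> real \<Rightarrow> bool" where
  "ideal_block (W1 r M) x p q e a b \<longleftrightarrow>
     top_deriv_on r x e {p<..<p + a} \<and>
     top_deriv_on r x 0 {p + a<..<q} \<and>
     (\<forall>y\<in>{p + a<..<q}. nderiv (r - 1) x y = e * M)"
| "ideal_block (W2 r M) x p q e a b \<longleftrightarrow>
     top_deriv_on r x e {p<..<p + a / 2} \<and>
     top_deriv_on r x (- e) {p + a / 2<..<p + a} \<and>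
     top_deriv_on r x 0 {p + a<..<q} \<and>
     (\<forall>y\<in>{p + a<..<q}. nderiv (r - 2) x y = e * M)"
| "ideal_block (W12 r M N) x p q e a b \<longleftrightarrow>
     b \<in> {0..a} \<and>
     top_deriv_on r x e {p<..<p + b / 2} \<and>
     top_deriv_on r x 0 {p + b / 2<..<p + a - b / 2} \<and>
     (\<forall>y\<in>{p + b / 2<..<p + a - b / 2}. nderiv (r - 1) x y = e * N) \<and>
     top_deriv_on r x (- e) {p + a - b / 2<..<p + a} \<and>
     top_deriv_on r x 0 {p + a<..<q} \<and>
     (\<forall>y\<in>{p + a<..<q}. nderiv (r - 2) x y = e * M)"

text \<open>
  At a knot \<open>p\<close> where the constraint on the derivative of order \<open>r - 2\<close> is not active:
\<close>

fun free_knot :: "fun_class \<Rightarrow> (real \<Rightarrow> real) \<Rightarrow> real \<Rightarrow> bool" where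
  "free_knot (W1 r M) x p \<longleftrightarrow> False"
| "free_knot (W2 r M) x p \<longleftrightarrow> \<bar>nderiv (r - 2) x p\<bar> < M"
| "free_knot (W12 r M N) x p \<longleftrightarrow> \<bar>nderiv (r - 2) x p\<bar> < M"

text \<open>
  \<open>ideal_spline X n t \<alpha> \<beta> x\<close>: \<open>x\<close> is an \<open>X\<close>-ideal spline with knots \<open>t 1 < \<dots> < t (2 * n + 1)\<close>
  (one period) and block parameters \<open>\<alpha>\<close>, \<open>\<beta>\<close>, indexed by \<open>1, \<dots>, 2 * n\<close>; \<open>\<beta>\<close> is irrelevant
  unless \<open>X\<close> has both constraints.

  The last clause makes the top derivative continue without a jump across a knot at which the
  constraint on the derivative of order \<open>r - 2\<close> is inactive, as the matching condition in
  \<open>spline_space\<close> below requires of the derivative of an ideal spline.  Without it, choosing all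
  signs equal and \<open>\<alpha> k = t (k + 1) - t k\<close> would admit perfect splines with \<open>4 * n\<close> switches
  (such as the Euler splines of half the period) as ideal splines with \<open>2 * n\<close> knots; these can
  have \<open>4 * n\<close> zeros per period and do not solve the recovery problem.  At all other knots the
  signs alternate automatically when the spline has \<open>2 * n\<close> zeros in a period.
\<close>

definition ideal_spline ::
  "fun_class \<Rightarrow> nat \<Rightarrow> (nat \<Rightarrow> real) \<Rightarrow> (nat \<Rightarrow> real) \<Rightarrow> (nat \<Rightarrow> real) \<Rightarrow> (real \<Rightarrow> real) \<Rightarrow> bool" where
  "ideal_spline X n t \<alpha> \<beta> x \<longleftrightarrow>
     x \<in> class_set X \<and>
     (\<forall>k\<in>{1..2 * n}. t k < t (k + 1)) \<and> t (2 * n + 1) = t 1 + 2 * pi \<and>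
     (\<exists>\<epsilon> :: nat \<Rightarrow> real. \<epsilon> (2 * n + 1) = \<epsilon> 1 \<and>
        (\<forall>k\<in>{1..2 * n}.
           \<epsilon> k \<in> {1, - 1} \<and> \<alpha> k \<in> {0..t (k + 1) - t k} \<and>
           ideal_block X x (t k) (t (k + 1)) (\<epsilon> k) (\<alpha> k) (\<beta> k) \<and>
           (free_knot X x (t (k + 1)) \<longrightarrow> \<epsilon> (k + 1) = - \<epsilon> k)))"

text \<open>
  The space \<open>S(X', \<Delta>)\<close> determined by the ideal spline \<open>\<phi>\<close> with knots \<open>t\<close> and parameters
  \<open>\<alpha>\<close>, \<open>\<beta>\<close>; the index of \<open>c\<close> is cyclic.
\<close>

fun spline_space ::
  "fun_class \<Rightarrow> nat \<Rightarrow> (nat \<Rightarrow> real) \<Rightarrow> (nat \<Rightarrow> real) \<Rightarrow> (nat \<Rightarrow> real) \<Rightarrow> (real \<Rightarrow> real)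
    \<Rightarrow> (real \<Rightarrow> real) set" where
  "spline_space (W1 r M) n t \<alpha> \<beta> \<phi> =
     {s \<in> L_inf (r - 1). \<exists>c. \<forall>k\<in>{1..2 * n}.
        top_deriv_on (r - 1) s (c k) {t k<..<t k + \<alpha> k} \<and>
        top_deriv_on (r - 1) s 0 {t k + \<alpha> k<..<t (k + 1)}}"
| "spline_space (W2 r M) n t \<alpha> \<beta> \<phi> =
     {s \<in> L_inf (r - 1). \<exists>c1 c2. c1 (2 * n + 1) = c1 1 \<and> (\<forall>k\<in>{1..2 * n}.
        top_deriv_on (r - 1) s (c1 k) {t k<..<t k + \<alpha> k / 2} \<and>
        top_deriv_on (r - 1) s (c2 k) {t k + \<alpha> k / 2<..<t k + \<alpha> k} \<and>
        top_deriv_on (r - 1) s 0 {t k + \<alpha> k<..<t (k + 1)} \<and>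
        (\<bar>nderiv (r - 2) \<phi> (t k)\<bar> = M \<longrightarrow> nderiv (r - 2) s (t k) = 0) \<and>
        (\<bar>nderiv (r - 2) \<phi> (t (k + 1))\<bar> < M \<longrightarrow> c2 k = c1 (k + 1)))}"
| "spline_space (W12 r M N) n t \<alpha> \<beta> \<phi> =
     {s \<in> L_inf (r - 1). \<exists>c1 c2. c1 (2 * n + 1) = c1 1 \<and> (\<forall>k\<in>{1..2 * n}.
        top_deriv_on (r - 1) s (c1 k) {t k<..<t k + \<beta> k / 2} \<and>
        top_deriv_on (r - 1) s (c2 k) {t k + \<alpha> k - \<beta> k / 2<..<t k + \<alpha> k} \<and>
        top_deriv_on (r - 1) s 0 {t k + \<beta> k / 2<..<t k + \<alpha> k - \<beta> k / 2} \<and>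
        top_deriv_on (r - 1) s 0 {t k + \<alpha> k<..<t (k + 1)} \<and>
        (\<bar>nderiv (r - 2) \<phi> (t k)\<bar> = M \<longrightarrow> nderiv (r - 2) s (t k) = 0) \<and>
        (\<bar>nderiv (r - 2) \<phi> (t (k + 1))\<bar> < M \<longrightarrow> c2 k = c1 (k + 1)))}"

definition spline_interpolant ::
  "fun_class \<Rightarrow> nat \<Rightarrow> (nat \<Rightarrow> real) \<Rightarrow> (nat \<Rightarrow> real) \<Rightarrow> (nat \<Rightarrow> real) \<Rightarrow> (real \<Rightarrow> real)
    \<Rightarrow> (nat \<Rightarrow> real) \<Rightarrow> (nat \<Rightarrow> real) \<Rightarrow> real \<Rightarrow> real" where
  "spline_interpolant X n t \<alpha> \<beta> \<phi> u v =
     (THE s. s \<in> spline_space X n t \<alpha> \<beta> \<phi> \<and> (\<forall>k\<in>{1..2 * n}. s (u k) = v k))"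

text \<open>
  A vector in \<open>2 * n\<close> dimensions is an extensional function on \<open>{1..2 * n}\<close>; restricting the
  argument ensures that a method sees only the sampled values.  Errors are extended reals since
  the supremum may be infinite for a poor method.
\<close>

definition recovery_error ::
  "(real \<Rightarrow> real) set \<Rightarrow> nat \<Rightarrow> (nat \<Rightarrow> real) \<Rightarrow> ((nat \<Rightarrow> real) \<Rightarrow> real) \<Rightarrow> real \<Rightarrow> ereal" where
  "recovery_error K n u \<Phi> \<tau> =
     (SUP x\<in>K. ereal \<bar>x \<tau> - \<Phi> (\<lambda>k\<in>{1..2 * n}. x (u k))\<bar>)"

definition best_error ::
  "(real \<Rightarrow> real) set \<Rightarrow> nat \<Rightarrow> (nat \<Rightarrow> real) \<Rightarrow> real \<Rightarrow> ereal" where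
  "best_error K n u \<tau> = (INF \<Phi>. recovery_error K n u \<Phi> \<tau>)"

end

theory Submission
  imports Defs "Jordan_Normal_Form.Determinant"
begin

text \<open>
  Let \<open>x \<in> X\<close> and let \<open>s\<close> be the interpolating spline.  If \<open>\<bar>x \<tau> - s \<tau>\<bar> > \<bar>\<phi> \<tau>\<bar>\<close>, then for some
  \<open>\<mu>\<close> with \<open>\<bar>\<mu>\<bar> > 1\<close> the function \<open>h = x - s - \<mu> \<phi>\<close> has \<open>2n + 1\<close> zeros in a period, so by Rolle's
  theorem its derivative of order \<open>r - 2\<close> changes sign at least \<open>2n + 2\<close> times.  On the other
  hand, where \<open>\<phi>\<^sup>(\<^sup>r\<^sup>) = \<plusminus>1\<close>, the derivative of order \<open>r - 1\<close> of \<open>h\<close> is strictly monotone since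
  \<open>\<bar>\<mu>\<bar> > \<bar>x\<^sup>(\<^sup>r\<^sup>)\<bar>\<close>, and where a constraint is active for \<open>\<phi>\<close> the sign of the corresponding derivative
  of \<open>h\<close> is that of \<open>- \<mu> \<phi>\<close>; this leaves at most one sign change for each of the \<open>2n\<close> blocks.
  Applied to \<open>x = 0\<close> and to multiples of \<open>s\<close>, the resulting estimate gives uniqueness of
  interpolation, and existence follows by counting dimensions.  The lower bound comes from
  comparing \<open>\<phi>\<close> with \<open>-\<phi>\<close>.

  The class \<open>W2 r M\<close> is \<open>W12 r M (2 * pi)\<close>, and the ideal splines of \<open>W1\<close> and \<open>W12\<close> both have the
  shape of the locale \<open>ramp_spline\<close>.
\<close>

section \<open>Absolutely continuous functions and the essential supremum norm\<close>

text \<open>Zeros need not be sign changes, so \<open>h\<close> is first shifted by a small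
  constant, which the first differentiation removes; it survives only for \<rho> = 0, where no
  constraint of order \<rho> can be active. The derivative of order r exists only almost everywhere.
  The count is therefore made at order r - 2, and \<open>x\<close> enters through a Lipschitz bound
  on its derivative of order r - 1. An ideal spline is required to alternate its signs only at free
  knots. Elsewhere alternation comes from the equality case of the same count: \<phi> has 2n zeros,
  so a suitable derivative of \<phi>, of constant sign on each of 2n blocks, has 2n sign changes,
  and the blocks must carry the two signs in turn. Only then do the ramps of consecutive blocks fit
  the common sign pattern against which \<open>h\<close> is counted.\<close>

lemma abs_continuous_on_nonoverlapping:
  assumes "abs_continuous_on_interval a b f"
  shows "\<forall>e>0. \<exists>d>0. \<forall>D :: real set set.
        finite D \<and> (\<forall>K\<in>D. K \<subseteq> {a..b} \<and> (\<exists>x y. x \<le> y \<and> K = {x..y})) \<and>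
        pairwise (\<lambda>K L. interior K \<inter> interior L = {}) D \<and> (\<Sum>K\<in>D. Sup K - Inf K) < d
        \<longrightarrow> (\<Sum>K\<in>D. \<bar>f (Sup K) - f (Inf K)\<bar>) < e"
proof (intro allI impI)
  fix e :: real assume e: "e > 0"
  obtain d where "d > 0" and d: "\<forall>D :: (real \<times> real) set.
        finite D \<and> (\<forall>(x, y)\<in>D. a \<le> x \<and> x \<le> y \<and> y \<le> b) \<and>
        disjoint_family_on (\<lambda>(x, y). {x<..<y}) D \<and> (\<Sum>(x, y)\<in>D. y - x) < d
        \<longrightarrow> (\<Sum>(x, y)\<in>D. \<bar>f y - f x\<bar>) < e"
    using assms[unfolded abs_continuous_on_interval_def, THEN spec, THEN mp, OF e] by (elim exE conjE) (rule that)
  show "\<exists>d>0. \<forall>D :: real set set.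
        finite D \<and> (\<forall>K\<in>D. K \<subseteq> {a..b} \<and> (\<exists>x y. x \<le> y \<and> K = {x..y})) \<and>
        pairwise (\<lambda>K L. interior K \<inter> interior L = {}) D \<and> (\<Sum>K\<in>D. Sup K - Inf K) < d
        \<longrightarrow> (\<Sum>K\<in>D. \<bar>f (Sup K) - f (Inf K)\<bar>) < e"
  proof (intro exI conjI allI impI)
    show "d > 0" by fact
    fix D :: "real set set"
    assume A: "finite D \<and> (\<forall>K\<in>D. K \<subseteq> {a..b} \<and> (\<exists>x y. x \<le> y \<and> K = {x..y})) \<and>
        pairwise (\<lambda>K L. interior K \<inter> interior L = {}) D \<and> (\<Sum>K\<in>D. Sup K - Inf K) < d"
    \<comment> \<open>Divisions produced by a gauge are sets of intervals, while absolute continuity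
      is stated for pairs of end points; a nonempty closed interval determines its end points, so
      \<open>g\<close> translates without loss.\<close>
    define g where "g = (\<lambda>K::real set. (Inf K, Sup K))"
    have K: "\<exists>x y. x \<le> y \<and> K = {x..y} \<and> g K = (x, y) \<and> a \<le> x \<and> y \<le> b" if "K \<in> D" for K
      using A that unfolding g_def by fastforce
    have inj: "inj_on g D"
      by (rule inj_onI) (use K in \<open>metis Pair_inject\<close>)
    have "(\<Sum>(x, y)\<in>g ` D. \<bar>f y - f x\<bar>) < e"
    proof (rule d[THEN spec, THEN mp], intro conjI)
      show "finite (g ` D)" using A by simp
      show "\<forall>(x, y)\<in>g ` D. a \<le> x \<and> x \<le> y \<and> y \<le> b" using K by fastforce
      show "disjoint_family_on (\<lambda>(x, y). {x<..<y}) (g ` D)"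
      proof (clarsimp simp: disjoint_family_on_def)
        fix K L assume KL: "K \<in> D" "L \<in> D" "g K \<noteq> g L"
        then have "K \<noteq> L" by auto
        then have "interior K \<inter> interior L = {}" using A KL unfolding pairwise_def by blast
        moreover obtain x y where "K = {x..y}" "g K = (x, y)" using K KL by blast
        moreover obtain x' y' where "L = {x'..y'}" "g L = (x', y')" using K KL by blast
        ultimately show "(case g K of (x, y) \<Rightarrow> {x<..<y}) \<inter> (case g L of (x, y) \<Rightarrow> {x<..<y}) = {}"
          by (simp add: interior_atLeastAtMost_real)
      qed
      show "(\<Sum>(x, y)\<in>g ` D. y - x) < d"
        using A by (simp add: sum.reindex[OF inj] o_def) (simp add: g_def)
    qed
    then show "(\<Sum>K\<in>D. \<bar>f (Sup K) - f (Inf K)\<bar>) < e"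
      by (simp add: sum.reindex[OF inj] o_def) (simp add: g_def)
  qed
qed

text \<open>A gauge argument: intervals tagged outside the null set obey the slope bound
  \<open>c + e1\<close>; those tagged inside it lie in an open set of measure below
  \<open>d\<close>, so absolute continuity makes their total increment small.\<close>

lemma abs_continuous_bounded_deriv_le:
  fixes f :: "real \<Rightarrow> real"
  assumes ac: "abs_continuous_on_interval a b f" and ab: "a \<le> b" and c: "0 \<le> c"
    and E: "AE y in lebesgue. \<exists>D. (f has_real_derivative D) (at y) \<and> \<bar>D\<bar> \<le> c"
  shows "\<bar>f b - f a\<bar> \<le> c * (b - a)"
proof (rule field_le_epsilon)
  fix e :: real assume "e > 0"
  \<comment> \<open>This choice gives \<open>e1 * (b - a) \<le> e / 2\<close>; the added 1 covers
    \<open>a = b\<close>.\<close>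
  define e1 where "e1 = e / (2 * (b - a + 1))"
  have "e1 > 0" using \<open>e > 0\<close> ab by (simp add: e1_def)
  obtain d where "d > 0" and d: "\<forall>D :: real set set. 
        finite D \<and> (\<forall>K\<in>D. K \<subseteq> {a..b} \<and> (\<exists>x y. x \<le> y \<and> K = {x..y})) \<and>
        pairwise (\<lambda>K L. interior K \<inter> interior L = {}) D \<and> (\<Sum>K\<in>D. Sup K - Inf K) < d
        \<longrightarrow> (\<Sum>K\<in>D. \<bar>f (Sup K) - f (Inf K)\<bar>) < e / 2"
    using abs_continuous_on_nonoverlapping[OF ac, THEN spec, THEN mp, OF half_gt_zero[OF \<open>e > 0\<close>]]
    by (elim exE conjE) (rule that)
  obtain B where B: "B \<in> null_sets lebesgue"
      "{y. \<not> (\<exists>D. (f has_real_derivative D) (at y) \<and> \<bar>D\<bar> \<le> c)} \<subseteq> B"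
    using E unfolding eventually_ae_filter by auto
  obtain U where U: "open U" "B \<subseteq> U" "emeasure lebesgue U < ennreal d"
  proof -
    have "B \<in> sets lebesgue" using B by auto
    then obtain U where "open U" "B \<subseteq> U" "(U - B) \<in> lmeasurable" "emeasure lebesgue (U - B) < ennreal d"
      using sets_lebesgue_outer_open[of B d] \<open>d > 0\<close> by metis
    moreover have "emeasure lebesgue U = emeasure lebesgue (U - B)"
      using B(1) \<open>open U\<close> by (simp add: emeasure_Diff_null_set)
    ultimately show ?thesis using that by auto
  qed
  have "\<exists>r>0. ball x r \<subseteq> U" if "x \<in> B" for x using U that open_contains_ball by blast
  then obtain r1 where r1: "\<And>x. x \<in> B \<Longrightarrow> r1 x > 0 \<and> ball x (r1 x) \<subseteq> U" by metis
  have "\<exists>r>0. \<forall>y. \<bar>y - x\<bar> < r \<longrightarrow> \<bar>f y - f x\<bar> \<le> (c + e1) * \<bar>y - x\<bar>" if "x \<notin> B" for x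
  proof -
    have "\<exists>D. (f has_real_derivative D) (at x) \<and> \<bar>D\<bar> \<le> c"
      using contra_subsetD[OF B(2) that] by (simp only: mem_Collect_eq not_not)
    then obtain D where D: "(f has_real_derivative D) (at x)" "\<bar>D\<bar> \<le> c" by (elim exE conjE)
    have "(\<lambda>h. h * D) = (*) D" by (rule ext) (rule mult.commute)
    with D(1) have "(f has_derivative (\<lambda>h. h * D)) (at x)"
      by (simp only: has_field_derivative_def)
    then obtain r where "r > 0" and r: "\<And>y. norm (y - x) < r \<Longrightarrow> norm (f y - f x - (y - x) * D) \<le> e1 * norm (y - x)"
      unfolding has_derivative_at_alt using \<open>e1 > 0\<close> by blast
    have "\<bar>f y - f x\<bar> \<le> (c + e1) * \<bar>y - x\<bar>" if "\<bar>y - x\<bar> < r" for y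
    proof -
      have "\<bar>f y - f x\<bar> \<le> e1 * \<bar>y - x\<bar> + \<bar>y - x\<bar> * \<bar>D\<bar>" using r[of y] that by (simp add: abs_mult[symmetric])
      also have "\<dots> \<le> e1 * \<bar>y - x\<bar> + \<bar>y - x\<bar> * c" using D by (simp add: mult_left_mono)
      finally show ?thesis by (simp add: algebra_simps)
    qed
    then show ?thesis using \<open>r > 0\<close> by blast
  qed
  then obtain r2 where r2: "\<And>x. x \<notin> B \<Longrightarrow> r2 x > 0 \<and> (\<forall>y. \<bar>y - x\<bar> < r2 x \<longrightarrow> \<bar>f y - f x\<bar> \<le> (c + e1) * \<bar>y - x\<bar>)"
    by metis
  define G where "G = (\<lambda>x. ball x (if x \<in> B then r1 x else r2 x))"
  have "gauge G" unfolding G_def gauge_def using r1 r2 by auto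
  then obtain p where p: "p tagged_division_of {a..b}" "G fine p" by (rule fine_division_exists_real)
  define P where "P = snd ` p"
  have Pdiv: "P division_of {a..b}" unfolding P_def using p(1) by (rule division_of_tagged_division)
  have finP: "finite P" by (rule division_ofD(1)[OF Pdiv])
  have PK: "\<exists>x y. x \<le> y \<and> K = {x..y} \<and> a \<le> x \<and> y \<le> b" if KP: "K \<in> P" for K
  proof -
    obtain x y where "K = cbox x y" using division_ofD(4)[OF Pdiv KP] by blast
    moreover have "K \<noteq> {}" "K \<subseteq> {a..b}" using division_ofD(2,3)[OF Pdiv KP] by auto
    ultimately show ?thesis by (auto simp: cbox_interval)
  qed
  \<comment> \<open>A set of intervals rather than of tagged pairs: every tag of an interval in
    \<open>P - Q\<close> then lies outside \<open>B\<close>.\<close>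
  define Q where "Q = snd ` {(x,K) \<in> p. x \<in> B}"
  have QP: "Q \<subseteq> P" unfolding Q_def P_def by auto
  have finQ: "finite Q" using QP finP finite_subset by blast
  have intr: "pairwise (\<lambda>K L. interior K \<inter> interior L = {}) P"
    unfolding pairwise_def using division_ofD(5)[OF Pdiv] by blast
  have QU: "K \<subseteq> U" if K: "K \<in> Q" for K
  proof -
    obtain x where x: "(x, K) \<in> p" "x \<in> B" using K unfolding Q_def by auto
    then have "K \<subseteq> G x" using p(2) by (auto simp: fine_def)
    then show ?thesis using r1[OF x(2)] x(2) unfolding G_def by auto
  qed
  have Qb: "\<And>K. K \<in> P \<Longrightarrow> measure lebesgue K = Sup K - Inf K"
    using PK by fastforce
  have "(\<Sum>K\<in>Q. Sup K - Inf K) = (\<Sum>K\<in>Q. measure lebesgue K)"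
    using QP Qb by (intro sum.cong) auto
  also have "\<dots> = measure lebesgue (\<Union>Q)"
  proof -
    have "Q division_of \<Union>Q" using Pdiv QP by (rule division_of_subset[OF division_of_union_self, THEN division_of_subset]) auto
    then show ?thesis by (simp add: content_division)
  qed
  also have "\<dots> < d"
  proof -
    have "emeasure lebesgue (\<Union>Q) \<le> emeasure lebesgue U"
      using QU U by (intro emeasure_mono) auto
    then have "emeasure lebesgue (\<Union>Q) < ennreal d" using U by auto
    then show ?thesis unfolding measure_def
      by (cases "emeasure lebesgue (\<Union>Q)") (auto simp: ennreal_less_iff)
  qed
  finally have lenQ: "(\<Sum>K\<in>Q. Sup K - Inf K) < d" .
  have "\<forall>K\<in>Q. K \<subseteq> {a..b} \<and> (\<exists>x y. x \<le> y \<and> K = {x..y})"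
  proof
    fix K assume "K \<in> Q"
    then obtain x y where "x \<le> y" "K = {x..y}" "a \<le> x" "y \<le> b" using PK[of K] QP by blast
    then show "K \<subseteq> {a..b} \<and> (\<exists>x y. x \<le> y \<and> K = {x..y})" by auto
  qed
  then have "(\<Sum>K\<in>Q. \<bar>f (Sup K) - f (Inf K)\<bar>) < e / 2"
    using pairwise_subset[OF intr QP] finQ lenQ d by simp
  moreover have "(\<Sum>K\<in>P - Q. \<bar>f (Sup K) - f (Inf K)\<bar>) \<le> (\<Sum>K\<in>P - Q. (c + e1) * (Sup K - Inf K))"
  proof (rule sum_mono)
    fix K assume K: "K \<in> P - Q"
    then obtain x where x: "(x, K) \<in> p" unfolding P_def by auto
    then have xB: "x \<notin> B" using K unfolding Q_def by force
    have "K \<subseteq> G x" using p(2) x by (auto simp: fine_def)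
    moreover obtain l h where lh: "l \<le> h" "K = {l..h}" using PK K by blast
    moreover have "x \<in> K" using tagged_division_ofD(2)[OF p(1) x] .
    ultimately have lx: "l \<le> x" "x \<le> h" and "l \<in> G x" "h \<in> G x" by auto
    then have "\<bar>h - x\<bar> < r2 x" "\<bar>l - x\<bar> < r2 x"
      using xB unfolding G_def by (auto simp: dist_real_def)
    then have "\<bar>f h - f x\<bar> \<le> (c + e1) * \<bar>h - x\<bar>" "\<bar>f l - f x\<bar> \<le> (c + e1) * \<bar>l - x\<bar>"
      using r2[OF xB] by blast+
    with lx have "\<bar>f h - f l\<bar> \<le> (c + e1) * (h - l)" by (simp add: algebra_simps)
    then show "\<bar>f (Sup K) - f (Inf K)\<bar> \<le> (c + e1) * (Sup K - Inf K)"
      using lh by (simp add: algebra_simps)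
  qed
  moreover have "(\<Sum>K\<in>P - Q. (c + e1) * (Sup K - Inf K)) \<le> (\<Sum>K\<in>P. (c + e1) * (Sup K - Inf K))"
  proof (rule sum_mono2[OF finP Diff_subset])
    fix K assume "K \<in> P - (P - Q)"
    then obtain x y where "x \<le> y" "K = {x..y}" using PK by blast
    then show "0 \<le> (c + e1) * (Sup K - Inf K)" using \<open>e1 > 0\<close> c by simp
  qed
  moreover have "(\<Sum>K\<in>P. (c + e1) * (Sup K - Inf K)) = (c + e1) * (b - a)"
  proof -
    have "(\<Sum>K\<in>P. Sup K - Inf K) = (\<Sum>K\<in>P. measure lebesgue K)" using Qb by (intro sum.cong) auto
    also have "\<dots> = measure lebesgue {a..b}" by (rule content_division[OF Pdiv])
    also have "\<dots> = b - a" using ab by simp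
    finally show ?thesis by (simp add: sum_distrib_left[symmetric])
  qed
  moreover have "(\<Sum>K\<in>P. \<bar>f (Sup K) - f (Inf K)\<bar>) = (\<Sum>K\<in>Q. \<bar>f (Sup K) - f (Inf K)\<bar>) + (\<Sum>K\<in>P - Q. \<bar>f (Sup K) - f (Inf K)\<bar>)"
    by (subst sum.subset_diff[OF QP finP]) (rule add.commute)
  moreover have "\<bar>f b - f a\<bar> \<le> (\<Sum>K\<in>P. \<bar>f (Sup K) - f (Inf K)\<bar>)"
  proof -
    \<comment> \<open>Passing from tagged pairs to intervals needs the value 0 on the empty
      interval, where \<open>Sup\<close> and \<open>Inf\<close> are unspecified.\<close>
    let ?d = "\<lambda>K. if K = {} then 0 else f (Sup K) - f (Inf K)"
    have "f b - f a = (\<Sum>(x, K)\<in>p. f (Sup K) - f (Inf K))"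
      by (rule additive_tagged_division_1[OF ab p(1), symmetric])
    also have "\<dots> = (\<Sum>(x, K)\<in>p. ?d K)"
    proof (rule sum.cong[OF refl], clarify)
      fix x K assume "(x, K) \<in> p"
      then have "x \<in> K" by (rule tagged_division_ofD(2)[OF p(1)])
      then show "f (Sup K) - f (Inf K) = ?d K" by auto
    qed
    also have "\<dots> = (\<Sum>K\<in>P. ?d K)"
      unfolding P_def
    proof (rule sum.over_tagged_division_lemma[OF p(1)])
      fix u v :: real assume uv: "box u v = {}"
      show "?d (cbox u v) = 0"
      proof (cases "u = v")
        case False
        then have "cbox u v = {}" using uv by simp
        then show ?thesis by simp
      qed simp
    qed
    also have "\<dots> = (\<Sum>K\<in>P. f (Sup K) - f (Inf K))"
    proof (rule sum.cong[OF refl])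
      fix K assume "K \<in> P"
      then have "K \<noteq> {}" by (rule division_ofD(3)[OF Pdiv])
      then show "?d K = f (Sup K) - f (Inf K)" by simp
    qed
    finally show ?thesis by (simp only: sum_abs)
  qed
  moreover have "e1 * (b - a) \<le> e / 2"
    using ab \<open>e > 0\<close> unfolding e1_def by (simp add: field_simps)
  ultimately show "\<bar>f b - f a\<bar> \<le> c * (b - a) + e" by (simp add: algebra_simps)
qed


lemma abs_continuous_on_interval_imp_continuous_on:
  assumes "abs_continuous_on_interval a b f"
  shows "continuous_on {a..b} f"
proof (rule continuous_onI)
  fix x e :: real assume x: "x \<in> {a..b}" and e: "e > 0"
  obtain d where "d > 0" and d: "\<forall>D :: (real \<times> real) set.
        finite D \<and> (\<forall>(x, y)\<in>D. a \<le> x \<and> x \<le> y \<and> y \<le> b) \<and>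
        disjoint_family_on (\<lambda>(x, y). {x<..<y}) D \<and> (\<Sum>(x, y)\<in>D. y - x) < d
        \<longrightarrow> (\<Sum>(x, y)\<in>D. \<bar>f y - f x\<bar>) < e"
    using assms[unfolded abs_continuous_on_interval_def, THEN spec, THEN mp, OF e] by (elim exE conjE) (rule that)
  have *: "\<bar>f v - f u\<bar> < e" if "a \<le> u" "u \<le> v" "v \<le> b" "v - u < d" for u v
    using d[THEN spec[of _ "{(u, v)}"]] that by (simp add: disjoint_family_on_def)
  have "dist (f y) (f x) \<le> e" if "y \<in> {a..b}" "dist y x < d" for y
  proof (cases "x \<le> y")
    case True
    then show ?thesis using *[of x y] that x by (simp add: dist_real_def)
  next
    case False
    then show ?thesis using *[of y x] that x by (simp add: dist_real_def abs_minus_commute)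
  qed
  then show "\<exists>d>0. \<forall>x'\<in>{a..b}. dist x' x < d \<longrightarrow> dist (f x') (f x) \<le> e"
    using \<open>d > 0\<close> by blast
qed

lemma locally_abs_continuous_imp_continuous:
  assumes "locally_abs_continuous f"
  shows "isCont f x"
proof -
  have "continuous_on {x - 1..x + 1} f"
    using assms abs_continuous_on_interval_imp_continuous_on unfolding locally_abs_continuous_def by blast
  then show ?thesis by (rule continuous_on_interior) (simp add: interior_atLeastAtMost_real)
qed

lemma lipschitz_imp_locally_abs_continuous:
  assumes "L \<ge> 0" and L: "\<And>x y. \<bar>f y - f x\<bar> \<le> L * \<bar>y - x\<bar>"
  shows "locally_abs_continuous f"
  unfolding locally_abs_continuous_def abs_continuous_on_interval_def
proof (intro allI impI)
  fix a b e :: real assume "e > 0"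
  define d where "d = e / (L + 1)"
  have "d > 0" "L * d < e" using \<open>e > 0\<close> \<open>L \<ge> 0\<close> by (auto simp: d_def field_simps)
  have "(\<Sum>(x, y)\<in>D. \<bar>f y - f x\<bar>) < e"
    if "finite D" and D: "\<forall>(x, y)\<in>D. a \<le> x \<and> x \<le> y \<and> y \<le> b" and "(\<Sum>(x, y)\<in>D. y - x) < d" for D
  proof -
    have "(\<Sum>(x, y)\<in>D. \<bar>f y - f x\<bar>) \<le> (\<Sum>(x, y)\<in>D. L * (y - x))"
    proof (rule sum_mono, clarify)
      fix x y assume "(x, y) \<in> D"
      then have "x \<le> y" using D by auto
      then show "\<bar>f y - f x\<bar> \<le> L * (y - x)" using L[of y x] by simp
    qed
    also have "\<dots> = L * (\<Sum>(x, y)\<in>D. y - x)" by (simp add: sum_distrib_left case_prod_unfold)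
    also have "\<dots> \<le> L * d" using that \<open>L \<ge> 0\<close> by (intro mult_left_mono) auto
    finally show ?thesis using \<open>L * d < e\<close> by simp
  qed
  then show "\<exists>d>0. \<forall>D. finite D \<and> (\<forall>(x, y)\<in>D. a \<le> x \<and> x \<le> y \<and> y \<le> b) \<and>
           disjoint_family_on (\<lambda>(x, y). {x<..<y}) D \<and> (\<Sum>(x, y)\<in>D. y - x) < d \<longrightarrow>
           (\<Sum>(x, y)\<in>D. \<bar>f y - f x\<bar>) < e"
    using \<open>d > 0\<close> by blast
qed

section \<open>Essential bounds in pointwise form, and measurability of derivatives\<close>

lemma sup_norm_finite_AE:
  assumes "sup_norm f \<le> ereal c"
  shows "AE x in lebesgue. \<bar>f x\<bar> \<le> c"
proof -
  have "AE x in lebesgue. ereal \<bar>f x\<bar> \<le> sup_norm f" unfolding sup_norm_def by (rule esssup_AE)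
  then show ?thesis
  proof (eventually_elim)
    case (elim x)
    then have "ereal \<bar>f x\<bar> \<le> ereal c" using assms by (rule order_trans)
    then show ?case by simp
  qed
qed

lemma sup_norm_leI:
  assumes "f \<in> borel_measurable lebesgue" "AE x in lebesgue. \<bar>f x\<bar> \<le> c"
  shows "sup_norm f \<le> ereal c"
  unfolding sup_norm_def using assms by (intro esssup_I) auto

text \<open>The set where \<open>\<bar>f\<bar>\<close> exceeds \<open>c\<close> is open and null,
  hence empty.\<close>

lemma sup_norm_continuous_le:
  assumes cont: "\<And>x. isCont f x" and "sup_norm f \<le> ereal c"
  shows "\<bar>f x\<bar> \<le> c"
proof (rule ccontr)
  assume "\<not> \<bar>f x\<bar> \<le> c"
  define U where "U = {x. c < \<bar>f x\<bar>}"
  have "continuous_on UNIV (\<lambda>x. \<bar>f x\<bar>)" using cont by (intro continuous_intros) (simp add: continuous_on_eq_continuous_at)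
  then have "open U" unfolding U_def by (intro open_Collect_less) auto
  moreover have "x \<in> U" using \<open>\<not> \<bar>f x\<bar> \<le> c\<close> by (simp add: U_def)
  moreover have "negligible U"
  proof -
    have "AE x in lebesgue. x \<notin> U" using sup_norm_finite_AE[OF assms(2)] by (simp add: U_def not_less)
    moreover have "U \<in> sets lebesgue" using \<open>open U\<close> by simp
    ultimately show ?thesis using AE_iff_null_sets negligible_iff_null_sets by blast
  qed
  ultimately show False using open_not_negligible by blast
qed

lemma sup_norm_le_iff_continuous:
  assumes cont: "\<And>x. isCont f x"
  shows "sup_norm f \<le> ereal c \<longleftrightarrow> (\<forall>x. \<bar>f x\<bar> \<le> c)"
proof
  assume "\<forall>x. \<bar>f x\<bar> \<le> c"
  moreover have "f \<in> borel_measurable lebesgue"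
  proof -
    have "f \<in> borel_measurable borel"
      using cont by (intro borel_measurable_continuous_onI) (simp add: continuous_at_imp_continuous_on)
    then show ?thesis by (intro measurable_completion) simp
  qed
  ultimately show "sup_norm f \<le> ereal c" by (intro sup_norm_leI) auto
qed (use sup_norm_continuous_le[OF cont] in blast)

text \<open>Off a null set \<open>deriv f\<close> is the limit of the difference quotients with step
  \<open>1 / (n + 1)\<close>, which are Borel; its unspecified values on the null set are covered by
  completeness. \<open>sup_norm_leI\<close> asks for this measurability.\<close>

lemma borel_measurable_deriv_lebesgue:
  fixes f :: "real \<Rightarrow> real"
  assumes cont: "\<And>x. isCont f x" and diff: "AE x in lebesgue. f field_differentiable (at x)"
  shows "deriv f \<in> borel_measurable lebesgue"
proof -
  define g where "g = (\<lambda>n x. (f (x + 1 / real (Suc n)) - f x) * real (Suc n))"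
  have g: "g n \<in> borel_measurable borel" for n
  proof -
    have c: "continuous_on UNIV f" using cont by (simp add: continuous_on_eq_continuous_at)
    have [measurable]: "f \<in> borel_measurable borel" by (rule borel_measurable_continuous_onI[OF c])
    show ?thesis unfolding g_def by measurable
  qed
  have g_lim: "(\<lambda>n. g n x) \<longlonglongrightarrow> deriv f x" if "f field_differentiable (at x)" for x
  proof -
    have "(f has_real_derivative deriv f x) (at x)" using that by (simp add: DERIV_deriv_iff_field_differentiable)
    then have "((\<lambda>h. (f (x + h) - f x) / h) \<longlongrightarrow> deriv f x) (at 0)" by (simp add: DERIV_def)
    moreover have "filterlim (\<lambda>n. 1 / real (Suc n)) (at 0) sequentially"
      unfolding filterlim_at using LIMSEQ_inverse_real_of_nat by (simp add: inverse_eq_divide)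
    ultimately have "(\<lambda>n. (f (x + 1 / real (Suc n)) - f x) / (1 / real (Suc n))) \<longlonglongrightarrow> deriv f x"
      by (rule filterlim_compose)
    then show ?thesis by (simp add: g_def)
  qed
  have ae: "AE x in lebesgue. deriv f x = lim (\<lambda>n. g n x)"
    using diff by (rule eventually_mono) (rule limI[OF g_lim, symmetric])
  have "(\<lambda>x. lim (\<lambda>n. g n x)) \<in> borel_measurable borel"
    using g by (intro borel_measurable_lim_metric)
  then have "(\<lambda>x. lim (\<lambda>n. g n x)) \<in> borel_measurable lebesgue" by (intro measurable_completion) simp
  then show ?thesis
    by (rule borel_measurable_AE) (use ae in \<open>simp add: eq_commute\<close>)
qed

section \<open>Iterated derivatives and the density of sign changes\<close>

text \<open>The exceptional points rule out a direct use of the mean value theorem; the fundamental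
  theorem for the gauge integral tolerates them without any regularity of the derivative.\<close>

lemma nonneg_deriv_le_finite_exceptions:
  fixes f :: "real \<Rightarrow> real"
  assumes "a \<le> b" "finite S" "continuous_on {a..b} f"
    and d: "\<And>x. a < x \<Longrightarrow> x < b \<Longrightarrow> x \<notin> S \<Longrightarrow> \<exists>D\<ge>0. (f has_real_derivative D) (at x)"
  shows "f a \<le> f b"
proof -
  obtain D where D: "\<And>x. a < x \<Longrightarrow> x < b \<Longrightarrow> x \<notin> S \<Longrightarrow> 0 \<le> D x \<and> (f has_real_derivative D x) (at x)"
    using d by metis
  define g where "g = (\<lambda>x. if a < x \<and> x < b \<and> x \<notin> S then D x else 0)"
  have "(g has_integral (f b - f a)) {a..b}"
    using assms(1-3) D
    by (intro fundamental_theorem_of_calculus_interior_strong[of S])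
      (auto simp: g_def has_real_derivative_iff_has_vector_derivative[symmetric])
  then have "0 \<le> f b - f a"
    by (rule has_integral_nonneg) (use D in \<open>auto simp: g_def\<close>)
  then show ?thesis by simp
qed

lemma deriv_bound_finite_exceptions:
  fixes f :: "real \<Rightarrow> real"
  assumes "a \<le> b" "finite S" "continuous_on {a..b} f"
    and d: "\<And>x. a < x \<Longrightarrow> x < b \<Longrightarrow> x \<notin> S \<Longrightarrow> \<exists>D. \<bar>D\<bar> \<le> L \<and> (f has_real_derivative D) (at x)"
  shows "\<bar>f b - f a\<bar> \<le> L * (b - a)"
proof -
  have "(\<lambda>x. L * x - f x) a \<le> (\<lambda>x. L * x - f x) b"
  proof (rule nonneg_deriv_le_finite_exceptions[OF assms(1,2), where f = "\<lambda>x. L * x - f x"])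
    fix x assume "a < x" "x < b" "x \<notin> S"
    then obtain D where "\<bar>D\<bar> \<le> L" "(f has_real_derivative D) (at x)" using d by blast
    then show "\<exists>D\<ge>0. ((\<lambda>x. L * x - f x) has_real_derivative D) (at x)"
      by (intro exI[of _ "L - D"]) (auto intro!: derivative_eq_intros)
  qed (intro continuous_intros assms)
  moreover have "(\<lambda>x. L * x + f x) a \<le> (\<lambda>x. L * x + f x) b"
  proof (rule nonneg_deriv_le_finite_exceptions[OF assms(1,2), where f = "\<lambda>x. L * x + f x"])
    fix x assume "a < x" "x < b" "x \<notin> S"
    then obtain D where "\<bar>D\<bar> \<le> L" "(f has_real_derivative D) (at x)" using d by blast
    then show "\<exists>D\<ge>0. ((\<lambda>x. L * x + f x) has_real_derivative D) (at x)"
      by (intro exI[of _ "L + D"]) (auto intro!: derivative_eq_intros)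
  qed (intro continuous_intros assms)
  ultimately show ?thesis by (simp add: algebra_simps abs_le_iff)
qed

text \<open>Linearity of \<open>nderiv\<close> needs genuine derivatives, since \<open>deriv\<close>
  is unspecified elsewhere; this predicate secures it up to and including order
  \<open>k\<close>.\<close>

definition smooth_upto :: "nat \<Rightarrow> (real \<Rightarrow> real) \<Rightarrow> bool" where
  "smooth_upto k f \<longleftrightarrow> (\<forall>j<k. \<forall>y. nderiv j f field_differentiable (at y))"

lemma smooth_uptoD:
  "smooth_upto k f \<Longrightarrow> j < k \<Longrightarrow> (nderiv j f has_real_derivative nderiv (Suc j) f y) (at y)"
  by (simp add: smooth_upto_def DERIV_deriv_iff_field_differentiable)

lemma smooth_upto_mono: "smooth_upto k f \<Longrightarrow> j \<le> k \<Longrightarrow> smooth_upto j f"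
  by (auto simp: smooth_upto_def)

lemma smooth_upto_isCont: "smooth_upto k f \<Longrightarrow> j < k \<Longrightarrow> isCont (nderiv j f) y"
  using smooth_uptoD DERIV_isCont by blast

lemma nderiv_lincomb:
  assumes "smooth_upto k f" "smooth_upto k g" "j \<le> k"
  shows "nderiv j (\<lambda>x. a * f x + b * g x) = (\<lambda>x. a * nderiv j f x + b * nderiv j g x)"
  using assms(3)
proof (induction j)
  case (Suc j)
  have "deriv (\<lambda>x. a * nderiv j f x + b * nderiv j g x) x = a * nderiv (Suc j) f x + b * nderiv (Suc j) g x" for x
    by (rule DERIV_imp_deriv)
      (use Suc.prems smooth_uptoD[OF assms(1), of j] smooth_uptoD[OF assms(2), of j]
        in \<open>auto intro!: derivative_eq_intros\<close>)
  moreover have "nderiv j (\<lambda>x. a * f x + b * g x) = (\<lambda>x. a * nderiv j f x + b * nderiv j g x)"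
    using Suc by simp
  ultimately show ?case by (intro ext) simp
qed simp

lemma smooth_upto_lincomb:
  assumes "smooth_upto k f" "smooth_upto k g"
  shows "smooth_upto k (\<lambda>x. a * f x + b * g x)"
  unfolding smooth_upto_def
proof (intro allI impI)
  fix j y assume "j < k"
  then have "nderiv j (\<lambda>x. a * f x + b * g x) = (\<lambda>x. a * nderiv j f x + b * nderiv j g x)"
    using nderiv_lincomb[OF assms] by simp
  moreover have "((\<lambda>x. a * nderiv j f x + b * nderiv j g x) has_real_derivative
      a * nderiv (Suc j) f y + b * nderiv (Suc j) g y) (at y)"
    using smooth_uptoD[OF assms(1) \<open>j < k\<close>] smooth_uptoD[OF assms(2) \<open>j < k\<close>]
    by (auto intro!: derivative_eq_intros)
  ultimately show "nderiv j (\<lambda>x. a * f x + b * g x) field_differentiable at y"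
    using field_differentiable_def by fastforce
qed

lemma nderiv_const: "nderiv j (\<lambda>x. c) = (\<lambda>x::real. if j = 0 then c else 0 :: real)"
  by (induction j) (auto intro!: ext)

lemma smooth_upto_const: "smooth_upto k (\<lambda>x. c)"
  by (simp add: smooth_upto_def nderiv_const)

lemma smooth_upto_sum:
  assumes "finite I" "\<And>i. i \<in> I \<Longrightarrow> smooth_upto k (f i)"
  shows "smooth_upto k (\<lambda>x. \<Sum>i\<in>I. a i * f i x)
    \<and> (\<forall>j\<le>k. nderiv j (\<lambda>x. \<Sum>i\<in>I. a i * f i x) = (\<lambda>x. \<Sum>i\<in>I. a i * nderiv j (f i) x))"
  using assms
proof (induction I rule: finite_induct)
  case empty
  then show ?case using smooth_upto_const[of k 0] by (simp add: nderiv_const)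
next
  case (insert i I)
  then have IH: "smooth_upto k (\<lambda>x. \<Sum>i\<in>I. a i * f i x)"
    "\<And>j. j \<le> k \<Longrightarrow> nderiv j (\<lambda>x. \<Sum>i\<in>I. a i * f i x) = (\<lambda>x. \<Sum>i\<in>I. a i * nderiv j (f i) x)"
    and fi: "smooth_upto k (f i)" by auto
  have "(\<lambda>x. \<Sum>i\<in>insert i I. a i * f i x) = (\<lambda>x. a i * f i x + 1 * (\<Sum>i\<in>I. a i * f i x))"
    using insert by simp
  then show ?case
    using smooth_upto_lincomb[OF fi IH(1), of "a i" 1] nderiv_lincomb[OF fi IH(1), of _ "a i" 1] IH(2) insert(1,2)
    by simp
qed

text \<open>No differentiability is assumed: the predicates inside the choice that defines
  \<open>deriv\<close> coincide at both points, so even unspecified values agree.\<close>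

lemma deriv_periodic:
  fixes f :: "real \<Rightarrow> real"
  assumes "\<And>x. f (x + p) = f x"
  shows "deriv f (x + p) = deriv f x"
proof -
  have "(f has_field_derivative D) (at (x + p)) \<longleftrightarrow> (f has_field_derivative D) (at x)" for D
    using DERIV_shift[of f D x p] assms by simp
  then show ?thesis by (simp add: deriv_def)
qed

lemma nderiv_periodic:
  assumes "\<And>x. f (x + p) = f x"
  shows "nderiv j f (x + p) = nderiv j f x"
proof (induction j arbitrary: x)
  case (Suc j)
  show ?case using deriv_periodic[of "nderiv j f" p x] Suc by simp
qed (simp add: assms)

lemma periodic_DERIV_shift:
  assumes "\<And>x. f (x + p) = f x"
  shows "(f has_real_derivative D) (at (x + p)) \<longleftrightarrow> (f has_real_derivative D) (at x)"
  using DERIV_shift[of f D x p] assms by simp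

lemma nderiv_zero_on_open:
  assumes "open U" "\<And>x. x \<in> U \<Longrightarrow> f x = 0" "x \<in> U"
  shows "nderiv j f x = 0"
  using assms(3)
proof (induction j arbitrary: x)
  case (Suc j)
  have "(nderiv j f has_real_derivative 0) (at x)"
    by (rule has_field_derivative_transform_within_open[of "\<lambda>x. 0" _ _ U])
      (use Suc assms(1) in auto)
  then show ?case by (simp add: DERIV_imp_deriv)
qed (simp add: assms)

section \<open>Integer-indexed sequences that advance by a fixed amount per period\<close>

lemma int_step_exists:
  fixes P :: "int \<Rightarrow> bool"
  assumes "P a" "\<not> P b" "a \<le> b"
  shows "\<exists>k. P k \<and> \<not> P (k + 1)"
proof (rule ccontr)
  assume "\<not> ?thesis"
  then have *: "\<And>k. P k \<Longrightarrow> P (k + 1)" by blast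
  from assms(3) have "P b" by (induction b rule: int_ge_induct) (auto simp: assms(1) *)
  then show False using assms(2) by simp
qed

text \<open>Letting \<open>j\<close> grow makes the bounded error irrelevant; this turns asymptotic
  densities into an inequality between integers.\<close>

lemma linear_growth_le:
  fixes m k :: nat
  assumes "\<And>j::nat. real (j * m) \<le> real (j * k) + C"
  shows "m \<le> k"
proof (rule ccontr)
  assume "\<not> m \<le> k"
  then have "real m \<ge> real k + 1" by simp
  obtain j :: nat where j: "C < real j" using reals_Archimedean2 by blast
  have "real j * real m \<ge> real j * (real k + 1)" using \<open>real m \<ge> real k + 1\<close> by (intro mult_left_mono) auto
  then show False using assms[of j] j by (simp add: algebra_simps)
qed

lemma period_mult:
  fixes T :: "int \<Rightarrow> real"
  assumes "\<And>k. T (k + N) = T k + c"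
  shows "T (k + N * l) = T k + c * of_int l"
proof (induction l rule: int_induct[of _ 0])
  case (step1 i)
  have "T (k + N * (i + 1)) = T ((k + N * i) + N)" by (simp add: algebra_simps)
  also have "\<dots> = T (k + N * i) + c" by (rule assms)
  finally show ?case using step1 by (simp add: algebra_simps)
next
  case (step2 i)
  have "T (k + N * i) = T ((k + N * (i - 1)) + N)" by (simp add: algebra_simps)
  also have "\<dots> = T (k + N * (i - 1)) + c" by (rule assms)
  finally show ?case using step2 by (simp add: algebra_simps)
qed simp

lemma period_cong:
  fixes e :: "int \<Rightarrow> real"
  assumes "\<And>k. e (k + N) = e k" "k mod N = k' mod N"
  shows "e k = e k'"
proof -
  have *: "e (k + N * l) = e k" for k l using period_mult[of e N 0] assms(1) by simp
  have "e k = e (k mod N)" for k using *[of "k mod N" "k div N"] by simp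
  then show ?thesis using assms(2) by metis
qed

text \<open>The expression is \<open>N\<close>-periodic in \<open>k\<close>. Its boundedness says
  that \<open>T\<close> has \<open>N\<close> points per \<open>2 * pi\<close>, up to a bounded
  error.\<close>

lemma period_bounded:
  fixes T :: "int \<Rightarrow> real"
  assumes "\<And>k. T (k + N) = T k + 2 * pi" "N > 0"
  shows "\<exists>C. \<forall>k. \<bar>of_int N * T k - 2 * pi * of_int k\<bar> \<le> C"
proof -
  define g where "g = (\<lambda>k. of_int N * T k - 2 * pi * of_int k)"
  have "g (k + N) = g k" for k unfolding g_def assms(1) by (simp add: algebra_simps)
  then have "g k = g (k mod N)" for k by (rule period_cong) simp
  moreover have "\<bar>g r\<bar> \<le> (\<Sum>r\<in>{0..<N}. \<bar>g r\<bar>)" if "r \<in> {0..<N}" for r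
    by (rule member_le_sum) (use that in auto)
  ultimately have "\<bar>g k\<bar> \<le> (\<Sum>r\<in>{0..<N}. \<bar>g r\<bar>)" for k
    using assms(2) by (metis atLeastLessThan_iff pos_mod_bound pos_mod_sign)
  then show ?thesis unfolding g_def by blast
qed

lemma int_block_exists:
  fixes T :: "int \<Rightarrow> real"
  assumes C: "\<And>k. \<bar>of_int N * T k - 2 * pi * of_int k\<bar> \<le> C" and "N > (0::int)"
  shows "\<exists>k. T k \<le> z \<and> z < T (k + 1)"
proof -
  have "C \<ge> 0" using C[of 0] by linarith
  have N1: "1 \<le> real_of_int N" using \<open>N > 0\<close> by simp
  define k0 where "k0 = \<lfloor>(of_int N * z - C) / (2 * pi)\<rfloor>"
  define k1 where "k1 = \<lfloor>(of_int N * z + C) / (2 * pi)\<rfloor> + 1"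
  have "2 * pi * of_int k0 \<le> of_int N * z - C"
  proof -
    have "2 * pi * of_int k0 \<le> 2 * pi * ((of_int N * z - C) / (2 * pi))"
      unfolding k0_def by (intro mult_left_mono of_int_floor_le) simp
    then show ?thesis by simp
  qed
  then have "of_int N * T k0 \<le> of_int N * z" using C[of k0] by linarith
  then have 0: "T k0 \<le> z" using N1 by simp
  have "(of_int N * z + C) / (2 * pi) < of_int k1" unfolding k1_def by linarith
  then have "of_int N * z + C < 2 * pi * of_int k1" by (simp add: field_simps)
  then have "of_int N * z < of_int N * T k1" using C[of k1] by linarith
  then have 1: "\<not> T k1 \<le> z" using N1 by simp
  have "k0 \<le> k1" unfolding k0_def k1_def
    using floor_mono[of "(of_int N * z - C) / (2 * pi)" "(of_int N * z + C) / (2 * pi)"] \<open>C \<ge> 0\<close>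
    by (simp add: divide_right_mono)
  then show ?thesis using int_step_exists[of "\<lambda>k. T k \<le> z", OF 0 1] by (simp add: not_le)
qed

text \<open>
  Sign changes are counted by their asymptotic density: \<open>f\<close> changes sign at least \<open>m\<close> times per
  period \<open>2\<pi>\<close>, at sample points outside \<open>D\<close>.  This form survives Rolle's theorem without any
  bookkeeping for the period.
\<close>

definition alternates :: "nat \<Rightarrow> (real \<Rightarrow> real) \<Rightarrow> real set \<Rightarrow> bool" where
  "alternates m f D \<longleftrightarrow> (\<exists>y C. (\<forall>i. y i < y (Suc i) \<and> y i \<notin> D \<and> f (y i) * f (y (Suc i)) < 0) \<and>
      (\<forall>j. y (j * m) \<le> 2 * pi * real j + C))"

text \<open>Between sample values of opposite sign \<open>f'\<close> has the sign of the later one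
  at some point off \<open>D\<close>; otherwise \<open>f\<close> would be monotone in the wrong
  direction. The index shift costs at most one period, which the constant absorbs.\<close>

lemma alternates_deriv:
  assumes cont: "\<And>x. isCont f x" and D: "\<And>a b. finite (D \<inter> {a..b})"
    and f': "\<And>x. x \<notin> D \<Longrightarrow> (f has_real_derivative f' x) (at x)"
    and alt: "alternates m f D0" and "m \<ge> 1"
  shows "alternates m f' D"
proof -
  obtain y C where y: "\<And>i. y i < y (Suc i)" "\<And>i. f (y i) * f (y (Suc i)) < 0"
    and C: "\<And>j. y (j * m) \<le> 2 * pi * real j + C"
    using alt unfolding alternates_def by blast
  have "\<exists>z. y i < z \<and> z < y (Suc i) \<and> z \<notin> D \<and> f' z * f (y (Suc i)) > 0" for i
  proof (rule ccontr)
    assume no: "\<not> ?thesis"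
    define s where "s = sgn (f (y (Suc i)))"
    have "(\<lambda>x. - s * f x) (y i) \<le> (\<lambda>x. - s * f x) (y (Suc i))"
    proof (rule nonneg_deriv_le_finite_exceptions[where f = "\<lambda>x. - s * f x" and S = "D \<inter> {y i..y (Suc i)}"])
      fix x assume x: "y i < x" "x < y (Suc i)" "x \<notin> D \<inter> {y i..y (Suc i)}"
      then have "x \<notin> D" by auto
      moreover from this have "f' x * f (y (Suc i)) \<le> 0" using no x by force
      then have "- s * f' x \<ge> 0" unfolding s_def
        by (auto simp: sgn_if mult_le_0_iff)
      ultimately show "\<exists>D\<ge>0. ((\<lambda>x. - s * f x) has_real_derivative D) (at x)"
        using f' by (intro exI[of _ "- s * f' x"]) (auto intro!: derivative_eq_intros)
    qed (use y(1)[of i] D cont in \<open>auto intro!: continuous_intros simp: less_imp_le continuous_at_imp_continuous_on\<close>)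
    then show False using y(2)[of i] unfolding s_def
      by (auto simp: sgn_if mult_less_0_iff split: if_splits)
  qed
  then obtain z where z: "\<And>i. y i < z i \<and> z i < y (Suc i) \<and> z i \<notin> D \<and> f' (z i) * f (y (Suc i)) > 0"
    by metis
  have ymono: "y i \<le> y j" if "i \<le> j" for i j
    using that y(1) by (simp add: lift_Suc_mono_le less_imp_le)
  have "z i < z (Suc i)" for i using z[of i] z[of "Suc i"] by linarith
  moreover have "f' (z i) * f' (z (Suc i)) < 0" for i
    using z[of i] z[of "Suc i"] y(2)[of "Suc i"]
    by (auto simp: zero_less_mult_iff mult_less_0_iff)
  moreover have "z (j * m) \<le> 2 * pi * real j + (2 * pi + C)" for j
  proof -
    have "z (j * m) \<le> y (Suc (j * m))" using z by (simp add: less_imp_le)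
    also have "\<dots> \<le> y (Suc j * m)" using \<open>m \<ge> 1\<close> by (intro ymono) simp
    also have "\<dots> \<le> 2 * pi * real (Suc j) + C" by (rule C)
    finally show ?thesis by (simp add: algebra_simps)
  qed
  ultimately show ?thesis unfolding alternates_def using z by blast
qed

text \<open>The first differentiation removes the shift \<open>c\<close>, hence the case distinction
  on \<open>j\<close>.\<close>

lemma alternates_nderiv:
  assumes "smooth_upto k h" "alternates m (\<lambda>x. h x - c) {}" "m \<ge> 1" "j \<le> k"
  shows "alternates m (\<lambda>x. nderiv j h x - (if j = 0 then c else 0)) {}"
  using assms(4)
proof (induction j)
  case (Suc j)
  let ?f = "\<lambda>x. nderiv j h x - (if j = 0 then c else 0)"
  have d: "(?f has_real_derivative nderiv (Suc j) h x) (at x)" for x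
    using smooth_uptoD[OF assms(1), of j x] Suc.prems by (auto intro!: derivative_eq_intros)
  have "alternates m (nderiv (Suc j) h) {}"
  proof (rule alternates_deriv[of ?f _ _ _ "{}"])
    show "isCont ?f x" for x by (rule DERIV_isCont[OF d])
    show "alternates m ?f {}" using Suc by simp
  qed (use d assms(3) in simp_all)
  then show ?case by simp
qed (use assms in simp)

section \<open>Counting sign changes\<close>

text \<open>In block \<open>k\<close> the sign of \<open>f\<close> can only pass from that of
  \<open>- \<sigma> k\<close> to that of \<open>\<sigma> k\<close>, which is the sign that the next
  block allows first. So each block admits one change, and there are \<open>2 * n\<close> blocks per
  period.\<close>

lemma alternates_le_pattern:
  fixes \<zeta> \<sigma> :: "int \<Rightarrow> real" and n :: nat
  assumes C0: "\<And>k. \<bar>real_of_int (2 * int n) * \<zeta> k - 2 * pi * of_int k\<bar> \<le> C0" and n: "n \<ge> 1"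
    and mono: "\<And>k. \<zeta> k \<le> \<zeta> (k + 1)"
    and \<sigma>: "\<And>k. \<sigma> (k + 1) = - \<sigma> k" "\<And>k. \<sigma> k \<noteq> 0"
    and pat: "\<And>k y y'. \<zeta> k \<le> y \<Longrightarrow> y < y' \<Longrightarrow> y' < \<zeta> (k + 1) \<Longrightarrow> y \<notin> D \<Longrightarrow> y' \<notin> D
        \<Longrightarrow> \<sigma> k * f y > 0 \<Longrightarrow> \<sigma> k * f y' \<ge> 0"
    and alt: "alternates m f D"
  shows "m \<le> 2 * n"
proof -
  obtain y C where y: "\<And>i. y i < y (Suc i)" "\<And>i. f (y i) * f (y (Suc i)) < 0" "\<And>i. y i \<notin> D"
    and C: "\<And>j. y (j * m) \<le> 2 * pi * real j + C"
    using alt unfolding alternates_def by blast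
  have "\<exists>k. \<zeta> k \<le> z \<and> z < \<zeta> (k + 1)" for z
    using int_block_exists[OF C0] n by simp
  then obtain K where K: "\<And>z. \<zeta> (K z) \<le> z \<and> z < \<zeta> (K z + 1)" by metis
  have mono': "\<zeta> k \<le> \<zeta> k'" if "k \<le> k'" for k k'
    using that by (induction k' rule: int_ge_induct) (auto intro: order_trans[OF _ mono])
  \<comment> \<open>The sign of \<open>f (y i)\<close> is that of \<open>\<sigma> (L i)\<close>, so \<open>L\<close> is strictly increasing.\<close>
  define L where "L = (\<lambda>i. if \<sigma> (K (y i)) * f (y i) > 0 then K (y i) else K (y i) - 1)"
  have step: "L i + 1 \<le> L (Suc i)" for i
  proof -
    define k where "k = K (y i)"
    define k' where "k' = K (y (Suc i))"
    have k: "\<zeta> k \<le> y i" "y i < \<zeta> (k + 1)" and k': "\<zeta> k' \<le> y (Suc i)" "y (Suc i) < \<zeta> (k' + 1)"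
      using K unfolding k_def k'_def by auto
    have "k \<le> k'"
    proof (rule ccontr)
      assume "\<not> k \<le> k'"
      then have "\<zeta> (k' + 1) \<le> \<zeta> k" by (intro mono') simp
      then show False using k k' y(1)[of i] by linarith
    qed
    then consider "k' = k" | "k' = k + 1" | "k' \<ge> k + 2" by linarith
    then show ?thesis
    proof cases
      case 1
      have "\<not> \<sigma> k * f (y i) > 0"
        using pat[of k "y i" "y (Suc i)"] k k' y[of i] y(3)[of "Suc i"] 1 \<sigma>(2)[of k]
        by (auto simp: zero_less_mult_iff mult_less_0_iff zero_le_mult_iff)
      moreover from this have "\<sigma> k * f (y (Suc i)) > 0"
        using y(2)[of i] \<sigma>(2)[of k] by (auto simp: zero_less_mult_iff mult_less_0_iff)
      ultimately show ?thesis using 1 unfolding L_def k_def k'_def by auto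
    next
      case 2
      have "\<sigma> k' * f (y (Suc i)) > 0" if "\<sigma> k * f (y i) > 0"
        using that y(2)[of i] \<sigma>(1)[of k] 2 by (auto simp: zero_less_mult_iff mult_less_0_iff)
      then show ?thesis using 2 unfolding L_def k_def k'_def by auto
    next
      case 3
      then show ?thesis unfolding L_def k_def k'_def by auto
    qed
  qed
  have L: "L 0 + int i \<le> L i" for i
  proof (induction i)
    case (Suc i)
    then show ?case using step[of i] by simp
  qed simp
  have "real (j * m) \<le> real (j * (2 * n)) + (real n * C / pi + C0 / (2 * pi) - real_of_int (L 0))" for j
  proof -
    have "L 0 + int (j * m) \<le> K (y (j * m))" using L[of "j * m"] unfolding L_def by (auto split: if_splits)
    then have 1: "real_of_int (L 0) + real (j * m) \<le> real_of_int (K (y (j * m)))" by linarith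
    have "\<zeta> (K (y (j * m))) \<le> 2 * pi * real j + C" using K C by (meson order_trans)
    then have "real n * \<zeta> (K (y (j * m))) \<le> real n * (2 * pi * real j + C)" by (intro mult_left_mono) auto
    moreover have "2 * pi * of_int (K (y (j * m))) \<le> 2 * (real n * \<zeta> (K (y (j * m)))) + C0"
      using C0[of "K (y (j * m))"] by (simp add: abs_le_iff algebra_simps)
    ultimately have "2 * pi * of_int (K (y (j * m))) \<le> 2 * (real n * (2 * pi * real j + C)) + C0" by linarith
    then have "of_int (K (y (j * m))) \<le> (2 * (real n * (2 * pi * real j + C)) + C0) / (2 * pi)"
      by (simp add: pos_le_divide_eq mult.commute)
    also have "\<dots> = real (j * (2 * n)) + (real n * C / pi + C0 / (2 * pi))"
      by (simp add: field_simps)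
    finally show ?thesis using 1 by linarith
  qed
  then show ?thesis by (rule linear_growth_le)
qed

lemma int_div_pred:
  fixes a N :: int assumes "N > 0"
  shows "a div N = (a - 1) div N + (if N dvd a then 1 else 0)"
proof -
  have 1: "a = N * (a div N) + a mod N" "0 \<le> a mod N" "a mod N < N" using assms by simp_all
  show ?thesis
  proof (cases "N dvd a")
    case True
    then have "(a - 1) div N = a div N - 1"
      using 1 assms by (intro int_div_pos_eq[of _ _ _ "N - 1"]) (auto simp: algebra_simps)
    then show ?thesis using True by simp
  next
    case False
    then have "a mod N \<ge> 1" using 1 by (simp add: dvd_eq_mod_eq_0)
    then have "(a - 1) div N = a div N"
      by (intro int_div_pos_eq[of _ _ _ "a mod N - 1"]) (use 1 in linarith)+
    then show ?thesis using False by simp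
  qed
qed

text \<open>The equality case of a density count: if \<open>k0\<close> were never followed directly
  by \<open>k0 + 1\<close> (modulo \<open>N\<close>), one of these two residues would be skipped in
  every period and the density could not reach 1.\<close>

lemma dense_sequence_covers_residues:
  fixes \<kappa> :: "nat \<Rightarrow> int" and N :: nat
  assumes inc: "\<And>i. \<kappa> i < \<kappa> (Suc i)" and C: "\<And>j. real_of_int (\<kappa> (j * N)) \<le> real (j * N) + C" and N: "N \<ge> 2"
  shows "\<exists>i. \<kappa> i mod int N = k0 mod int N \<and> \<kappa> (Suc i) = \<kappa> i + 1"
proof (rule ccontr)
  assume no: "\<not> ?thesis"
  \<comment> \<open>\<open>R\<close> counts the integers with \<open>k\<close> and \<open>k + 1\<close> identified whenever \<open>k = k0\<close> modulo \<open>N\<close>; it has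
    density less than 1 but still increases strictly along \<open>\<kappa>\<close>.\<close>
  define R where "R = (\<lambda>k::int. k - (k - k0 - 1) div int N)"
  have R1: "R (k + 1) = R k + (if int N dvd k - k0 then 0 else 1)" for k
    using int_div_pred[of "int N" "k - k0"] N unfolding R_def by auto
  have Rmono: "R k \<le> R k'" if "k \<le> k'" for k k'
    using that by (induction k' rule: int_ge_induct) (auto simp: R1)
  have step: "R (\<kappa> i) + 1 \<le> R (\<kappa> (Suc i))" for i
  proof (cases "int N dvd \<kappa> i - k0")
    case False
    then show ?thesis using R1[of "\<kappa> i"] Rmono[of "\<kappa> i + 1" "\<kappa> (Suc i)"] inc[of i] by simp
  next
    case True
    then have "\<kappa> i mod int N = k0 mod int N" by (simp add: mod_eq_dvd_iff)
    then have "\<kappa> (Suc i) \<noteq> \<kappa> i + 1" using no by auto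
    then have 2: "\<kappa> i + 2 \<le> \<kappa> (Suc i)" using inc[of i] by simp
    have "\<not> int N dvd (\<kappa> i + 1) - k0"
    proof
      assume "int N dvd (\<kappa> i + 1) - k0"
      then have "int N dvd ((\<kappa> i + 1) - k0) - (\<kappa> i - k0)" using True by (rule dvd_diff)
      then show False using N by simp
    qed
    then have "R (\<kappa> i + 1 + 1) = R (\<kappa> i) + 1" using R1[of "\<kappa> i + 1"] R1[of "\<kappa> i"] True by simp
    then show ?thesis using Rmono[OF 2] by (simp add: add.assoc)
  qed
  have R: "R (\<kappa> 0) + int i \<le> R (\<kappa> i)" for i
  proof (induction i)
    case (Suc i)
    then show ?case using step[of i] by simp
  qed simp
  define B where "B = \<bar>C\<bar> + of_int \<bar>k0\<bar> + 3 + of_int \<bar>R (\<kappa> 0)\<bar>"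
  have "real j \<le> B" for j
  proof -
    define k where "k = \<kappa> (j * N)"
    have "R (\<kappa> 0) + int (j * N) \<le> R k" using R unfolding k_def by blast
    then have 1: "of_int (R (\<kappa> 0)) + real (j * N) \<le> of_int (R k)" by linarith
    have "k - k0 - 1 = int N * ((k - k0 - 1) div int N) + (k - k0 - 1) mod int N" by simp
    moreover have "(k - k0 - 1) mod int N < int N" using N by simp
    ultimately have "k - k0 - 1 \<le> int N * ((k - k0 - 1) div int N) + int N" by linarith
    then have 2: "real_of_int k - k0 - 1 - N \<le> real N * of_int ((k - k0 - 1) div int N)"
      by (metis (mono_tags) add.commute diff_le_eq of_int_1 of_int_add of_int_diff of_int_le_iff of_int_mult of_int_of_nat_eq)
    define r where "r = real_of_int (R k)"
    have "r = of_int k - of_int ((k - k0 - 1) div int N)" unfolding r_def R_def by simp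
    then have "real N * r = real N * of_int k - real N * of_int ((k - k0 - 1) div int N)"
      by (simp only: right_diff_distrib)
    also have "\<dots> \<le> (real N - 1) * of_int k + k0 + 1 + N" using 2 by (simp add: algebra_simps)
    also have "\<dots> \<le> (real N - 1) * (real (j * N) + C) + k0 + 1 + N"
      using C[of j] N unfolding k_def by (intro add_right_mono mult_left_mono) auto
    finally have "real N * r \<le> (real N - 1) * (real (j * N) + C) + k0 + 1 + N" .
    moreover have "real N * (of_int (R (\<kappa> 0)) + real (j * N)) \<le> real N * r"
      using 1 unfolding r_def by (intro mult_left_mono) auto
    ultimately have "real N * of_int (R (\<kappa> 0)) + real N * real j \<le> (real N - 1) * C + k0 + 1 + N"
      by (simp add: algebra_simps)
    moreover have "(real N - 1) * C \<le> real N * \<bar>C\<bar>"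
    proof -
      have "(real N - 1) * C \<le> (real N - 1) * \<bar>C\<bar>" using N by (intro mult_left_mono) auto
      also have "\<dots> \<le> real N * \<bar>C\<bar>" by (intro mult_right_mono) auto
      finally show ?thesis .
    qed
    moreover have "real_of_int k0 \<le> real N * of_int \<bar>k0\<bar>" using N
      by (smt (verit) mult_le_cancel_right1 of_int_0_le_iff of_int_abs of_nat_1 of_nat_mono one_le_numeral order_trans)
    moreover have "- (real N * of_int (R (\<kappa> 0))) \<le> real N * of_int \<bar>R (\<kappa> 0)\<bar>"
      by (metis abs_ge_minus_self mult_left_mono mult_minus_right of_int_le_iff of_int_minus of_nat_0_le_iff)
    ultimately have "real N * real j \<le> real N * \<bar>C\<bar> + real N * of_int \<bar>k0\<bar> + 1 + N + real N * of_int \<bar>R (\<kappa> 0)\<bar>" by linarith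
    also have "\<dots> \<le> real N * B" using N unfolding B_def by (simp add: algebra_simps)
    finally show ?thesis using N by simp
  qed
  then show False using reals_Archimedean2[of B] by (meson not_le)
qed

text \<open>Sample points of opposite sign lie in different blocks, so \<open>2 * n\<close> changes
  per period visit the \<open>2 * n\<close> blocks at density 1. Hence for each \<open>k\<close> two
  neighbouring blocks carry nonzero values of opposite sign.\<close>

lemma alternates_all_blocks:
  fixes T e :: "int \<Rightarrow> real" and n :: nat
  assumes n: "n \<ge> 1" and T: "\<And>k. T k < T (k + 1)" "\<And>k. T (k + 2 * int n) = T k + 2 * pi"
    and e: "\<And>k. e (k + 2 * int n) = e k" "\<And>k. e k \<in> {1, - 1}"
    and f: "\<And>k y. T k \<le> y \<Longrightarrow> y < T (k + 1) \<Longrightarrow> y \<notin> D \<Longrightarrow> e k * f y \<ge> 0"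
    and alt: "alternates (2 * n) f D"
  shows "e (k + 1) = - e k" "\<exists>k' y. k' mod (2 * int n) = k mod (2 * int n) \<and> T k' \<le> y \<and> y < T (k' + 1) \<and> y \<notin> D \<and> f y \<noteq> 0"
proof -
  obtain y C where y: "\<And>i. y i < y (Suc i)" "\<And>i. f (y i) * f (y (Suc i)) < 0" "\<And>i. y i \<notin> D"
    and C: "\<And>j. y (j * (2 * n)) \<le> 2 * pi * real j + C"
    using alt unfolding alternates_def by blast
  obtain C0 where C0: "\<And>k. \<bar>real_of_int (2 * int n) * T k - 2 * pi * of_int k\<bar> \<le> C0"
    using period_bounded[of T "2 * int n"] T(2) n by auto
  have "\<exists>k. T k \<le> z \<and> z < T (k + 1)" for z
    using int_block_exists[OF C0] n by simp
  then obtain K where K: "\<And>z. T (K z) \<le> z \<and> z < T (K z + 1)" by metis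
  have mono': "T k \<le> T k'" if "k \<le> k'" for k k'
    using that by (induction k' rule: int_ge_induct) (auto intro: order_trans[OF _ less_imp_le[OF T(1)]])
  define \<kappa> where "\<kappa> = (\<lambda>i. K (y i))"
  have s: "e (\<kappa> i) * f (y i) > 0" for i
    using f[of "\<kappa> i" "y i"] K[of "y i"] y(2)[of i] y(3)[of i] e(2)[of "\<kappa> i"] unfolding \<kappa>_def
    by (auto simp: mult_less_0_iff)
  have inc: "\<kappa> i < \<kappa> (Suc i)" for i
  proof (rule ccontr)
    assume "\<not> \<kappa> i < \<kappa> (Suc i)"
    then consider "\<kappa> (Suc i) = \<kappa> i" | "\<kappa> (Suc i) + 1 \<le> \<kappa> i" by linarith
    then show False
    proof cases
      case 1
      then show False using s[of i] s[of "Suc i"] y(2)[of i] by (auto simp: zero_less_mult_iff mult_less_0_iff)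
    next
      case 2
      then show False using mono'[OF 2] K[of "y i"] K[of "y (Suc i)"] y(1)[of i] unfolding \<kappa>_def by linarith
    qed
  qed
  have dens: "real_of_int (\<kappa> (j * (2 * n))) \<le> real (j * (2 * n)) + (real n * C / pi + C0 / (2 * pi))" for j
  proof -
    have "T (\<kappa> (j * (2 * n))) \<le> 2 * pi * real j + C" using K C unfolding \<kappa>_def by (meson order_trans)
    then have "real n * T (\<kappa> (j * (2 * n))) \<le> real n * (2 * pi * real j + C)" by (intro mult_left_mono) auto
    moreover have "2 * pi * of_int (\<kappa> (j * (2 * n))) \<le> 2 * (real n * T (\<kappa> (j * (2 * n)))) + C0"
      using C0[of "\<kappa> (j * (2 * n))"] by (simp add: abs_le_iff algebra_simps)
    ultimately have "2 * pi * of_int (\<kappa> (j * (2 * n))) \<le> 2 * (real n * (2 * pi * real j + C)) + C0" by linarith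
    then have "of_int (\<kappa> (j * (2 * n))) \<le> (2 * (real n * (2 * pi * real j + C)) + C0) / (2 * pi)"
      by (simp add: pos_le_divide_eq mult.commute)
    also have "\<dots> = real (j * (2 * n)) + (real n * C / pi + C0 / (2 * pi))"
      by (simp add: field_simps)
    finally show ?thesis .
  qed
  obtain i where i: "\<kappa> i mod int (2 * n) = k mod int (2 * n)" "\<kappa> (Suc i) = \<kappa> i + 1"
    using dense_sequence_covers_residues[OF inc dens, of k] n by auto
  then have m: "\<kappa> i mod (2 * int n) = k mod (2 * int n)" by simp
  then have m': "(\<kappa> i + 1) mod (2 * int n) = (k + 1) mod (2 * int n)" by (metis mod_add_left_eq)
  have "e (\<kappa> (Suc i)) = - e (\<kappa> i)"
    using s[of i] s[of "Suc i"] y(2)[of i] e(2)[of "\<kappa> i"] e(2)[of "\<kappa> (Suc i)"]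
    by (auto simp: zero_less_mult_iff mult_less_0_iff)
  then show "e (k + 1) = - e k"
    using period_cong[of e "2 * int n", OF e(1) m] period_cong[of e "2 * int n", OF e(1) m'] i(2) by simp
  show "\<exists>k' y. k' mod (2 * int n) = k mod (2 * int n) \<and> T k' \<le> y \<and> y < T (k' + 1) \<and> y \<notin> D \<and> f y \<noteq> 0"
    using m K[of "y i"] y(3)[of i] y(2)[of i] unfolding \<kappa>_def
    by (intro exI[of _ "K (y i)"] exI[of _ "y i"]) auto
qed

text \<open>At least \<open>(m + 1) div 2\<close> of the \<open>m\<close> arcs share a sign. The
  rounding up is decisive: \<open>2 * n + 1\<close> zeros give \<open>2 * n + 2\<close> changes,
  whereas \<open>2 * n\<close> zeros give \<open>2 * n\<close>.\<close>

lemma zeros_alternate: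
  fixes h :: "real \<Rightarrow> real" and z :: "nat \<Rightarrow> real"
  assumes per: "\<And>x. h (x + 2 * pi) = h x"
    and z: "\<And>i. z i < z (Suc i)" "\<And>i. z (i + m) = z i + 2 * pi" "\<And>i. h (z i) = 0"
    and nonflat: "\<And>a b. a < b \<Longrightarrow> \<exists>x. a < x \<and> x < b \<and> h x \<noteq> 0"
    and m: "m \<ge> 1" "m + 1 \<ge> 2 * q"
  shows "\<exists>c. alternates (2 * q) (\<lambda>x. h x - c) {}"
proof -
  obtain a0 where a0: "\<And>i. z i < a0 i \<and> a0 i < z (Suc i) \<and> h (a0 i) \<noteq> 0"
    using nonflat[OF z(1)] by metis
  have zper: "z (i + m * l) = z i + 2 * pi * real l" for i l
  proof (induction l)
    case (Suc l)
    have "z (i + m * Suc l) = z ((i + m * l) + m)" by (simp add: algebra_simps)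
    also have "\<dots> = z (i + m * l) + 2 * pi" by (rule z(2))
    finally show ?case using Suc by (simp add: algebra_simps)
  qed simp
  have hper: "h (x + 2 * pi * real l) = h x" for x l
  proof (induction l)
    case (Suc l)
    have "h (x + 2 * pi * real (Suc l)) = h ((x + 2 * pi * real l) + 2 * pi)" by (simp add: algebra_simps)
    also have "\<dots> = h (x + 2 * pi * real l)" by (rule per)
    finally show ?case using Suc by simp
  qed simp
  \<comment> \<open>At least half of the arcs of \<open>h\<close> between its zeros have a common sign \<open>s\<close>; a small shift by
    \<open>s * d\<close> turns each of them into two sign changes.\<close>
  define A where "A = (\<lambda>s::real. {i. i < m \<and> s * h (a0 i) > 0})"
  have "A 1 \<union> A (- 1) = {..<m}" "A 1 \<inter> A (- 1) = {}" using a0 unfolding A_def by (auto simp: neq_iff)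
  moreover have finA: "finite (A s)" for s unfolding A_def by simp
  ultimately have card: "card (A 1) + card (A (- 1)) = m" by (metis card_Un_disjoint card_lessThan)
  obtain s where s: "s \<in> {1, - 1}" "2 * card (A s) \<ge> m"
  proof (cases "m \<le> 2 * card (A 1)")
    case True
    then show ?thesis using that[of 1] by simp
  next
    case False
    then show ?thesis using that[of "- 1"] card by simp
  qed
  define N where "N = card (A s)"
  have N: "N \<ge> 1" "N \<ge> q" using s(2) m unfolding N_def by auto
  have "\<exists>d>0. \<forall>i\<in>A s. d < s * h (a0 i)"
  proof (intro exI conjI ballI)
    have ne: "A s \<noteq> {}" using N(1) unfolding N_def by auto
    let ?d = "Min ((\<lambda>i. s * h (a0 i)) ` A s)"
    have "?d \<in> (\<lambda>i. s * h (a0 i)) ` A s" using ne finA by (intro Min_in) auto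
    then have "?d > 0" unfolding A_def by auto
    then show "?d / 2 > 0" by simp
    fix i assume "i \<in> A s"
    then have "?d \<le> s * h (a0 i)" using finA by (intro Min_le) auto
    then show "?d / 2 < s * h (a0 i)" using \<open>?d > 0\<close> by linarith
  qed
  then obtain d where d: "d > 0" "\<And>i. i \<in> A s \<Longrightarrow> d < s * h (a0 i)" by blast
  define l where "l = sorted_list_of_set (A s)"
  have l: "length l = N" "set l = A s" "sorted_wrt (<) l"
    unfolding l_def N_def using finA[of s] by auto
  have lA: "l ! j \<in> A s" if "j < N" for j using l that nth_mem by metis
  have lm: "l ! j < m" if "j < N" for j using lA[OF that] unfolding A_def by simp
  \<comment> \<open>The chosen arcs are repeated periodically; \<open>\<kappa> j\<close> is the
    index of the zero that precedes the \<open>j\<close>-th of them.\<close>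
  define \<kappa> where "\<kappa> = (\<lambda>j. l ! (j mod N) + m * (j div N))"
  have \<kappa>inc: "\<kappa> j < \<kappa> (Suc j)" for j
  proof (cases "Suc (j mod N) = N")
    case True
    then have "Suc j mod N = 0" "Suc j div N = Suc (j div N)" by (simp_all add: mod_Suc div_Suc)
    then show ?thesis unfolding \<kappa>_def using lm[of "j mod N"] N(1) by simp
  next
    case False
    then have lt: "Suc (j mod N) < N" using N(1) mod_less_divisor[of N j] by linarith
    then have "Suc j mod N = Suc (j mod N)" "Suc j div N = j div N" by (simp_all add: mod_Suc div_Suc)
    moreover have "l ! (j mod N) < l ! Suc (j mod N)"
      using sorted_wrt_nth_less[OF l(3), of "j mod N" "Suc (j mod N)"] lt l(1) by simp
    ultimately show ?thesis unfolding \<kappa>_def by simp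
  qed
  define a where "a = (\<lambda>j. a0 (l ! (j mod N)) + 2 * pi * real (j div N))"
  have a: "z (\<kappa> j) < a j" "a j < z (Suc (\<kappa> j))" "d < s * h (a j)" for j
  proof -
    have j: "j mod N < N" using N(1) by simp
    have 1: "z (\<kappa> j) = z (l ! (j mod N)) + 2 * pi * real (j div N)"
      "z (Suc (\<kappa> j)) = z (Suc (l ! (j mod N))) + 2 * pi * real (j div N)"
      unfolding \<kappa>_def using zper[of "l ! (j mod N)"] zper[of "Suc (l ! (j mod N))"] by auto
    show "z (\<kappa> j) < a j" "a j < z (Suc (\<kappa> j))" unfolding 1 a_def using a0 by auto
    show "d < s * h (a j)" unfolding a_def hper using d(2) lA[OF j] by simp
  qed
  have zmono: "z i \<le> z j" if "i \<le> j" for i j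
    using that z(1) by (simp add: lift_Suc_mono_le less_imp_le)
  \<comment> \<open>Zeros, where \<open>h - c\<close> has the sign of \<open>- s\<close>, alternate
    with arc points, where it has the sign of \<open>s\<close>.\<close>
  define y where "y = (\<lambda>i. if even i then z (\<kappa> (i div 2)) else a (i div 2))"
  define c where "c = s * d"
  have y_inc: "y i < y (Suc i)" for i
  proof (cases "even i")
    case True
    then show ?thesis unfolding y_def using a(1) by simp
  next
    case False
    then have "Suc i div 2 = Suc (i div 2)" by simp
    moreover have "z (Suc (\<kappa> (i div 2))) \<le> z (\<kappa> (Suc (i div 2)))" using \<kappa>inc by (intro zmono) (simp add: Suc_leI)
    ultimately show ?thesis unfolding y_def using False a(2)[of "i div 2"] by simp
  qed
  have ev: "s * (h (y i) - c) < 0" if "even i" for i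
    using that s(1) d(1) unfolding y_def c_def by (auto simp: z)
  have od: "s * (h (y i) - c) > 0" if "odd i" for i
    using that s(1) a(3)[of "i div 2"] unfolding y_def c_def by (auto simp: algebra_simps)
  have "(h (y i) - c) * (h (y (Suc i)) - c) < 0" for i
    using ev[of i] ev[of "Suc i"] od[of i] od[of "Suc i"] s(1)
    by (cases "even i") (auto simp: mult_less_0_iff)
  moreover have "y (j * (2 * q)) \<le> 2 * pi * real j + z (l ! 0)" for j
  proof -
    have *: "\<kappa> i \<le> \<kappa> i'" if "i \<le> i'" for i i'
      using that \<kappa>inc by (simp add: lift_Suc_mono_le less_imp_le)
    have "y (j * (2 * q)) = z (\<kappa> (j * q))" unfolding y_def by simp
    also have "\<dots> \<le> z (\<kappa> (j * N))" using N(2) by (intro zmono *) simp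
    also have "\<dots> = z (l ! 0) + 2 * pi * real j" unfolding \<kappa>_def using N(1) zper by simp
    finally show ?thesis by simp
  qed
  ultimately have "alternates (2 * q) (\<lambda>x. h x - c) {}" unfolding alternates_def using y_inc by blast
  then show ?thesis by blast
qed

section \<open>Auxiliary results for splines\<close>

definition v_shaped :: "real \<Rightarrow> real \<Rightarrow> (real \<Rightarrow> real) \<Rightarrow> real \<Rightarrow> bool" where
  "v_shaped a b F \<zeta> \<longleftrightarrow> a \<le> \<zeta> \<and> \<zeta> \<le> b \<and>
     (\<forall>x y. a \<le> x \<longrightarrow> x \<le> y \<longrightarrow> y \<le> \<zeta> \<longrightarrow> F y \<le> F x) \<and>
     (\<forall>x y. \<zeta> \<le> x \<longrightarrow> x \<le> y \<longrightarrow> y \<le> b \<longrightarrow> F x \<le> F y)"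

text \<open>Convexity in a form that tolerates finitely many points without derivative: \<zeta>
  separates the points with \<open>\<gamma> \<le> 0\<close> from those with
  \<open>\<gamma> \<ge> 0\<close>.\<close>

lemma convex_v_shape:
  fixes F \<gamma> :: "real \<Rightarrow> real"
  assumes ab: "a \<le> b" and S: "finite S" and cont: "continuous_on {a..b} F"
    and mono: "\<And>x y. a \<le> x \<Longrightarrow> x \<le> y \<Longrightarrow> y \<le> b \<Longrightarrow> \<gamma> x \<le> \<gamma> y"
    and deriv: "\<And>x. a < x \<Longrightarrow> x < b \<Longrightarrow> x \<notin> S \<Longrightarrow> (F has_real_derivative \<gamma> x) (at x)"
  shows "\<exists>\<zeta>. v_shaped a b F \<zeta>"
proof -
  obtain \<zeta> where \<zeta>: "a \<le> \<zeta>" "\<zeta> \<le> b" "\<And>x. a \<le> x \<Longrightarrow> x < \<zeta> \<Longrightarrow> \<gamma> x \<le> 0" "\<And>x. \<zeta> < x \<Longrightarrow> x \<le> b \<Longrightarrow> 0 \<le> \<gamma> x"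
  proof (cases "\<gamma> a \<le> 0")
    case True
    define Z where "Z = {x. a \<le> x \<and> x \<le> b \<and> \<gamma> x \<le> 0}"
    have Z: "a \<in> Z" "bdd_above Z" using True ab unfolding Z_def by (auto intro: bdd_aboveI[of _ b])
    show ?thesis
    proof
      show "a \<le> Sup Z" using Z by (rule cSup_upper)
      show "Sup Z \<le> b" using Z(1) by (intro cSup_least) (auto simp: Z_def)
      show "\<gamma> x \<le> 0" if x: "a \<le> x" "x < Sup Z" for x
      proof -
        obtain z where "z \<in> Z" "x < z" using x(2) less_cSupE Z(1) by (metis empty_iff)
        then show ?thesis using mono[of x z] x unfolding Z_def by auto
      qed
      show "0 \<le> \<gamma> x" if "Sup Z < x" "x \<le> b" for x
      proof (rule ccontr)
        assume "\<not> 0 \<le> \<gamma> x"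
        moreover have "a \<le> Sup Z" using Z by (rule cSup_upper)
        ultimately have "x \<in> Z" using that unfolding Z_def by auto
        then show False using cSup_upper[OF _ Z(2), of x] that by simp
      qed
    qed
  next
    case False
    show ?thesis
    proof (rule that[of a])
      show "0 \<le> \<gamma> x" if "a < x" "x \<le> b" for x using False mono[of a x] that by simp
    qed (use ab in auto)
  qed
  have "F y \<le> F x" if "a \<le> x" "x \<le> y" "y \<le> \<zeta>" for x y
  proof -
    have "(\<lambda>t. - F t) x \<le> (\<lambda>t. - F t) y"
    proof (rule nonneg_deriv_le_finite_exceptions[OF that(2) S])
      show "continuous_on {x..y} (\<lambda>t. - F t)"
        using that \<zeta> by (intro continuous_intros continuous_on_subset[OF cont]) auto
      fix t assume t: "x < t" "t < y" "t \<notin> S"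
      then have "((\<lambda>t. - F t) has_real_derivative - \<gamma> t) (at t)"
        using that \<zeta> by (intro DERIV_minus deriv) auto
      then show "\<exists>D\<ge>0. ((\<lambda>t. - F t) has_real_derivative D) (at t)"
        using \<zeta>(3)[of t] t that by (intro exI[of _ "- \<gamma> t"]) auto
    qed
    then show ?thesis by simp
  qed
  moreover have "F x \<le> F y" if "\<zeta> \<le> x" "x \<le> y" "y \<le> b" for x y
  proof (rule nonneg_deriv_le_finite_exceptions[OF that(2) S])
    show "continuous_on {x..y} F"
      using that \<zeta> by (intro continuous_on_subset[OF cont]) auto
    fix t assume t: "x < t" "t < y" "t \<notin> S"
    then show "\<exists>D\<ge>0. (F has_real_derivative D) (at t)"
      using \<zeta> that by (intro exI[of _ "\<gamma> t"] conjI deriv) auto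
  qed
  ultimately show ?thesis using \<zeta>(1,2) unfolding v_shaped_def by blast
qed

lemma constant_slope:
  fixes f :: "real \<Rightarrow> real"
  assumes "a \<le> z" "z \<le> w" "w \<le> b" "finite S" "continuous_on {a..b} f"
    and "\<And>t. a < t \<Longrightarrow> t < b \<Longrightarrow> t \<notin> S \<Longrightarrow> (f has_real_derivative c) (at t)"
  shows "f w - f z = c * (w - z)"
proof -
  have "\<bar>(\<lambda>t. f t - c * t) w - (\<lambda>t. f t - c * t) z\<bar> \<le> 0 * (w - z)"
  proof (rule deriv_bound_finite_exceptions[OF assms(2,4)])
    show "continuous_on {z..w} (\<lambda>t. f t - c * t)"
      using assms by (intro continuous_intros continuous_on_subset[OF assms(5)]) auto
    fix t assume "z < t" "t < w" "t \<notin> S"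
    then have "(f has_real_derivative c) (at t)" using assms by auto
    then have "((\<lambda>t. f t - c * t) has_real_derivative 0) (at t)" by (auto intro!: derivative_eq_intros)
    then show "\<exists>D. \<bar>D\<bar> \<le> 0 \<and> ((\<lambda>t. f t - c * t) has_real_derivative D) (at t)"
      by (intro exI[of _ 0]) auto
  qed
  then show ?thesis by (simp add: algebra_simps)
qed

text \<open>Injectivity forces a nonzero determinant, hence an inverse matrix. This is the dimension
  count behind the existence of the interpolant.\<close>

lemma square_system_solvable:
  fixes A :: "nat \<Rightarrow> nat \<Rightarrow> real"
  assumes inj: "\<And>p. (\<And>i. i < N \<Longrightarrow> (\<Sum>j<N. A i j * p j) = 0) \<Longrightarrow> (\<And>j. j < N \<Longrightarrow> p j = 0)"
  shows "\<exists>p. \<forall>i<N. (\<Sum>j<N. A i j * p j) = v i"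
proof -
  define B where "B = mat N N (\<lambda>(i, j). A i j)"
  have B: "B \<in> carrier_mat N N" unfolding B_def by simp
  have mult: "vec_index (B *\<^sub>v w) i = (\<Sum>j<N. A i j * vec_index w j)"
    if "w \<in> carrier_vec N" "i < N" for w i
    using that unfolding B_def
    by (simp add: scalar_prod_def atLeast0LessThan)
  have "det B \<noteq> 0"
  proof
    assume "det B = 0"
    then obtain w where w: "w \<in> carrier_vec N" "w \<noteq> 0\<^sub>v N" "B *\<^sub>v w = 0\<^sub>v N"
      using det_0_iff_vec_prod_zero[OF B] by blast
    have "vec_index w j = 0" if "j < N" for j
    proof (rule inj[OF _ that])
      fix i assume "i < N"
      then show "(\<Sum>j<N. A i j * vec_index w j) = 0" using mult[OF w(1), of i] w(3) by simp
    qed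
    then have "w = 0\<^sub>v N" using w(1) by (intro eq_vecI) auto
    then show False using w(2) by simp
  qed
  then obtain C where C: "C \<in> carrier_mat N N" "B * C = 1\<^sub>m N"
    using det_non_zero_imp_unit[OF B, of undefined] unfolding Units_def ring_mat_def by auto
  define w where "w = C *\<^sub>v Matrix.vec N v"
  have w: "w \<in> carrier_vec N" unfolding w_def using C by simp
  have "B *\<^sub>v w = (B * C) *\<^sub>v Matrix.vec N v"
    unfolding w_def by (rule assoc_mult_mat_vec[symmetric]) (use B C in auto)
  also have "\<dots> = Matrix.vec N v" unfolding C(2) by simp
  finally have "(\<Sum>j<N. A i j * vec_index w j) = v i" if "i < N" for i
    using mult[OF w that] that by simp
  then show ?thesis by blast
qed

text \<open>\<mu> is the mean of \<open>f\<close> over a period, the only obstruction to a periodic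
  antiderivative.\<close>

lemma periodic_antiderivative:
  fixes f :: "real \<Rightarrow> real"
  assumes cont: "\<And>x. isCont f x" and per: "\<And>x. f (x + 2 * pi) = f x"
  shows "\<exists>F \<mu>. (\<forall>x. F (x + 2 * pi) = F x) \<and> (\<forall>x. (F has_real_derivative f x - \<mu>) (at x))"
proof -
  have "\<exists>F. \<forall>x::real. (-\<infinity>) < ereal x \<longrightarrow> ereal x < \<infinity> \<longrightarrow> (F has_vector_derivative f x) (at x)"
    by (rule einterval_antiderivative) (auto intro: cont)
  then obtain F where F: "\<And>x. (F has_real_derivative f x) (at x)"
    by (auto simp: has_real_derivative_iff_has_vector_derivative)
  have "((\<lambda>x. F (x + 2 * pi) - F x) has_real_derivative 0) (at x)" for x
  proof -
    have "((\<lambda>x. F (x + 2 * pi)) has_real_derivative f x) (at x)"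
      using F[of "x + 2 * pi"] DERIV_shift[of F "f x" x "2 * pi"] per by simp
    then show ?thesis using DERIV_diff[OF _ F[of x]] by fastforce
  qed
  then have const: "F (x + 2 * pi) - F x = F (0 + 2 * pi) - F 0" for x
    by (metis (no_types, lifting) DERIV_isconst_all)
  define \<mu> where "\<mu> = (F (0 + 2 * pi) - F 0) / (2 * pi)"
  define G where "G = (\<lambda>x. F x - \<mu> * x)"
  have "G (x + 2 * pi) = G x" for x
  proof -
    have "\<mu> * (2 * pi) = F (x + 2 * pi) - F x" unfolding const[of x] \<mu>_def by simp
    then show ?thesis unfolding G_def by (simp add: algebra_simps)
  qed
  moreover have "(G has_real_derivative f x - \<mu>) (at x)" for x
    unfolding G_def using F[of x] by (auto intro!: derivative_eq_intros)
  ultimately show ?thesis by blast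
qed

text \<open>Means subtracted at later integrations vanish on differentiating back, so a single
  constant remains. For \<open>\<rho> = 0\<close> nothing is integrated and no correction
  arises.\<close>

lemma periodic_iterated_antiderivative:
  fixes f :: "real \<Rightarrow> real"
  assumes "\<And>x. isCont f x" and "\<And>x. f (x + 2 * pi) = f x"
  shows "\<exists>S \<mu>. (\<forall>x. S (x + 2 * pi) = S x) \<and> smooth_upto \<rho> S \<and> nderiv \<rho> S = (\<lambda>z. f z - \<mu>) \<and> (\<rho> = 0 \<longrightarrow> \<mu> = 0)"
  using assms
proof (induction \<rho> arbitrary: f)
  case 0
  then show ?case by (intro exI[of _ f] exI[of _ 0]) (auto simp: smooth_upto_def)
next
  case (Suc \<rho>)
  obtain F \<mu> where F: "\<And>x. F (x + 2 * pi) = F x" "\<And>x. (F has_real_derivative f x - \<mu>) (at x)"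
    using periodic_antiderivative[OF Suc.prems] by blast
  obtain S \<nu> where S: "\<And>x. S (x + 2 * pi) = S x" "smooth_upto \<rho> S" "nderiv \<rho> S = (\<lambda>z. F z - \<nu>)"
    using Suc.IH[of F] F DERIV_isCont by blast
  have d: "(nderiv \<rho> S has_real_derivative f x - \<mu>) (at x)" for x
    unfolding S(3) using F(2)[of x] by (auto intro!: derivative_eq_intros)
  then have "nderiv (Suc \<rho>) S = (\<lambda>z. f z - \<mu>)" by (intro ext) (simp add: DERIV_imp_deriv)
  moreover have "smooth_upto (Suc \<rho>) S"
    using S(2) d unfolding smooth_upto_def less_Suc_eq field_differentiable_def by blast
  ultimately show ?case using S(1) by blast
qed

lemma zero_set_alternates:
  fixes h :: "real \<Rightarrow> real"
  assumes per: "\<And>x. h (x + 2 * pi) = h x"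
    and nonflat: "\<And>a b. a < b \<Longrightarrow> \<exists>x. a < x \<and> x < b \<and> h x \<noteq> 0"
    and Z: "finite Z" "Z \<subseteq> {0..<2 * pi}" "\<And>z. z \<in> Z \<Longrightarrow> h z = 0"
    and card: "card Z \<ge> 1" "card Z + 1 \<ge> 2 * q"
  shows "\<exists>c. alternates (2 * q) (\<lambda>x. h x - c) {}"
proof -
  define m where "m = card Z"
  define l where "l = sorted_list_of_set Z"
  have l: "length l = m" "set l = Z" "sorted_wrt (<) l"
    unfolding l_def m_def using Z(1) by auto
  have m: "m \<ge> 1" using card m_def by simp
  have lZ: "l ! j \<in> Z" if "j < m" for j using l that nth_mem by metis
  define z where "z = (\<lambda>i. l ! (i mod m) + 2 * pi * real (i div m))"
  have hper: "h (x + 2 * pi * real k) = h x" for x k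
  proof (induction k)
    case (Suc k)
    have "h (x + 2 * pi * real (Suc k)) = h ((x + 2 * pi * real k) + 2 * pi)" by (simp add: algebra_simps)
    also have "\<dots> = h (x + 2 * pi * real k)" by (rule per)
    finally show ?case using Suc by simp
  qed simp
  show ?thesis
  proof (rule zeros_alternate[of h z m])
    show "z i < z (Suc i)" for i
    proof (cases "Suc (i mod m) = m")
      case True
      then have "Suc i mod m = 0" "Suc i div m = Suc (i div m)" by (simp_all add: mod_Suc div_Suc)
      moreover have "l ! (i mod m) < 2 * pi" "0 \<le> l ! 0" using lZ[of "i mod m"] lZ[of 0] m Z(2) by auto
      ultimately show ?thesis unfolding z_def by (simp add: algebra_simps)
    next
      case False
      then have lt: "Suc (i mod m) < m" using m mod_less_divisor[of m i] by linarith
      then have "Suc i mod m = Suc (i mod m)" "Suc i div m = i div m" by (simp_all add: mod_Suc div_Suc)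
      moreover have "l ! (i mod m) < l ! Suc (i mod m)"
        using sorted_wrt_nth_less[OF l(3), of "i mod m" "Suc (i mod m)"] lt l(1) by simp
      ultimately show ?thesis unfolding z_def by simp
    qed
    show "z (i + m) = z i + 2 * pi" for i unfolding z_def using m by (simp add: algebra_simps)
    show "h (z i) = 0" for i unfolding z_def hper using lZ[of "i mod m"] m Z(3) by simp
  qed (use per nonflat m card m_def in auto)
qed

lemma mono_glue:
  fixes f :: "real \<Rightarrow> real"
  assumes "\<And>x y. a \<le> x \<Longrightarrow> x \<le> y \<Longrightarrow> y \<le> b \<Longrightarrow> f x \<le> f y"
    and "\<And>x y. b \<le> x \<Longrightarrow> x \<le> y \<Longrightarrow> y \<le> c \<Longrightarrow> f x \<le> f y"
    and "a \<le> x" "x \<le> y" "y \<le> c"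
  shows "f x \<le> f y"
proof -
  consider "y \<le> b" | "b \<le> x" | "x \<le> b" "b \<le> y" by linarith
  then show ?thesis
  proof cases
    case 3
    then have "f x \<le> f b" "f b \<le> f y" using assms by auto
    then show ?thesis by simp
  qed (use assms in auto)
qed

lemma nderiv_diff3:
  assumes "smooth_upto k f" "smooth_upto k g" "smooth_upto k u"
  shows "smooth_upto k (\<lambda>x. f x - g x - l * u x)"
    "j \<le> k \<Longrightarrow> nderiv j (\<lambda>x. f x - g x - l * u x) = (\<lambda>x. nderiv j f x - nderiv j g x - l * nderiv j u x)"
proof -
  have fg: "smooth_upto k (\<lambda>x. 1 * f x + (- 1) * g x)" by (rule smooth_upto_lincomb[OF assms(1,2)])
  have eq: "(\<lambda>x. f x - g x - l * u x) = (\<lambda>x. 1 * (1 * f x + (- 1) * g x) + (- l) * u x)" by auto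
  show "smooth_upto k (\<lambda>x. f x - g x - l * u x)"
    unfolding eq by (rule smooth_upto_lincomb[OF fg assms(3)])
  show "nderiv j (\<lambda>x. f x - g x - l * u x) = (\<lambda>x. nderiv j f x - nderiv j g x - l * nderiv j u x)" if "j \<le> k"
    unfolding eq nderiv_lincomb[OF fg assms(3) that] nderiv_lincomb[OF assms(1,2) that] by auto
qed

lemma periodic_int_mult:
  fixes f :: "real \<Rightarrow> real"
  assumes "\<And>x. f (x + p) = f x"
  shows "f (x + p * of_int k) = f x"
proof -
  have "(\<lambda>i. f (x + p * of_int i)) (0 + 1 * k) = (\<lambda>i. f (x + p * of_int i)) 0 + 0 * of_int k"
  proof (rule period_mult)
    fix i :: int
    have "x + p * of_int (i + 1) = (x + p * of_int i) + p" by (simp add: algebra_simps)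
    then show "f (x + p * of_int (i + 1)) = f (x + p * of_int i) + 0" by (simp only: assms add_0_right)
  qed
  then show ?thesis by simp
qed

section \<open>The zero count\<close>

text \<open>
  The common shape of the ideal splines, with \<open>\<rho> = r - 2\<close> and breakpoints indexed by all
  integers.  On the two ramps \<open>(p k, q k)\<close> and \<open>(q' k, p' k)\<close> the derivative of order \<open>\<rho> + 1\<close> of
  \<open>\<phi>\<close> has slope \<open>e k\<close>, on the plateau \<open>(p' k, p (k + 1))\<close> it equals \<open>e k * N\<close>.  If the constraint
  of order \<open>\<rho>\<close> is active at \<open>k\<close>, the ramps are separated by the rest interval \<open>[q k, q' k]\<close>, on
  which the derivative of order \<open>\<rho>\<close> equals \<open>- e k * M\<close>; otherwise they form a single ramp.
\<close>

locale ramp_spline =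
  fixes n \<rho> :: nat and p q q' p' :: "int \<Rightarrow> real" and act :: "int \<Rightarrow> bool" and e :: "int \<Rightarrow> real"
    and M N :: real and \<phi> :: "real \<Rightarrow> real"
  assumes n: "n \<ge> 1" and M: "M > 0" and N: "N > 0"
    and order: "p k \<le> q k" "q k \<le> q' k" "q' k \<le> p' k" "p' k \<le> p (k + 1)"
    and p_per: "p (k + 2 * int n) = p k + 2 * pi" and q_per: "q (k + 2 * int n) = q k + 2 * pi"
    and q'_per: "q' (k + 2 * int n) = q' k + 2 * pi" and p'_per: "p' (k + 2 * int n) = p' k + 2 * pi"
    and act_per: "act (k + 2 * int n) = act k"
    and free: "\<not> act k \<Longrightarrow> q k = q' k" "\<not> act k \<Longrightarrow> p k < p' k"
    and active: "act k \<Longrightarrow> p k < q k" "act k \<Longrightarrow> q' k < p' k" "act k \<Longrightarrow> \<rho> \<ge> 1"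
    and e: "e (k + 1) = - e k" "e k \<in> {1, - 1}"
    and \<phi>_per: "\<phi> (x + 2 * pi) = \<phi> x" and \<phi>_smooth: "smooth_upto (Suc \<rho>) \<phi>"
    and \<phi>_cont: "isCont (nderiv (Suc \<rho>) \<phi>) x"
    and \<phi>_ramp: "p k < x \<Longrightarrow> x < q k \<Longrightarrow> (nderiv (Suc \<rho>) \<phi> has_real_derivative e k) (at x)"
      "q' k < x \<Longrightarrow> x < p' k \<Longrightarrow> (nderiv (Suc \<rho>) \<phi> has_real_derivative e k) (at x)"
    and \<phi>_plateau: "p' k < x \<Longrightarrow> x < p (k + 1) \<Longrightarrow> nderiv (Suc \<rho>) \<phi> x = e k * N"
    and \<phi>_rest: "act k \<Longrightarrow> q k \<le> x \<Longrightarrow> x \<le> q' k \<Longrightarrow> nderiv \<rho> \<phi> x = - e k * M"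
begin

text \<open>What the error estimate uses of a member of the class: a Lipschitz bound in place of the
  essential bound on the top derivative, and pointwise bounds for the others. The bound
  \<open>M\<close> is tied to the existence of an active index, so that the class without a
  constraint of order \<rho> fits too.\<close>

definition tame :: "(real \<Rightarrow> real) \<Rightarrow> bool" where
  "tame x \<longleftrightarrow> (\<forall>z. x (z + 2 * pi) = x z) \<and> smooth_upto (Suc \<rho>) x \<and>
     (\<forall>z w. \<bar>nderiv (Suc \<rho>) x w - nderiv (Suc \<rho>) x z\<bar> \<le> \<bar>w - z\<bar>) \<and>
     (\<forall>z. \<bar>nderiv (Suc \<rho>) x z\<bar> \<le> N) \<and> (\<forall>k z. act k \<longrightarrow> \<bar>nderiv \<rho> x z\<bar> \<le> M)"

text \<open>\<open>c\<close> and \<open>c'\<close> are the slopes before and after the rest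
  interval; at a free index they agree because the two ramps form one. Vanishing on the rest
  interval corresponds to the fixed value that \<phi> has there.\<close>

definition spl_pieces :: "(int \<Rightarrow> real) \<Rightarrow> (int \<Rightarrow> real) \<Rightarrow> (real \<Rightarrow> real) \<Rightarrow> bool" where
  "spl_pieces c c' w \<longleftrightarrow> (\<forall>k. c (k + 2 * int n) = c k \<and> c' (k + 2 * int n) = c' k \<and>
     (\<forall>z\<in>{p k<..<q k}. (w has_real_derivative c k) (at z)) \<and>
     (\<forall>z\<in>{q' k<..<p' k}. (w has_real_derivative c' k) (at z)) \<and>
     (\<forall>z\<in>{p' k<..<p (k + 1)}. (w has_real_derivative 0) (at z)) \<and>
     (act k \<longrightarrow> (\<forall>z\<in>{q k..q' k}. w z = 0)) \<and> (\<not> act k \<longrightarrow> c k = c' k))"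

definition spl :: "(real \<Rightarrow> real) \<Rightarrow> bool" where
  "spl s \<longleftrightarrow> (\<forall>z. s (z + 2 * pi) = s z) \<and> smooth_upto \<rho> s \<and> (\<forall>z. isCont (nderiv \<rho> s) z) \<and>
     (\<exists>c c'. spl_pieces c c' (nderiv \<rho> s))"

lemma two_n_pos: "(2::int) * int n > 0" "2 * n \<ge> 1"
  using n by auto

lemma p_bound: obtains C where "\<And>k. \<bar>real_of_int (2 * int n) * p k - 2 * pi * of_int k\<bar> \<le> C"
  using period_bounded[of p "2 * int n"] p_per two_n_pos by blast

lemma block_exists: "\<exists>k. p k \<le> z \<and> z < p (k + 1)"
  using p_bound int_block_exists two_n_pos by metis

lemma slope_ramp1: "p k \<le> z \<Longrightarrow> z \<le> w \<Longrightarrow> w \<le> q k \<Longrightarrow>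
    nderiv (Suc \<rho>) \<phi> w - nderiv (Suc \<rho>) \<phi> z = e k * (w - z)"
  by (rule constant_slope[of "p k" _ _ "q k" "{}"])
    (use \<phi>_ramp \<phi>_cont in \<open>auto simp: continuous_at_imp_continuous_on simp del: funpow.simps\<close>)

lemma slope_ramp2: "q' k \<le> z \<Longrightarrow> z \<le> w \<Longrightarrow> w \<le> p' k \<Longrightarrow>
    nderiv (Suc \<rho>) \<phi> w - nderiv (Suc \<rho>) \<phi> z = e k * (w - z)"
  by (rule constant_slope[of "q' k" _ _ "p' k" "{}"])
    (use \<phi>_ramp \<phi>_cont in \<open>auto simp: continuous_at_imp_continuous_on simp del: funpow.simps\<close>)

lemma slope_ramp: "\<not> act k \<Longrightarrow> p k \<le> z \<Longrightarrow> z \<le> w \<Longrightarrow> w \<le> p' k \<Longrightarrow>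
    nderiv (Suc \<rho>) \<phi> w - nderiv (Suc \<rho>) \<phi> z = e k * (w - z)"
proof (rule constant_slope[of "p k" _ _ "p' k" "{q k}"])
  fix t assume "\<not> act k" "p k < t" "t < p' k" "t \<notin> {q k}"
  then show "(nderiv (Suc \<rho>) \<phi> has_real_derivative e k) (at t)"
    using \<phi>_ramp[of k t] free[of k] by (cases "t < q k") (auto simp del: funpow.simps)
qed (use \<phi>_cont in \<open>auto simp: continuous_at_imp_continuous_on simp del: funpow.simps\<close>)

end

section \<open>The difference \<open>x - s - \<mu> * \<phi>\<close> and its sign changes\<close>

locale ramp_difference = ramp_spline +
  fixes x s :: "real \<Rightarrow> real" and \<mu> :: real and c c' :: "int \<Rightarrow> real"
  assumes x: "tame x" and s: "spl s" and pieces: "spl_pieces c c' (nderiv \<rho> s)" and \<mu>: "\<bar>\<mu>\<bar> > 1"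
begin

definition h :: "real \<Rightarrow> real" where "h = (\<lambda>z. x z - s z - \<mu> * \<phi> z)"

text \<open>Chosen so that \<open>\<sigma> k * \<mu> * e k = - \<bar>\<mu>\<bar>\<close>. In
  \<open>\<sigma> k * nderiv \<rho> h\<close> the term with \<phi> then contributes
  \<open>\<bar>\<mu>\<bar>\<close> to the second derivative on ramps,
  \<open>\<bar>\<mu>\<bar> * N\<close> to the first on plateaus and
  \<open>- \<bar>\<mu>\<bar> * M\<close> to the value on rests, each time outweighing
  \<open>x\<close>.\<close>

definition \<sigma> :: "int \<Rightarrow> real" where "\<sigma> k = - sgn \<mu> * e k"

text \<open>The derivative of \<open>\<sigma> k * nderiv \<rho> h\<close> where \<open>nderiv \<rho> s\<close> has slope \<open>d\<close>.\<close>

definition g :: "int \<Rightarrow> real \<Rightarrow> real \<Rightarrow> real" where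
  "g k d z = \<sigma> k * (nderiv (Suc \<rho>) x z - d - \<mu> * nderiv (Suc \<rho>) \<phi> z)"

lemma \<sigma>: "\<sigma> (k + 1) = - \<sigma> k" "\<sigma> k \<in> {1, - 1}" "\<sigma> k * \<mu> * e k = - \<bar>\<mu>\<bar>" "\<bar>\<sigma> k\<bar> = 1"
  using e[of k] \<mu> unfolding \<sigma>_def by (auto simp: sgn_if)

lemma x_facts: "smooth_upto (Suc \<rho>) x" "\<bar>nderiv (Suc \<rho>) x w - nderiv (Suc \<rho>) x z\<bar> \<le> \<bar>w - z\<bar>"
    "\<bar>nderiv (Suc \<rho>) x z\<bar> \<le> N" "act k \<Longrightarrow> \<bar>nderiv \<rho> x z\<bar> \<le> M" "x (z + 2 * pi) = x z"
  using x unfolding tame_def by blast+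

lemma s_facts: "s (z + 2 * pi) = s z" "smooth_upto \<rho> s" "isCont (nderiv \<rho> s) z"
    "p k < z \<Longrightarrow> z < q k \<Longrightarrow> (nderiv \<rho> s has_real_derivative c k) (at z)"
    "q' k < z \<Longrightarrow> z < p' k \<Longrightarrow> (nderiv \<rho> s has_real_derivative c' k) (at z)"
    "p' k < z \<Longrightarrow> z < p (k + 1) \<Longrightarrow> (nderiv \<rho> s has_real_derivative 0) (at z)"
    "act k \<Longrightarrow> q k \<le> z \<Longrightarrow> z \<le> q' k \<Longrightarrow> nderiv \<rho> s z = 0" "\<not> act k \<Longrightarrow> c k = c' k"
  using s pieces unfolding spl_def spl_pieces_def by auto

lemma h_facts: "smooth_upto \<rho> h"
    "nderiv \<rho> h = (\<lambda>z. nderiv \<rho> x z - nderiv \<rho> s z - \<mu> * nderiv \<rho> \<phi> z)" "h (z + 2 * pi) = h z"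
  using nderiv_diff3[of \<rho> x s \<phi>, where l = \<mu>] smooth_upto_mono[OF x_facts(1), of \<rho>] smooth_upto_mono[OF \<phi>_smooth, of \<rho>] s_facts(2)
  unfolding h_def by (auto simp: x_facts(5) s_facts(1) \<phi>_per)

lemma h_cont: "isCont (nderiv \<rho> h) z"
  unfolding h_facts(2)
  using smooth_upto_isCont[OF x_facts(1), of \<rho> z] smooth_upto_isCont[OF \<phi>_smooth, of \<rho> z] s_facts(3)[of z]
  by (intro continuous_intros) auto

lemma h_deriv: "(nderiv \<rho> s has_real_derivative d) (at z) \<Longrightarrow>
    ((\<lambda>z. \<sigma> k * (nderiv \<rho> h z - c0)) has_real_derivative g k d z) (at z)"
  unfolding h_facts(2) g_def
  using smooth_uptoD[OF x_facts(1), of \<rho> z] smooth_uptoD[OF \<phi>_smooth, of \<rho> z]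
  by (auto intro!: derivative_eq_intros simp del: funpow.simps)

text \<open>The term with \<phi> contributes exactly \<open>\<bar>\<mu>\<bar>\<close> to the slope,
  \<open>x\<close> at least -1 by its Lipschitz bound, and \<open>d\<close> cancels.\<close>

lemma g_growth:
  assumes "z \<le> w" "nderiv (Suc \<rho>) \<phi> w - nderiv (Suc \<rho>) \<phi> z = e k * (w - z)"
  shows "g k d w - g k d z \<ge> (\<bar>\<mu>\<bar> - 1) * (w - z)"
proof -
  have "g k d w - g k d z = \<sigma> k * (nderiv (Suc \<rho>) x w - nderiv (Suc \<rho>) x z)
      - \<sigma> k * \<mu> * (nderiv (Suc \<rho>) \<phi> w - nderiv (Suc \<rho>) \<phi> z)"
    unfolding g_def by (simp only: algebra_simps)
  also have "\<dots> = \<sigma> k * (nderiv (Suc \<rho>) x w - nderiv (Suc \<rho>) x z) + \<bar>\<mu>\<bar> * (w - z)"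
    using \<sigma>(3)[of k] unfolding assms(2) by (simp add: mult.assoc[symmetric])
  moreover have "\<bar>\<sigma> k * (nderiv (Suc \<rho>) x w - nderiv (Suc \<rho>) x z)\<bar> \<le> w - z"
    using x_facts(2)[of w z] \<sigma>(4) assms(1) by (simp add: abs_mult del: funpow.simps)
  ultimately show ?thesis by (simp add: algebra_simps abs_le_iff del: funpow.simps)
qed

lemma g_mono:
  assumes "z \<le> w" "nderiv (Suc \<rho>) \<phi> w - nderiv (Suc \<rho>) \<phi> z = e k * (w - z)"
  shows "g k d z \<le> g k d w"
proof -
  have "0 \<le> (\<bar>\<mu>\<bar> - 1) * (w - z)" using \<mu> assms by simp
  then show ?thesis using g_growth[OF assms, of d] by linarith
qed

lemma g_strict_mono:
  assumes "z < w" "nderiv (Suc \<rho>) \<phi> w - nderiv (Suc \<rho>) \<phi> z = e k * (w - z)"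
  shows "g k d z < g k d w"
proof -
  have "0 < (\<bar>\<mu>\<bar> - 1) * (w - z)" using \<mu> assms by simp
  then show ?thesis using g_growth[of z w k d] assms by simp
qed

lemma g_plateau: "p' k < z \<Longrightarrow> z < p (k + 1) \<Longrightarrow> g k 0 z > 0"
proof -
  assume "p' k < z" "z < p (k + 1)"
  then have "nderiv (Suc \<rho>) \<phi> z = e k * N" by (rule \<phi>_plateau)
  then have "g k 0 z = \<sigma> k * nderiv (Suc \<rho>) x z + \<bar>\<mu>\<bar> * N"
    using \<sigma>(3)[of k] unfolding g_def by (simp add: algebra_simps del: funpow.simps)
  moreover have "\<bar>\<sigma> k * nderiv (Suc \<rho>) x z\<bar> \<le> N"
    using x_facts(3)[of z] \<sigma>(4) by (simp add: abs_mult del: funpow.simps)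
  moreover have "N < \<bar>\<mu>\<bar> * N" using \<mu> N by simp
  ultimately show ?thesis by linarith
qed

lemma h_rest: "act k \<Longrightarrow> q k \<le> z \<Longrightarrow> z \<le> q' k \<Longrightarrow> \<sigma> k * nderiv \<rho> h z < 0"
proof -
  assume z: "act k" "q k \<le> z" "z \<le> q' k"
  then have "\<sigma> k * nderiv \<rho> h z = \<sigma> k * nderiv \<rho> x z - \<bar>\<mu>\<bar> * M"
    using \<sigma>(3)[of k] unfolding h_facts(2) by (simp add: s_facts(7) \<phi>_rest algebra_simps)
  moreover have "\<bar>\<sigma> k * nderiv \<rho> x z\<bar> \<le> M" using x_facts(4)[OF z(1)] \<sigma>(4) by (simp add: abs_mult)
  moreover have "M < \<bar>\<mu>\<bar> * M" using \<mu> M by simp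
  ultimately show ?thesis by linarith
qed

text \<open>Provides a nonzero value between neighbouring zeros. On a flat interval the derivatives
  of \<open>h\<close> would vanish, against strict growth of \<open>g\<close> on ramps, its
  positivity on plateaus and the negative sign on rests.\<close>

lemma h_nonflat:
  assumes "a < b" shows "\<exists>z. a < z \<and> z < b \<and> h z \<noteq> 0"
proof (rule ccontr)
  assume no: "\<not> ?thesis"
  have D0: "nderiv j h z = 0" if "a < z" "z < b" for j z
    by (rule nderiv_zero_on_open[of "{a<..<b}"]) (use no that in auto)
  have g0: "g k d z = 0" if "a < z" "z < b" "(nderiv \<rho> s has_real_derivative d) (at z)" for k d z
  proof -
    have "((\<lambda>z. \<sigma> k * (nderiv \<rho> h z - 0)) has_real_derivative g k d z) (at z)"
      by (rule h_deriv[OF that(3)])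
    moreover have "((\<lambda>z. \<sigma> k * (nderiv \<rho> h z - 0)) has_real_derivative 0) (at z)"
      by (rule has_field_derivative_transform_within_open[of "\<lambda>z. 0" _ _ "{a<..<b}"])
        (use D0 that in auto)
    ultimately show ?thesis by (rule DERIV_unique)
  qed
  define m where "m = (a + b) / 2"
  have m: "a < m" "m < b" using assms by (auto simp: m_def)
  obtain k where k: "p k \<le> m" "m < p (k + 1)" using block_exists by blast
  consider "m < q k" | "q k \<le> m" "m < q' k" | "q' k \<le> m" "m < p' k" | "p' k \<le> m" by linarith
  then show False
  proof cases
    case 1
    obtain w where w: "m < w" "w < min b (q k)" using dense[of m "min b (q k)"] m 1 by auto
    obtain z where z: "m < z" "z < w" using dense[OF w(1)] by blast
    have "g k (c k) z < g k (c k) w"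
      by (rule g_strict_mono[OF z(2)], rule slope_ramp1) (use k w z in auto)
    moreover have "g k (c k) z = 0" "g k (c k) w = 0"
      using w z m k by (auto intro!: g0 s_facts(4))
    ultimately show False by simp
  next
    case 2
    then have "act k" using free(1)[of k] by force
    then show False using h_rest[of k m] 2 D0[of m \<rho>] m by simp
  next
    case 3
    obtain w where w: "m < w" "w < min b (p' k)" using dense[of m "min b (p' k)"] m 3 by auto
    obtain z where z: "m < z" "z < w" using dense[OF w(1)] by blast
    have "g k (c' k) z < g k (c' k) w"
      by (rule g_strict_mono[OF z(2)], rule slope_ramp2) (use 3 w z in auto)
    moreover have "g k (c' k) z = 0" "g k (c' k) w = 0"
      using w z m 3 by (auto intro!: g0 s_facts(5))
    ultimately show False by simp
  next
    case 4
    obtain z where z: "m < z" "z < min b (p (k + 1))" using dense[of m "min b (p (k + 1))"] m k by auto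
    have "g k 0 z > 0" using g_plateau[of k z] 4 z by simp
    moreover have "g k 0 z = 0" using z m 4 by (auto intro!: g0 s_facts(6)[of k])
    ultimately show False by simp
  qed
qed

text \<open>Two points instead of one, since on a rest interval only the sign of
  \<open>\<sigma> k * nderiv \<rho> h\<close> is known, not its monotonicity.\<close>

definition turning :: "real \<Rightarrow> int \<Rightarrow> real \<Rightarrow> real \<Rightarrow> bool" where
  "turning c0 k \<zeta>m \<zeta>p \<longleftrightarrow> p k \<le> \<zeta>m \<and> \<zeta>m \<le> \<zeta>p \<and> \<zeta>p \<le> p' k \<and>
    (\<forall>y z. p k \<le> y \<longrightarrow> y \<le> z \<longrightarrow> z \<le> \<zeta>m \<longrightarrow> \<sigma> k * (nderiv \<rho> h z - c0) \<le> \<sigma> k * (nderiv \<rho> h y - c0)) \<and>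
    (\<forall>y z. \<zeta>p \<le> y \<longrightarrow> y \<le> z \<longrightarrow> z \<le> p' k \<longrightarrow> \<sigma> k * (nderiv \<rho> h y - c0) \<le> \<sigma> k * (nderiv \<rho> h z - c0)) \<and>
    (\<zeta>m = \<zeta>p \<or> (\<forall>z. \<zeta>m \<le> z \<longrightarrow> z \<le> \<zeta>p \<longrightarrow> \<sigma> k * (nderiv \<rho> h z - c0) \<le> 0))"

lemma turning_points:
  assumes c0: "\<forall>k. act k \<longrightarrow> c0 = 0"
  shows "\<exists>\<zeta>m \<zeta>p. turning c0 k \<zeta>m \<zeta>p"
proof -
  let ?F = "\<lambda>z. \<sigma> k * (nderiv \<rho> h z - c0)"
  have cont: "continuous_on A ?F" for A
    using h_cont by (intro continuous_intros) (simp add: continuous_at_imp_continuous_on)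
  show ?thesis
  proof (cases "act k")
    case False
    have "(?F has_real_derivative g k (c k) t) (at t)" if "p k < t" "t < p' k" "t \<notin> {q k}" for t
      using s_facts(4,5)[of k t] s_facts(8)[of k] that free(1)[OF False] False
      by (intro h_deriv) (cases "t < q k"; simp)
    then have "\<exists>\<zeta>. v_shaped (p k) (p' k) ?F \<zeta>"
      using free(2)[OF False] g_mono[OF _ slope_ramp[OF False]]
      by (intro convex_v_shape[of _ _ "{q k}" _ "g k (c k)"] cont) auto
    then obtain \<zeta> where "v_shaped (p k) (p' k) ?F \<zeta>" ..
    then show ?thesis unfolding v_shaped_def turning_def by (intro exI[of _ \<zeta>]) auto
  next
    case True
    have "\<exists>\<zeta>. v_shaped (p k) (q k) ?F \<zeta>"
      using order[of k] g_mono[OF _ slope_ramp1] h_deriv[OF s_facts(4)]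
      by (intro convex_v_shape[of _ _ "{}" _ "g k (c k)"] cont) auto
    then obtain \<zeta>1 where 1: "v_shaped (p k) (q k) ?F \<zeta>1" ..
    have "\<exists>\<zeta>. v_shaped (q' k) (p' k) ?F \<zeta>"
      using order[of k] g_mono[OF _ slope_ramp2] h_deriv[OF s_facts(5)]
      by (intro convex_v_shape[of _ _ "{}" _ "g k (c' k)"] cont) auto
    then obtain \<zeta>2 where 2: "v_shaped (q' k) (p' k) ?F \<zeta>2" ..
    have rest: "?F z \<le> 0" if "q k \<le> z" "z \<le> q' k" for z
    proof -
      have "c0 = 0" using c0 True by blast
      then show ?thesis using h_rest[OF True that] by simp
    qed
    \<comment> \<open>Between the two minima the values are bounded by those at the ends
      \<open>q k\<close> and \<open>q' k\<close> of the rest interval, or belong to that interval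
      themselves.\<close>
    have neg: "?F z \<le> 0" if "\<zeta>1 \<le> z" "z \<le> \<zeta>2" for z
    proof -
      consider "z \<le> q k" | "q k \<le> z" "z \<le> q' k" | "q' k \<le> z" by linarith
      then show ?thesis
      proof cases
        case 1
        then have "?F z \<le> ?F (q k)" using that \<open>v_shaped (p k) (q k) ?F \<zeta>1\<close> unfolding v_shaped_def by blast
        also have "\<dots> \<le> 0" using order[of k] by (intro rest) auto
        finally show ?thesis .
      next
        case 3
        then have "?F z \<le> ?F (q' k)" using that 2 unfolding v_shaped_def by blast
        also have "\<dots> \<le> 0" using order[of k] by (intro rest) auto
        finally show ?thesis .
      qed (rule rest)
    qed
    have "\<zeta>1 \<le> \<zeta>2" using 1 2 order[of k] unfolding v_shaped_def by linarith
    then have "turning c0 k \<zeta>1 \<zeta>2"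
      using 1 2 neg unfolding turning_def v_shaped_def
      by (elim conjE, intro conjI disjI2 allI impI) (assumption | simp)+
    then show ?thesis by blast
  qed
qed

lemma plateau_mono:
  assumes "p' k \<le> y" "y \<le> z" "z \<le> p (k + 1)"
  shows "\<sigma> k * (nderiv \<rho> h y - c0) \<le> \<sigma> k * (nderiv \<rho> h z - c0)"
proof (rule nonneg_deriv_le_finite_exceptions[OF assms(2), of "{}" "\<lambda>z. \<sigma> k * (nderiv \<rho> h z - c0)"])
  show "continuous_on {y..z} (\<lambda>z. \<sigma> k * (nderiv \<rho> h z - c0))"
    using h_cont by (intro continuous_intros) (simp add: continuous_at_imp_continuous_on)
  fix t assume t: "y < t" "t < z"
  have "((\<lambda>z. \<sigma> k * (nderiv \<rho> h z - c0)) has_real_derivative g k 0 t) (at t)"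
    by (rule h_deriv, rule s_facts(6)[of k]) (use t assms in auto)
  moreover have "g k 0 t \<ge> 0" using g_plateau[of k t] t assms by simp
  ultimately show "\<exists>D\<ge>0. ((\<lambda>z. \<sigma> k * (nderiv \<rho> h z - c0)) has_real_derivative D) (at t)" by blast
qed simp

text \<open>Blocks are cut at the points \<open>\<zeta>p k\<close>: from there
  \<open>\<sigma> k * (nderiv \<rho> h z - c0)\<close> increases through the plateau up to
  \<open>\<zeta>m (k + 1)\<close>, and from \<open>\<zeta>m (k + 1)\<close> to
  \<open>\<zeta>p (k + 1)\<close> it is nonnegative because
  \<open>\<sigma> (k + 1) = - \<sigma> k\<close>.\<close>

lemma h_alternates_le:
  assumes c0: "\<forall>k. act k \<longrightarrow> c0 = 0" and alt: "alternates m (\<lambda>z. nderiv \<rho> h z - c0) {}"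
  shows "m \<le> 2 * n"
proof -
  obtain \<zeta>m \<zeta>p where tp: "\<And>k. turning c0 k (\<zeta>m k) (\<zeta>p k)"
    using turning_points[OF c0] by metis
  have \<zeta>: "p k \<le> \<zeta>m k" "\<zeta>m k \<le> \<zeta>p k" "\<zeta>p k \<le> p' k"
    "p k \<le> y \<Longrightarrow> y \<le> z \<Longrightarrow> z \<le> \<zeta>m k \<Longrightarrow> \<sigma> k * (nderiv \<rho> h z - c0) \<le> \<sigma> k * (nderiv \<rho> h y - c0)"
    "\<zeta>p k \<le> y \<Longrightarrow> y \<le> z \<Longrightarrow> z \<le> p' k \<Longrightarrow> \<sigma> k * (nderiv \<rho> h y - c0) \<le> \<sigma> k * (nderiv \<rho> h z - c0)"
    "\<zeta>m k \<noteq> \<zeta>p k \<Longrightarrow> \<zeta>m k \<le> z \<Longrightarrow> z \<le> \<zeta>p k \<Longrightarrow> \<sigma> k * (nderiv \<rho> h z - c0) \<le> 0" for k y z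
    using tp[of k] unfolding turning_def by blast+
  have mono: "\<sigma> k * (nderiv \<rho> h y - c0) \<le> \<sigma> k * (nderiv \<rho> h z - c0)"
    if "\<zeta>p k \<le> y" "y \<le> z" "z \<le> \<zeta>m (k + 1)" for k y z
  proof (rule mono_glue[of "\<zeta>p k" "p' k" _ "\<zeta>m (k + 1)", where f = "\<lambda>z. \<sigma> k * (nderiv \<rho> h z - c0)"])
    fix y z assume a: "p' k \<le> y" "y \<le> z" "z \<le> \<zeta>m (k + 1)"
    show "\<sigma> k * (nderiv \<rho> h y - c0) \<le> \<sigma> k * (nderiv \<rho> h z - c0)"
      by (rule mono_glue[of "p' k" "p (k + 1)" _ "\<zeta>m (k + 1)", where f = "\<lambda>z. \<sigma> k * (nderiv \<rho> h z - c0)"])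
        (use a plateau_mono[of k _ _ c0] \<zeta>(4)[of "k + 1"] \<sigma>(1)[of k] in \<open>auto simp: algebra_simps\<close>)
  qed (use that \<zeta>(5) in auto)
  obtain C where C: "\<And>k. \<bar>real_of_int (2 * int n) * p k - 2 * pi * of_int k\<bar> \<le> C"
    using p_bound by blast
  show ?thesis
  proof (rule alternates_le_pattern[of n \<zeta>p "C + 2 * pi" \<sigma>])
    \<comment> \<open>\<open>\<zeta>p k\<close> lies between \<open>p k\<close> and
      \<open>p (k + 1)\<close>, whose reference values \<open>2 * pi * k\<close> differ by
      \<open>2 * pi\<close>.\<close>
    show "\<bar>real_of_int (2 * int n) * \<zeta>p k - 2 * pi * of_int k\<bar> \<le> C + 2 * pi" for k
    proof -
      have *: "\<bar>b - d\<bar> \<le> C + 2 * pi"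
        if "a \<le> b" "b \<le> c" "d' = d + 2 * pi" "\<bar>a - d\<bar> \<le> C" "\<bar>c - d'\<bar> \<le> C" for a b c d d' :: real
        using that pi_gt_zero by linarith
      have "p k \<le> \<zeta>p k" "\<zeta>p k \<le> p (k + 1)" using \<zeta>(1-3)[of k] order[of k] by linarith+
      then show ?thesis
        by (intro *[OF _ _ _ C[of k] C[of "k + 1"]] mult_left_mono) (simp_all add: algebra_simps)
    qed
    show "\<zeta>p k \<le> \<zeta>p (k + 1)" for k using \<zeta>(1,2)[of "k + 1"] \<zeta>(3)[of k] order(4)[of k] by linarith
    show "\<sigma> (k + 1) = - \<sigma> k" "\<sigma> k \<noteq> 0" for k using \<sigma>(1,2)[of k] by auto
    show "0 \<le> \<sigma> k * (nderiv \<rho> h y' - c0)"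
      if "\<zeta>p k \<le> y" "y < y'" "y' < \<zeta>p (k + 1)" "0 < \<sigma> k * (nderiv \<rho> h y - c0)" for k y y'
    proof (cases "y' \<le> \<zeta>m (k + 1)")
      case True
      then show ?thesis using mono[of k y y'] that by simp
    next
      case False
      then show ?thesis using \<zeta>(6)[of "k + 1" y'] that \<sigma>(1)[of k] by simp
    qed
  qed (use n alt in auto)
qed

lemma card_zeros_le:
  assumes Z: "finite Z" "Z \<subseteq> {0..<2 * pi}" "\<And>z. z \<in> Z \<Longrightarrow> h z = 0"
  shows "card Z \<le> 2 * n"
proof (rule ccontr)
  assume no: "\<not> ?thesis"
  obtain d where d: "alternates (2 * (n + 1)) (\<lambda>z. h z - d) {}"
    using zero_set_alternates[OF h_facts(3) h_nonflat Z, of "n + 1"] no n by auto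
  have "alternates (2 * (n + 1)) (\<lambda>z. nderiv \<rho> h z - (if \<rho> = 0 then d else 0)) {}"
    by (rule alternates_nderiv[OF h_facts(1) d]) auto
  \<comment> \<open>For \<open>\<rho> = 0\<close> the shift \<open>d\<close> is still present, but
    then \<open>active(3)\<close> excludes active indices.\<close>
  then have "2 * (n + 1) \<le> 2 * n"
    by (rule h_alternates_le[rotated]) (use active(3) in auto)
  then show False by simp
qed

end

section \<open>Error estimate and uniqueness of the interpolating spline\<close>

context ramp_spline
begin

lemma tame_zero: "tame (\<lambda>z. 0)"
  using smooth_upto_const[of "Suc \<rho>" 0] N M unfolding tame_def nderiv_const by auto

lemma spl_lincomb:
  assumes "spl s1" "spl s2"
  shows "spl (\<lambda>z. a * s1 z + b * s2 z)"
proof -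
  obtain c1 c1' where 1: "spl_pieces c1 c1' (nderiv \<rho> s1)" using assms unfolding spl_def by blast
  obtain c2 c2' where 2: "spl_pieces c2 c2' (nderiv \<rho> s2)" using assms unfolding spl_def by blast
  have sm: "smooth_upto \<rho> s1" "smooth_upto \<rho> s2" using assms unfolding spl_def by auto
  have D: "((\<lambda>x. a * nderiv \<rho> s1 x + b * nderiv \<rho> s2 x) has_real_derivative a * d1 + b * d2) (at z)"
    if "(nderiv \<rho> s1 has_real_derivative d1) (at z)" "(nderiv \<rho> s2 has_real_derivative d2) (at z)" for d1 d2 z
    using that by (auto intro!: derivative_eq_intros)
  have "spl_pieces (\<lambda>k. a * c1 k + b * c2 k) (\<lambda>k. a * c1' k + b * c2' k) (nderiv \<rho> (\<lambda>z. a * s1 z + b * s2 z))"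
    using 1 2 D D[of 0 _ 0] unfolding spl_pieces_def nderiv_lincomb[OF sm order_refl] by simp
  moreover have "isCont (nderiv \<rho> (\<lambda>z. a * s1 z + b * s2 z)) z" for z
    using assms unfolding nderiv_lincomb[OF sm order_refl] spl_def by (auto intro!: continuous_intros)
  ultimately show ?thesis
    using assms smooth_upto_lincomb[OF sm] unfolding spl_def by (auto simp del: funpow.simps)
qed

theorem interpolation_error_le:
  assumes x: "tame x" and s: "spl s" and U: "finite U" "U \<subseteq> {0..<2 * pi}" "card U = 2 * n"
    and eq: "\<And>z. z \<in> U \<Longrightarrow> x z = s z" "\<And>z. z \<in> U \<Longrightarrow> \<phi> z = 0" and \<tau>: "\<tau> \<in> {0..<2 * pi}"
  shows "\<bar>x \<tau> - s \<tau>\<bar> \<le> \<bar>\<phi> \<tau>\<bar>"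
proof (rule ccontr)
  assume no: "\<not> ?thesis"
  then have "\<tau> \<notin> U" using eq by auto
  then have card: "card (insert \<tau> U) = 2 * n + 1" using U by simp
  have Z: "finite (insert \<tau> U)" "insert \<tau> U \<subseteq> {0..<2 * pi}" using U \<tau> by auto
  have zero: "spl (\<lambda>z. 0)" using spl_lincomb[OF s s, of 0 0] by simp
  show False
  proof (cases "\<phi> \<tau> = 0")
    case True
    \<comment> \<open>No quotient can be formed. Instead \<phi> itself would have
      \<open>2 * n + 1\<close> zeros, which the count excludes with \<open>x = 0\<close>,
      \<open>s = 0\<close> and the factor 2, an arbitrary choice of modulus above 1.\<close>
    obtain c c' where "spl_pieces c c' (nderiv \<rho> (\<lambda>z. 0))" using zero unfolding spl_def by blast
    then interpret ramp_difference n \<rho> p q q' p' act e M N \<phi> "\<lambda>z. 0" "\<lambda>z. 0" 2 c c'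
      by unfold_locales (use tame_zero zero in auto)
    show False using card_zeros_le[OF Z] card True eq unfolding h_def by auto
  next
    case False
    define \<mu> where "\<mu> = (x \<tau> - s \<tau>) / \<phi> \<tau>"
    obtain c c' where "spl_pieces c c' (nderiv \<rho> s)" using s unfolding spl_def by blast
    then interpret ramp_difference n \<rho> p q q' p' act e M N \<phi> x s \<mu> c c'
      by unfold_locales (use x s no False in \<open>auto simp: \<mu>_def abs_divide\<close>)
    have "h z = 0" if "z \<in> insert \<tau> U" for z
      using that eq False unfolding h_def unfolding \<mu>_def by auto
    then show False using card_zeros_le[OF Z] card by simp
  qed
qed

theorem spl_unique:
  assumes s: "spl s1" "spl s2" and U: "finite U" "U \<subseteq> {0..<2 * pi}" "card U = 2 * n"
    and eq: "\<And>z. z \<in> U \<Longrightarrow> s1 z = s2 z" "\<And>z. z \<in> U \<Longrightarrow> \<phi> z = 0"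
  shows "s1 = s2"
proof
  fix z
  have *: "s1 \<tau> = s2 \<tau>" if \<tau>: "\<tau> \<in> {0..<2 * pi}" for \<tau>
  proof (rule ccontr)
    assume ne: "s1 \<tau> \<noteq> s2 \<tau>"
    \<comment> \<open>Scales the difference to the value
      \<open>\<bar>\<phi> \<tau>\<bar> + 1\<close> at \<tau>, one more than the estimate
      permits.\<close>
    define K where "K = (\<bar>\<phi> \<tau>\<bar> + 1) / (s1 \<tau> - s2 \<tau>)"
    have "\<bar>0 - (K * s1 \<tau> + (- K) * s2 \<tau>)\<bar> \<le> \<bar>\<phi> \<tau>\<bar>"
      by (rule interpolation_error_le[OF tame_zero spl_lincomb[OF s] U _ _ \<tau>]) (use eq in auto)
    moreover have "K * s1 \<tau> + (- K) * s2 \<tau> = K * (s1 \<tau> - s2 \<tau>)" by (simp add: algebra_simps)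
    moreover have "K * (s1 \<tau> - s2 \<tau>) = \<bar>\<phi> \<tau>\<bar> + 1" unfolding K_def using ne by simp
    ultimately show False by simp
  qed
  define k where "k = \<lfloor>z / (2 * pi)\<rfloor>"
  have "z - 2 * pi * of_int k \<in> {0..<2 * pi}"
  proof -
    have "of_int k \<le> z / (2 * pi)" "z / (2 * pi) < of_int k + 1" unfolding k_def by linarith+
    then show ?thesis by (simp add: field_simps)
  qed
  from *[OF this] show "s1 z = s2 z"
    using periodic_int_mult[of s1 "2 * pi" "z - 2 * pi * of_int k" k]
      periodic_int_mult[of s2 "2 * pi" "z - 2 * pi * of_int k" k] s unfolding spl_def by simp
qed

end

section \<open>Existence of the interpolating spline\<close>

definition unit_ramp :: "real \<Rightarrow> real \<Rightarrow> real \<Rightarrow> real" where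
  "unit_ramp a b z = max 0 (min 1 ((z - a) / (b - a)))"

lemma unit_ramp_le: "a < b \<Longrightarrow> z \<le> a \<Longrightarrow> unit_ramp a b z = 0"
  and unit_ramp_ge: "a < b \<Longrightarrow> b \<le> z \<Longrightarrow> unit_ramp a b z = 1"
  and unit_ramp_mid: "a \<le> z \<Longrightarrow> z \<le> b \<Longrightarrow> a < b \<Longrightarrow> unit_ramp a b z = (z - a) / (b - a)"
  unfolding unit_ramp_def by (auto simp: divide_le_0_iff field_simps max_def min_def)

lemma unit_ramp_cont: "a < b \<Longrightarrow> continuous_on A (unit_ramp a b)"
  unfolding unit_ramp_def by (intro continuous_intros) auto

lemma unit_ramp_shift: "unit_ramp (a + d) (b + d) (z + d) = unit_ramp a b z"
  unfolding unit_ramp_def by simp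

context ramp_spline
begin

text \<open>Start of the rise to the plateau value \<open>P k\<close>; \<open>dn\<close> is the end
  of the descent from \<open>P (k - 1)\<close>. At an active index the two leave room for the rest
  interval, at a free one both span the whole ramp and add up to one linear piece.\<close>

definition up :: "int \<Rightarrow> real" where "up k = (if act k then q' k else p k)"
definition dn :: "int \<Rightarrow> real" where "dn k = (if act k then q k else p' k)"

text \<open>
  The continuous piecewise linear function with value \<open>P k\<close> on the plateau \<open>[p' k, p (k + 1)]\<close>
  that vanishes on the rest intervals; \<open>interp_piece P k\<close> is its restriction to \<open>[p k, p (k + 1)]\<close>.
\<close>

definition interp_piece :: "(int \<Rightarrow> real) \<Rightarrow> int \<Rightarrow> real \<Rightarrow> real" where
  "interp_piece P k z = P (k - 1) * (1 - unit_ramp (p k) (dn k) z) + P k * unit_ramp (up k) (p' k) z"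

definition block :: "real \<Rightarrow> int" where "block z = (SOME k. p k \<le> z \<and> z < p (k + 1))"

definition interp :: "(int \<Rightarrow> real) \<Rightarrow> real \<Rightarrow> real" where
  "interp P z = interp_piece P (block z) z"

lemma p_less: "p k < p' k" "p k < p (k + 1)" "p k < dn k" "up k < p' k" "p k \<le> up k" "dn k \<le> p' k"
  using order[of k] free[of k] active[of k] unfolding up_def dn_def by (cases "act k"; force)+

lemma p_mono: "k \<le> k' \<Longrightarrow> p k \<le> p k'"
  by (induction k' rule: int_ge_induct) (auto intro: order_trans[OF _ less_imp_le[OF p_less(2)]])

lemma block: "p (block z) \<le> z" "z < p (block z + 1)"
  using someI_ex[OF block_exists, of z] unfolding block_def by auto

lemma block_eq: "p k \<le> z \<Longrightarrow> z < p (k + 1) \<Longrightarrow> block z = k"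
proof (rule ccontr)
  assume z: "p k \<le> z" "z < p (k + 1)" and "block z \<noteq> k"
  then consider "block z + 1 \<le> k" | "k + 1 \<le> block z" by linarith
  then show False
    using z block[of z] p_mono[of "block z + 1" k] p_mono[of "k + 1" "block z"] by cases auto
qed

lemma interp_piece_end: "interp_piece P k (p (k + 1)) = P k" "interp_piece P k (p k) = P (k - 1)"
  using p_less[of k] order[of k] unfolding interp_piece_def
  by (simp_all add: unit_ramp_le unit_ramp_ge)

lemma interp_eq: "p k \<le> z \<Longrightarrow> z \<le> p (k + 1) \<Longrightarrow> interp P z = interp_piece P k z"
proof (cases "z = p (k + 1)")
  case True
  have "block z = k + 1" using p_less(2)[of "k + 1"] by (intro block_eq) (auto simp: True)
  then show ?thesis unfolding interp_def using interp_piece_end[of P] True by simp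
qed (auto simp: interp_def block_eq)

lemma interp_cont: "isCont (interp P) z"
proof -
  define k where "k = block z"
  have piece: "continuous_on {p j..p (j + 1)} (interp P)" for j
  proof -
    have "continuous_on {p j..p (j + 1)} (interp_piece P j)"
      unfolding interp_piece_def using p_less[of j] by (intro continuous_intros unit_ramp_cont)
    then show ?thesis using interp_eq[of j] by (subst continuous_on_cong[OF refl, of _ _ "interp_piece P j"]) auto
  qed
  have "continuous_on ({p (k - 1)..p k} \<union> {p k..p (k + 1)}) (interp P)"
    using piece[of "k - 1"] piece[of k] by (intro continuous_on_closed_Un) auto
  moreover have "{p (k - 1)..p k} \<union> {p k..p (k + 1)} = {p (k - 1)..p (k + 1)}"
    using p_mono[of "k - 1" k] p_mono[of k "k + 1"] by (intro ivl_disj_un_two_touch) auto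
  ultimately have "continuous_on {p (k - 1)..p (k + 1)} (interp P)" by simp
  then show ?thesis
    by (rule continuous_on_interior)
      (use block[of z] p_less(2)[of "k - 1"] in \<open>auto simp: k_def interior_atLeastAtMost_real\<close>)
qed

lemma interp_deriv:
  assumes ab: "p k \<le> a" "b \<le> p (k + 1)" "a < z" "z < b"
    and affine: "\<And>t. a < t \<Longrightarrow> t < b \<Longrightarrow> interp_piece P k t = C + d * t"
  shows "(interp P has_real_derivative d) (at z)"
  by (rule has_field_derivative_transform_within_open[of "\<lambda>t. C + d * t" _ _ "{a<..<b}"])
    (use assms interp_eq[of k _ P] in \<open>auto intro!: derivative_eq_intros\<close>)

lemma interp_pieces:
  assumes P: "\<And>k. P (k + 2 * int n) = P k"
  shows "\<exists>c c'. spl_pieces c c' (interp P)"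
proof -
  define c where "c = (\<lambda>k. if act k then - P (k - 1) / (q k - p k) else (P k - P (k - 1)) / (p' k - p k))"
  define c' where "c' = (\<lambda>k. if act k then P k / (p' k - q' k) else (P k - P (k - 1)) / (p' k - p k))"
  have free_ramp: "(interp P has_real_derivative (P k - P (k - 1)) / (p' k - p k)) (at z)"
    if "\<not> act k" "p k < z" "z < p' k" for k z
    by (rule interp_deriv[of k "p k" "p' k" _ _ "P (k - 1) - (P k - P (k - 1)) / (p' k - p k) * p k"])
      (use that p_less[of k] order[of k] in
        \<open>auto simp: interp_piece_def up_def dn_def unit_ramp_mid divide_inverse algebra_simps\<close>)
  have "(interp P has_real_derivative c k) (at z)" if "z \<in> {p k<..<q k}" for k z
  proof (cases "act k")
    case True
    have "(interp P has_real_derivative - P (k - 1) / (q k - p k)) (at z)"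
      by (rule interp_deriv[of k "p k" "q k" _ _ "P (k - 1) + P (k - 1) / (q k - p k) * p k"])
        (use that True p_less[of k] order[of k] in
          \<open>auto simp: interp_piece_def up_def dn_def unit_ramp_mid unit_ramp_le divide_inverse algebra_simps\<close>)
    then show ?thesis using True by (simp add: c_def)
  next
    case False
    then show ?thesis using free_ramp[of k z] that order[of k] by (simp add: c_def)
  qed
  moreover have "(interp P has_real_derivative c' k) (at z)" if "z \<in> {q' k<..<p' k}" for k z
  proof (cases "act k")
    case True
    have "(interp P has_real_derivative P k / (p' k - q' k)) (at z)"
      by (rule interp_deriv[of k "q' k" "p' k" _ _ "- (P k / (p' k - q' k) * q' k)"])
        (use that True p_less[of k] order[of k] in
          \<open>auto simp: interp_piece_def up_def dn_def unit_ramp_mid unit_ramp_ge divide_inverse algebra_simps\<close>)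
    then show ?thesis using True by (simp add: c'_def)
  next
    case False
    then show ?thesis using free_ramp[of k z] that order[of k] by (simp add: c'_def)
  qed
  moreover have "(interp P has_real_derivative 0) (at z)" if "z \<in> {p' k<..<p (k + 1)}" for k z
    by (rule interp_deriv[of k "p' k" "p (k + 1)" _ _ "P k"])
      (use that p_less[of k] order[of k] in \<open>auto simp: interp_piece_def unit_ramp_ge\<close>)
  moreover have "interp P z = 0" if "act k" "z \<in> {q k..q' k}" for k z
  proof -
    have "interp P z = interp_piece P k z" using that order[of k] by (intro interp_eq) auto
    also have "\<dots> = 0"
      using that p_less[of k] unfolding interp_piece_def up_def dn_def by (simp add: unit_ramp_ge unit_ramp_le)
    finally show ?thesis .
  qed
  moreover have "c (k + 2 * int n) = c k" "c' (k + 2 * int n) = c' k" for k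
  proof -
    have "k + 2 * int n - 1 = (k - 1) + 2 * int n" by simp
    then have "P (k + 2 * int n - 1) = P (k - 1)" using P by metis
    then show "c (k + 2 * int n) = c k" "c' (k + 2 * int n) = c' k"
      unfolding c_def c'_def by (simp_all only: P p_per q_per q'_per p'_per act_per add_diff_cancel_right)
  qed
  ultimately have "spl_pieces c c' (interp P)"
    unfolding spl_pieces_def by (auto simp: c_def c'_def)
  then show ?thesis by blast
qed

lemma interp_periodic:
  assumes "\<And>k. P (k + 2 * int n) = P k"
  shows "interp P (z + 2 * pi) = interp P z"
proof -
  define k where "k = block z"
  have k: "p k \<le> z" "z < p (k + 1)" using block unfolding k_def by auto
  have p1: "p (k + 2 * int n + 1) = p (k + 1) + 2 * pi"
    using p_per[of "k + 1"] by (simp add: algebra_simps)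
  have "interp P (z + 2 * pi) = interp_piece P (k + 2 * int n) (z + 2 * pi)"
    using k by (intro interp_eq) (auto simp: p_per p1)
  also have "\<dots> = interp_piece P k z"
  proof -
    have "k + 2 * int n - 1 = (k - 1) + 2 * int n" by simp
    then have "P (k + 2 * int n - 1) = P (k - 1)" using assms by metis
    then show ?thesis
      unfolding interp_piece_def up_def dn_def
      by (cases "act k") (simp_all only: p_per q_per q'_per p'_per act_per assms unit_ramp_shift if_True if_False)
  qed
  also have "\<dots> = interp P z" using k by (intro interp_eq[symmetric]) auto
  finally show ?thesis .
qed

text \<open>Unknowns are the \<open>2 * n\<close> plateau values and an additive constant; equations
  are the interpolation conditions and \<open>row w = 0\<close>. By \<open>spl_unique\<close> zero
  data force zero unknowns, so the square system is solvable.\<close>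

theorem spl_interpolation:
  fixes u :: "nat \<Rightarrow> real"
  assumes u: "inj_on u {1..2 * n}" "u ` {1..2 * n} \<subseteq> {0..<2 * pi}"
    and \<phi>u: "\<And>k. k \<in> {1..2 * n} \<Longrightarrow> \<phi> (u k) = 0"
  shows "\<exists>s. spl s \<and> (\<forall>k\<in>{1..2 * n}. s (u k) = v k)"
proof -
  define \<delta> where "\<delta> = (\<lambda>(j::nat) (k::int). if k mod (2 * int n) = int j then 1 else (0::real))"
  have \<delta>_per: "\<delta> j (k + 2 * int n) = \<delta> j k" for j k unfolding \<delta>_def by simp
  define Q where "Q = (\<lambda>j S \<mu>. (\<forall>x. S (x + 2 * pi) = S x) \<and> smooth_upto \<rho> S \<and>
      nderiv \<rho> S = (\<lambda>z. interp (\<delta> j) z - \<mu>) \<and> (\<rho> = 0 \<longrightarrow> \<mu> = 0))"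
  have "\<exists>S \<mu>. Q j S \<mu>" for j
    unfolding Q_def by (intro periodic_iterated_antiderivative interp_cont interp_periodic \<delta>_per)
  then obtain S \<mu> where Q: "\<And>j. Q j (S j) (\<mu> j)" by metis
  have S: "S j (x + 2 * pi) = S j x" "smooth_upto \<rho> (S j)"
      "nderiv \<rho> (S j) = (\<lambda>z. interp (\<delta> j) z - \<mu> j)" "\<rho> = 0 \<Longrightarrow> \<mu> j = 0" for j x
    using Q[of j] unfolding Q_def by blast+
  define s where "s = (\<lambda>(w::nat \<Rightarrow> real) z. (\<Sum>j<2 * n. w j * S j z) + w (2 * n))"
  define W where "W = (\<lambda>(w::nat \<Rightarrow> real) (k::int). w (nat (k mod (2 * int n))))"
  have n2: "k mod (2 * int n) < 2 * int n" "0 \<le> k mod (2 * int n)" for k using two_n_pos by auto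
  have W_per: "W w (k + 2 * int n) = W w k" for w k unfolding W_def by simp
  have W_sum: "W w k = (\<Sum>j<2 * n. w j * \<delta> j k)" for w k
  proof -
    have "(\<Sum>j<2 * n. w j * \<delta> j k) = (\<Sum>j<2 * n. if j = nat (k mod (2 * int n)) then w j else 0)"
      unfolding \<delta>_def using n2[of k] by (intro sum.cong) auto
    also have "\<dots> = W w k" unfolding W_def using n2[of k] by (simp add: nat_less_iff)
    finally show ?thesis by simp
  qed
  have interp_sum: "interp (W w) z = (\<Sum>j<2 * n. w j * interp (\<delta> j) z)" for w z
    unfolding interp_def interp_piece_def W_sum
    by (simp add: sum_distrib_left sum_distrib_right sum.distrib sum_subtractf algebra_simps)
  \<comment> \<open>For \<open>\<rho> \<ge> 1\<close> the condition \<open>row w = 0\<close> makes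
    the mean corrections \<open>\<mu> j\<close> cancel, so that \<open>nderiv \<rho> (s w)\<close>
    is exactly \<open>interp (W w)\<close>. For \<open>\<rho> = 0\<close> there are no corrections,
    but the additive constant would disturb this identity and is set to 0.\<close>
  define row where "row = (\<lambda>w::nat \<Rightarrow> real. if \<rho> = 0 then w (2 * n) else (\<Sum>j<2 * n. \<mu> j * w j))"
  have sum_smooth: "smooth_upto \<rho> (\<lambda>z. \<Sum>j<2 * n. w j * S j z)"
    "nderiv \<rho> (\<lambda>z. \<Sum>j<2 * n. w j * S j z) = (\<lambda>z. \<Sum>j<2 * n. w j * nderiv \<rho> (S j) z)" for w
    using smooth_upto_sum[of "{..<2 * n}" \<rho> S w] S(2) by auto
  have s_eq: "s w = (\<lambda>z. 1 * (\<Sum>j<2 * n. w j * S j z) + 1 * w (2 * n))" for w unfolding s_def by simp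
  have s_smooth: "smooth_upto \<rho> (s w)" for w
    unfolding s_eq by (rule smooth_upto_lincomb[OF sum_smooth(1) smooth_upto_const])
  have s_deriv: "nderiv \<rho> (s w) = interp (W w)" if "row w = 0" for w
  proof
    fix z
    have "nderiv \<rho> (s w) z = (\<Sum>j<2 * n. w j * (interp (\<delta> j) z - \<mu> j)) + (if \<rho> = 0 then w (2 * n) else 0)"
      unfolding s_eq nderiv_lincomb[OF sum_smooth(1) smooth_upto_const order_refl] sum_smooth(2)
      by (simp add: S(3) nderiv_const)
    also have "\<dots> = interp (W w) z"
      using that unfolding interp_sum row_def
      by (auto simp: S(4) algebra_simps sum_subtractf split: if_splits)
    finally show "nderiv \<rho> (s w) z = interp (W w) z" .
  qed
  have s_per: "s w (z + 2 * pi) = s w z" for w z unfolding s_def S(1) ..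
  have s_spl: "spl (s w)" if "row w = 0" for w
    unfolding spl_def s_deriv[OF that]
    by (intro conjI allI s_per s_smooth interp_cont interp_pieces W_per)
  define A where "A = (\<lambda>i j. if i < 2 * n then (if j < 2 * n then S j (u (i + 1)) else 1)
      else if \<rho> = 0 then (if j < 2 * n then 0 else 1) else (if j < 2 * n then \<mu> j else 0))"
  have A: "(\<Sum>j<2 * n + 1. A i j * w j) = (if i < 2 * n then s w (u (i + 1)) else row w)" for i w
    unfolding A_def s_def row_def by (simp add: mult.commute)
  have U: "finite (u ` {1..2 * n})" "card (u ` {1..2 * n}) = 2 * n"
    using u(1) by (auto simp: card_image)
  have zero_spl: "spl (\<lambda>z. 0)"
    using s_spl[of "\<lambda>_. 0"] unfolding s_def row_def by simp
  have "\<exists>w. \<forall>i<2 * n + 1. (\<Sum>j<2 * n + 1. A i j * w j) = (if i < 2 * n then v (i + 1) else 0)"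
  proof (rule square_system_solvable)
    fix w j assume *: "\<And>i. i < 2 * n + 1 \<Longrightarrow> (\<Sum>j<2 * n + 1. A i j * w j) = 0" and j: "j < 2 * n + 1"
    have row: "row w = 0" using *[of "2 * n"] unfolding A by simp
    have su: "s w (u k) = 0" if k: "k \<in> {1..2 * n}" for k
    proof -
      obtain i where "k = Suc i" "i < 2 * n" using k by (cases k) auto
      then show ?thesis using *[of i] unfolding A by simp
    qed
    have s0: "s w = (\<lambda>z. 0)"
      by (rule spl_unique[OF s_spl[OF row] zero_spl U(1) u(2) U(2)]) (use su \<phi>u in auto)
    then have "interp (W w) z = 0" for z
      using s_deriv[OF row] by (metis nderiv_const)
    \<comment> \<open>At the right end of a block the interpolant takes its plateau value, so the
      coefficients can be read off.\<close>
    moreover have "interp (W w) (p (k + 1)) = W w k" for k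
      using interp_eq[of k "p (k + 1)"] p_less(2)[of k] interp_piece_end by simp
    ultimately have "W w k = 0" for k by metis
    then have w0: "w i = 0" if "i < 2 * n" for i
      using that unfolding W_def by (metis int_ops(2) mod_pos_pos_trivial nat_int of_nat_0_le_iff of_nat_less_iff of_nat_mult of_nat_numeral)
    have "s w 0 = w (2 * n)" unfolding s_def using w0 by simp
    then show "w j = 0" using s0 w0[of j] j by (cases "j = 2 * n") auto
  qed
  then obtain w where w: "\<And>i. i < 2 * n + 1 \<Longrightarrow>
      (if i < 2 * n then s w (u (i + 1)) else row w) = (if i < 2 * n then v (i + 1) else 0)"
    unfolding A by blast
  have "row w = 0" using w[of "2 * n"] by simp
  moreover have "s w (u k) = v k" if k: "k \<in> {1..2 * n}" for k
  proof -
    obtain i where "k = Suc i" "i < 2 * n" using k by (cases k) auto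
    then show ?thesis using w[of i] by simp
  qed
  ultimately show ?thesis using s_spl by blast
qed

end

section \<open>The recovery problem for ramp splines\<close>

lemma periodic_range_finite:
  fixes T :: "int \<Rightarrow> real"
  assumes "\<And>k. T (k + N) = T k + 2 * pi" "N > 0"
  shows "finite (range T \<inter> {a..b})"
proof -
  obtain C where C: "\<And>k. \<bar>of_int N * T k - 2 * pi * of_int k\<bar> \<le> C"
    using period_bounded[of T N] assms by blast
  have N: "real_of_int N > 0" using assms(2) by simp
  have "range T \<inter> {a..b} \<subseteq> T ` {\<lfloor>(of_int N * a - C) / (2 * pi)\<rfloor>..\<lceil>(of_int N * b + C) / (2 * pi)\<rceil>}"
  proof
    fix z assume "z \<in> range T \<inter> {a..b}"
    then obtain k where k: "z = T k" "a \<le> T k" "T k \<le> b" by auto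
    have "of_int N * a \<le> of_int N * T k" "of_int N * T k \<le> of_int N * b" using k N by (auto intro: mult_left_mono)
    then have "of_int N * a - C \<le> 2 * pi * of_int k" "2 * pi * of_int k \<le> of_int N * b + C"
      using C[of k] by linarith+
    then have "(of_int N * a - C) / (2 * pi) \<le> of_int k" "of_int k \<le> (of_int N * b + C) / (2 * pi)"
      by (simp_all add: field_simps)
    then have "\<lfloor>(of_int N * a - C) / (2 * pi)\<rfloor> \<le> k" "k \<le> \<lceil>(of_int N * b + C) / (2 * pi)\<rceil>"
      by linarith+
    then show "z \<in> T ` {\<lfloor>(of_int N * a - C) / (2 * pi)\<rfloor>..\<lceil>(of_int N * b + C) / (2 * pi)\<rceil>}" using k by auto
  qed
  then show ?thesis by (rule finite_subset) simp
qed

lemma periodic_int_bounded: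
  fixes c :: "int \<Rightarrow> real"
  assumes "\<And>k. c (k + N) = c k" "N > 0"
  shows "\<exists>L. \<forall>k. \<bar>c k\<bar> \<le> L"
proof -
  have "\<bar>c k\<bar> \<le> (\<Sum>r\<in>{0..<N}. \<bar>c r\<bar>)" for k
  proof -
    have "c k = c (k mod N)" by (rule period_cong[of c N]) (simp_all add: assms(1))
    moreover have "\<bar>c (k mod N)\<bar> \<le> (\<Sum>r\<in>{0..<N}. \<bar>c r\<bar>)"
      by (rule member_le_sum[of "k mod N" _ "\<lambda>r. \<bar>c r\<bar>"]) (use assms(2) in auto)
    ultimately show ?thesis by simp
  qed
  then show ?thesis by blast
qed

lemma L_infD:
  assumes "x \<in> L_inf (Suc k)"
  shows "x (z + 2 * pi) = x z" "smooth_upto k x" "isCont (nderiv k x) z"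
    "AE y in lebesgue. nderiv k x field_differentiable (at y)" "locally_abs_continuous (nderiv k x)"
  using assms locally_abs_continuous_imp_continuous[of "nderiv k x"]
  unfolding L_inf_def smooth_upto_def by auto

text \<open>Absolute continuity turns the essential bound on the top derivative into an estimate
  valid everywhere; this is the form in which the zero count uses it.\<close>

lemma L_inf_lipschitz:
  assumes "x \<in> L_inf (Suc k)" "sup_norm (nderiv (Suc k) x) \<le> ereal c" "c \<ge> 0"
  shows "\<bar>nderiv k x w - nderiv k x z\<bar> \<le> c * \<bar>w - z\<bar>"
proof -
  have "AE y in lebesgue. \<exists>D. (nderiv k x has_real_derivative D) (at y) \<and> \<bar>D\<bar> \<le> c"
    using L_infD(4)[OF assms(1)] sup_norm_finite_AE[OF assms(2)]
  proof eventually_elim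
    case (elim y)
    then show ?case
      by (intro exI[of _ "nderiv (Suc k) x y"]) (simp add: DERIV_deriv_iff_field_differentiable)
  qed
  then have *: "\<bar>nderiv k x b - nderiv k x a\<bar> \<le> c * (b - a)" if "a \<le> b" for a b
    using that assms(3) L_infD(5)[OF assms(1)]
    by (intro abs_continuous_bounded_deriv_le) (auto simp: locally_abs_continuous_def)
  show ?thesis using *[of z w] *[of w z] by (cases "z \<le> w") (auto simp: abs_minus_commute)
qed

text \<open>\<open>deriv\<close> is known to commute with negation only where the derivative exists,
  so the top derivatives are compared almost everywhere and measurability is established anew. The
  lower bound for the recovery error uses \<open>- \<phi>\<close>.\<close>

lemma L_inf_uminus:
  assumes x: "x \<in> L_inf (Suc k)" and c: "sup_norm (nderiv (Suc k) x) \<le> ereal c"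
  shows "(\<lambda>z. - x z) \<in> L_inf (Suc k)" "sup_norm (nderiv (Suc k) (\<lambda>z. - x z)) \<le> ereal c"
    "j \<le> k \<Longrightarrow> nderiv j (\<lambda>z. - x z) = (\<lambda>z. - nderiv j x z)"
proof -
  have eq: "(\<lambda>z. - x z) = (\<lambda>z. (- 1) * x z + 0 * x z)" by simp
  have sm: "smooth_upto k (\<lambda>z. - x z)"
    unfolding eq by (rule smooth_upto_lincomb[OF L_infD(2)[OF x] L_infD(2)[OF x]])
  have nd: "nderiv j (\<lambda>z. - x z) = (\<lambda>z. - nderiv j x z)" if "j \<le> k" for j
    unfolding eq nderiv_lincomb[OF L_infD(2)[OF x] L_infD(2)[OF x] that] by simp
  then show "j \<le> k \<Longrightarrow> nderiv j (\<lambda>z. - x z) = (\<lambda>z. - nderiv j x z)" .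
  have diff: "(\<lambda>z. - nderiv k x z) field_differentiable at y" "deriv (\<lambda>z. - nderiv k x z) y = - nderiv (Suc k) x y"
    if "nderiv k x field_differentiable at y" for y
    using that by (auto intro!: field_differentiable_minus)
  have ae: "AE y in lebesgue. (\<lambda>z. - nderiv k x z) field_differentiable at y"
    using L_infD(4)[OF x] by eventually_elim (rule diff(1))
  have meas: "deriv (\<lambda>z. - nderiv k x z) \<in> borel_measurable lebesgue"
    by (rule borel_measurable_deriv_lebesgue[OF _ ae]) (intro continuous_intros L_infD(3)[OF x])
  have bound: "AE y in lebesgue. \<bar>deriv (\<lambda>z. - nderiv k x z) y\<bar> \<le> c"
    using L_infD(4)[OF x] sup_norm_finite_AE[OF c]
    by eventually_elim (simp only: diff(2) abs_minus_cancel)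
  show c': "sup_norm (nderiv (Suc k) (\<lambda>z. - x z)) \<le> ereal c"
    using sup_norm_leI[OF meas bound] nd[of k] by simp
  have "locally_abs_continuous (\<lambda>z. - nderiv k x z)"
    using L_infD(5)[OF x] unfolding locally_abs_continuous_def abs_continuous_on_interval_def
    by (simp add: abs_minus_commute)
  moreover have "sup_norm (nderiv (Suc k) (\<lambda>z. - x z)) < \<infinity>" using c' by (auto intro: le_less_trans)
  ultimately show "(\<lambda>z. - x z) \<in> L_inf (Suc k)"
    using sm ae L_infD(1)[OF x] nd[of k] unfolding L_inf_def smooth_upto_def by simp
qed

lemma strict_sample_points:
  fixes u :: "nat \<Rightarrow> real"
  assumes u: "0 \<le> u 1" "strict_mono_on {1..2 * n} u" "u (2 * n) < 2 * pi"
  shows "u ` {1..2 * n} \<subseteq> {0..<2 * pi}" "card (u ` {1..2 * n}) = 2 * n"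
proof -
  show "u ` {1..2 * n} \<subseteq> {0..<2 * pi}"
  proof
    fix z assume "z \<in> u ` {1..2 * n}"
    then obtain k where k: "k \<in> {1..2 * n}" "z = u k" by blast
    have "u 1 \<le> u k" using strict_mono_on_leD[OF u(2), of 1 k] k by auto
    moreover have "u k \<le> u (2 * n)" using strict_mono_on_leD[OF u(2), of k "2 * n"] k by auto
    ultimately show "z \<in> {0..<2 * pi}" using u k by auto
  qed
  show "card (u ` {1..2 * n}) = 2 * n"
    using strict_mono_on_imp_inj_on[OF u(2)] by (simp add: card_image)
qed

section \<open>Regularity of the splines and optimality of interpolation\<close>

context ramp_spline
begin

definition breaks :: "real set" where
  "breaks = range p \<union> range q \<union> range q' \<union> range p'"

lemma breaks_finite: "finite (breaks \<inter> {a..b})"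
  unfolding breaks_def Int_Un_distrib2
  using periodic_range_finite[of _ "2 * int n"] two_n_pos p_per q_per q'_per p'_per by simp

lemma breaks_negligible: "AE z in lebesgue. z \<notin> breaks"
proof -
  have "breaks \<in> null_sets lborel"
    by (rule countable_imp_null_set_lborel) (simp add: breaks_def)
  then show ?thesis using AE_not_in AE_completion by blast
qed

lemma spl_piecesD:
  assumes "spl_pieces c c' w"
  shows "act k \<Longrightarrow> q k \<le> z \<Longrightarrow> z \<le> q' k \<Longrightarrow> w z = 0"
    "p k < z \<Longrightarrow> z < q k \<Longrightarrow> (w has_real_derivative c k) (at z)"
    "q' k < z \<Longrightarrow> z < p' k \<Longrightarrow> (w has_real_derivative c' k) (at z)"
    "p' k < z \<Longrightarrow> z < p (k + 1) \<Longrightarrow> (w has_real_derivative 0) (at z)"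
    "\<not> act k \<Longrightarrow> c k = c' k"
  using assms unfolding spl_pieces_def by auto

lemma spl_bounded_deriv:
  assumes "spl s"
  shows "\<exists>L\<ge>0. \<forall>z. z \<notin> breaks \<longrightarrow> (\<exists>D. \<bar>D\<bar> \<le> L \<and> (nderiv \<rho> s has_real_derivative D) (at z))"
proof -
  obtain c c' where c: "spl_pieces c c' (nderiv \<rho> s)" using assms unfolding spl_def by blast
  obtain L where L: "\<And>k. \<bar>c k\<bar> \<le> L"
    using periodic_int_bounded[of c "2 * int n"] two_n_pos c unfolding spl_pieces_def by auto
  obtain L' where L': "\<And>k. \<bar>c' k\<bar> \<le> L'"
    using periodic_int_bounded[of c' "2 * int n"] two_n_pos c unfolding spl_pieces_def by auto
  have pos: "0 \<le> L" "0 \<le> L'" using L[of 0] L'[of 0] by linarith+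
  have "\<exists>D. \<bar>D\<bar> \<le> L + L' \<and> (nderiv \<rho> s has_real_derivative D) (at z)" if "z \<notin> breaks" for z
  proof -
    obtain k where k: "p k \<le> z" "z < p (k + 1)" using block_exists by blast
    have ne: "z \<noteq> p k" "z \<noteq> q k" "z \<noteq> q' k" "z \<noteq> p' k" using that unfolding breaks_def by auto
    then have "p k < z" using k by simp
    consider "z < q k" | "q k < z" "z < q' k" | "q' k < z" "z < p' k" | "p' k < z" using ne by linarith
    then show ?thesis
    proof cases
      case 1
      then show ?thesis using spl_piecesD(2)[OF c] \<open>p k < z\<close> L[of k] pos by (intro exI[of _ "c k"]) auto
    next
      case 2
      then have "act k" using free(1)[of k] by force
      then have "(nderiv \<rho> s has_real_derivative 0) (at z)"
        using spl_piecesD(1)[OF c \<open>act k\<close>] 2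
        by - (rule has_field_derivative_transform_within_open[of "\<lambda>z. 0" 0 z "{q k<..<q' k}"], auto)
      then show ?thesis using pos by (intro exI[of _ 0]) auto
    next
      case 3
      then show ?thesis using spl_piecesD(3)[OF c] L'[of k] pos by (intro exI[of _ "c' k"]) auto
    next
      case 4
      then show ?thesis using spl_piecesD(4)[OF c] k pos by (intro exI[of _ 0]) auto
    qed
  qed
  then show ?thesis using pos by (intro exI[of _ "L + L'"]) auto
qed

text \<open>By periodicity the slopes are bounded, so \<open>nderiv \<rho> s\<close> is Lipschitz,
  which is more than absolute continuity.\<close>

lemma spl_L_inf:
  assumes s: "spl s"
  shows "s \<in> L_inf (Suc \<rho>)"
proof -
  obtain L where L: "L \<ge> 0" "\<And>z. z \<notin> breaks \<Longrightarrow> \<exists>D. \<bar>D\<bar> \<le> L \<and> (nderiv \<rho> s has_real_derivative D) (at z)"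
    using spl_bounded_deriv[OF s] by blast
  have cont: "isCont (nderiv \<rho> s) z" for z using s unfolding spl_def by blast
  have *: "\<bar>nderiv \<rho> s b - nderiv \<rho> s a\<bar> \<le> L * (b - a)" if "a \<le> b" for a b
    by (rule deriv_bound_finite_exceptions[OF that breaks_finite[of a b]])
      (use cont L(2) in \<open>auto simp: continuous_at_imp_continuous_on\<close>)
  have "\<bar>nderiv \<rho> s b - nderiv \<rho> s a\<bar> \<le> L * \<bar>b - a\<bar>" for a b
    using *[of a b] *[of b a] by (cases "a \<le> b") (auto simp: abs_minus_commute)
  then have ac: "locally_abs_continuous (nderiv \<rho> s)"
    by (rule lipschitz_imp_locally_abs_continuous[OF L(1)])
  have ae: "AE z in lebesgue. nderiv \<rho> s field_differentiable at z"
    using breaks_negligible by eventually_elim (use L(2) field_differentiable_def in blast)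
  have "AE z in lebesgue. \<bar>nderiv (Suc \<rho>) s z\<bar> \<le> L"
    using breaks_negligible
  proof eventually_elim
    case (elim z)
    then show ?case using L(2)[of z] DERIV_imp_deriv by fastforce
  qed
  moreover have "nderiv (Suc \<rho>) s \<in> borel_measurable lebesgue"
    using borel_measurable_deriv_lebesgue[OF cont ae] by simp
  ultimately have "sup_norm (nderiv (Suc \<rho>) s) \<le> ereal L" by (intro sup_norm_leI)
  then have "sup_norm (nderiv (Suc \<rho>) s) < \<infinity>" by (auto intro: le_less_trans)
  then show ?thesis using ac ae s unfolding L_inf_def spl_def smooth_upto_def by simp
qed

text \<open>The class enters only through tameness of its members and through \<open>\<phi>\<close>
  and \<open>- \<phi>\<close> belonging to it, so all three kinds of classes can share this
  statement.\<close>

theorem recovery: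
  fixes u :: "nat \<Rightarrow> real"
  assumes K: "\<And>x. x \<in> K \<Longrightarrow> tame x" "\<phi> \<in> K" "(\<lambda>z. - \<phi> z) \<in> K"
    and u: "0 \<le> u 1" "strict_mono_on {1..2 * n} u" "u (2 * n) < 2 * pi" and \<tau>: "\<tau> \<in> {0..<2 * pi}"
    and \<phi>u: "\<And>k. k \<in> {1..2 * n} \<Longrightarrow> \<phi> (u k) = 0"
  shows "best_error K n u \<tau> = ereal \<bar>\<phi> \<tau>\<bar> \<and>
    recovery_error K n u (\<lambda>v. (THE s. s \<in> Collect spl \<and> (\<forall>k\<in>{1..2 * n}. s (u k) = v k)) \<tau>) \<tau> = best_error K n u \<tau>"
proof -
  let ?\<Phi> = "\<lambda>v. (THE s. s \<in> Collect spl \<and> (\<forall>k\<in>{1..2 * n}. s (u k) = v k)) \<tau>"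
  have inj: "inj_on u {1..2 * n}" using u(2) by (rule strict_mono_on_imp_inj_on)
  note rng = strict_sample_points(1)[OF u]
  have U: "finite (u ` {1..2 * n})" "card (u ` {1..2 * n}) = 2 * n"
    using strict_sample_points(2)[OF u] by simp_all
  have upper: "recovery_error K n u ?\<Phi> \<tau> \<le> ereal \<bar>\<phi> \<tau>\<bar>"
    unfolding recovery_error_def
  proof (rule SUP_least)
    fix x assume x: "x \<in> K"
    let ?v = "\<lambda>k\<in>{1..2 * n}. x (u k)"
    obtain s where s: "spl s" "\<And>k. k \<in> {1..2 * n} \<Longrightarrow> s (u k) = x (u k)"
      using spl_interpolation[OF inj rng \<phi>u, of "\<lambda>k. x (u k)"] by blast
    have "(THE s. s \<in> Collect spl \<and> (\<forall>k\<in>{1..2 * n}. s (u k) = ?v k)) = s"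
    proof (rule the_equality)
      show "s \<in> Collect spl \<and> (\<forall>k\<in>{1..2 * n}. s (u k) = ?v k)" using s by simp
      fix s' assume s': "s' \<in> Collect spl \<and> (\<forall>k\<in>{1..2 * n}. s' (u k) = ?v k)"
      show "s' = s"
        by (rule spl_unique[OF _ s(1) U(1) rng U(2)]) (use s' s(2) \<phi>u in auto)
    qed
    moreover have "\<bar>x \<tau> - s \<tau>\<bar> \<le> \<bar>\<phi> \<tau>\<bar>"
      by (rule interpolation_error_le[OF K(1)[OF x] s(1) U(1) rng U(2) _ _ \<tau>]) (use s(2) \<phi>u in auto)
    ultimately show "ereal \<bar>x \<tau> - ?\<Phi> ?v\<bar> \<le> ereal \<bar>\<phi> \<tau>\<bar>" by simp
  qed
  have lower: "ereal \<bar>\<phi> \<tau>\<bar> \<le> recovery_error K n u \<Phi> \<tau>" for \<Phi>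
  proof -
    \<comment> \<open>Both functions have zero data, so any method returns the same value
      \<open>a\<close> for them and misses one of them by at least
      \<open>\<bar>\<phi> \<tau>\<bar>\<close>.\<close>
    have "(\<lambda>k\<in>{1..2 * n}. \<phi> (u k)) = (\<lambda>k\<in>{1..2 * n}. - \<phi> (u k))"
      using \<phi>u by (intro restrict_ext) simp
    then obtain a where a: "\<Phi> (\<lambda>k\<in>{1..2 * n}. \<phi> (u k)) = a" "\<Phi> (\<lambda>k\<in>{1..2 * n}. - \<phi> (u k)) = a" by simp
    have "ereal \<bar>\<phi> \<tau> - a\<bar> \<le> recovery_error K n u \<Phi> \<tau>"
      unfolding recovery_error_def by (rule SUP_upper2[OF K(2)]) (simp only: a order_refl)
    moreover have "ereal \<bar>- \<phi> \<tau> - a\<bar> \<le> recovery_error K n u \<Phi> \<tau>"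
      unfolding recovery_error_def by (rule SUP_upper2[OF K(3)]) (simp only: a order_refl)
    moreover have "\<bar>\<phi> \<tau>\<bar> \<le> max \<bar>\<phi> \<tau> - a\<bar> \<bar>- \<phi> \<tau> - a\<bar>" by linarith
    then have "ereal \<bar>\<phi> \<tau>\<bar> \<le> max (ereal \<bar>\<phi> \<tau> - a\<bar>) (ereal \<bar>- \<phi> \<tau> - a\<bar>)"
      by (simp add: max_def split: if_splits)
    ultimately show ?thesis by (meson max.boundedI order_trans)
  qed
  have "best_error K n u \<tau> = ereal \<bar>\<phi> \<tau>\<bar>"
  proof (rule antisym)
    have "best_error K n u \<tau> \<le> recovery_error K n u ?\<Phi> \<tau>" unfolding best_error_def by (rule INF_lower) simp
    then show "best_error K n u \<tau> \<le> ereal \<bar>\<phi> \<tau>\<bar>" using upper by (rule order_trans)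
    show "ereal \<bar>\<phi> \<tau>\<bar> \<le> best_error K n u \<tau>" unfolding best_error_def by (rule INF_greatest) (rule lower)
  qed
  then show ?thesis using upper lower[of ?\<Phi>] by (simp add: antisym)
qed

end

section \<open>The class with a bounded derivative of order \<open>r - 1\<close>\<close>

lemma constant_on_closure:
  fixes f :: "real \<Rightarrow> real"
  assumes "\<And>x. isCont f x" "a < b" "\<And>x. a < x \<Longrightarrow> x < b \<Longrightarrow> f x = c" "a \<le> x" "x \<le> b"
  shows "f x = c"
proof (rule continuous_constant_on_closure[of "{a<..<b}" f])
  show "continuous_on (closure {a<..<b}) f" using assms(1) by (simp add: continuous_at_imp_continuous_on)
qed (use assms in auto)

section \<open>Periodic continuation of the knots to all integers\<close>

locale knots =
  fixes n :: nat and t :: "nat \<Rightarrow> real"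
  assumes n: "n \<ge> 1" and t_less: "k \<in> {1..2 * n} \<Longrightarrow> t k < t (k + 1)" and t_end: "t (2 * n + 1) = t 1 + 2 * pi"
begin

text \<open>Knots are numbered from 1, hence the shift: \<open>k = idx k + 2 * n * turn k\<close>
  with \<open>idx k\<close> in \<open>{1..2 * n}\<close>.\<close>

definition idx :: "int \<Rightarrow> nat" where "idx k = nat ((k - 1) mod (2 * int n)) + 1"
definition turn :: "int \<Rightarrow> int" where "turn k = (k - 1) div (2 * int n)"
definition T :: "int \<Rightarrow> real" where "T k = t (idx k) + 2 * pi * of_int (turn k)"

lemma idx_range: "idx k \<in> {1..2 * n}"
proof -
  have "(k - 1) mod (2 * int n) < 2 * int n" "0 \<le> (k - 1) mod (2 * int n)" using n by simp_all
  then show ?thesis unfolding idx_def by auto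
qed

lemma idx_shift: "idx (k + 2 * int n) = idx k" "turn (k + 2 * int n) = turn k + 1"
proof -
  have eq: "k + 2 * int n - 1 = (k - 1) + 2 * int n" by simp
  show "idx (k + 2 * int n) = idx k" "turn (k + 2 * int n) = turn k + 1"
    unfolding idx_def turn_def eq using n by simp_all
qed

lemma idx_int: "k \<in> {1..2 * n} \<Longrightarrow> idx (int k) = k" "k \<in> {1..2 * n} \<Longrightarrow> turn (int k) = 0"
  unfolding idx_def turn_def by (auto simp: nat_diff_distrib)

lemma idx_Suc:
  "idx k < 2 * n \<Longrightarrow> idx (k + 1) = idx k + 1 \<and> turn (k + 1) = turn k"
  "idx k = 2 * n \<Longrightarrow> idx (k + 1) = 1 \<and> turn (k + 1) = turn k + 1"
proof -
  define N where "N = 2 * int n"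
  have N: "N > 0" using n by (simp add: N_def)
  define r where "r = (k - 1) mod N"
  define d where "d = (k - 1) div N"
  have kd: "k - 1 = N * d + r" "0 \<le> r" "r < N" using N by (auto simp: r_def d_def)
  have i: "int (idx k) = r + 1" unfolding idx_def N_def[symmetric] r_def[symmetric] using kd by simp
  show "idx (k + 1) = idx k + 1 \<and> turn (k + 1) = turn k" if "idx k < 2 * n"
  proof -
    have "r + 1 < N" using that i unfolding N_def by linarith
    then have "k mod N = r + 1" "k div N = d"
      using kd by (intro int_mod_pos_eq[of _ _ d] int_div_pos_eq[of _ _ _ "r + 1"]; simp)+
    then show ?thesis unfolding idx_def turn_def N_def[symmetric] r_def[symmetric] d_def[symmetric] using kd by simp
  qed
  show "idx (k + 1) = 1 \<and> turn (k + 1) = turn k + 1" if "idx k = 2 * n"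
  proof -
    have "r + 1 = N" using that i unfolding N_def by linarith
    then have "k = N * (d + 1) + 0" using kd by (simp add: algebra_simps)
    then have "k mod N = 0" "k div N = d + 1" using N by simp_all
    then show ?thesis unfolding idx_def turn_def N_def[symmetric] d_def[symmetric] by simp
  qed
qed

lemma T_Suc: "T (k + 1) = t (idx k + 1) + 2 * pi * of_int (turn k)"
proof (cases "idx k = 2 * n")
  case True
  then show ?thesis using idx_Suc(2)[of k] t_end unfolding T_def by (simp add: algebra_simps)
next
  case False
  then have "idx k < 2 * n" using idx_range[of k] by simp
  then show ?thesis using idx_Suc(1)[of k] unfolding T_def by simp
qed

lemma ext_Suc: "f (2 * n + 1) = f 1 \<Longrightarrow> f (idx (k + 1)) = f (idx k + 1)"
  using idx_Suc[of k] idx_range[of k] by (cases "idx k = 2 * n") auto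

lemma T_per: "T (k + 2 * int n) = T k + 2 * pi"
  unfolding T_def idx_shift by (simp add: algebra_simps)

lemma T_less: "T k < T (k + 1)"
  unfolding T_Suc unfolding T_def using t_less[OF idx_range] by simp

lemma T_len: "T (k + 1) - T k = t (idx k + 1) - t (idx k)"
  unfolding T_Suc unfolding T_def by simp

lemma T_int: "k \<in> {1..2 * n} \<Longrightarrow> T (int k) = t k" "k \<in> {1..2 * n} \<Longrightarrow> T (int k + 1) = t (k + 1)"
  unfolding T_Suc unfolding T_def using idx_int[of k] by simp_all

lemma T_block: "\<exists>k. T k \<le> z \<and> z < T (k + 1)"
proof -
  obtain C where "\<And>k. \<bar>of_int (2 * int n) * T k - 2 * pi * of_int k\<bar> \<le> C"
    using period_bounded[of T "2 * int n"] T_per n by auto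
  then show ?thesis using int_block_exists[of "2 * int n" T C z] n by auto
qed

lemma shift_cases:
  assumes per: "\<And>z. (P (z + 2 * pi) :: bool) = P z"
    and P: "\<And>y. t (idx k) + a < y \<Longrightarrow> y < t (idx k) + b \<Longrightarrow> P y"
    and y: "T k + a < y" "y < T k + b"
  shows "P y"
proof -
  \<comment> \<open>The predicate is coded as a function with values 0 and 1, so that
    \<open>periodic_int_mult\<close> applies.\<close>
  have "(if P (y - 2 * pi * of_int (turn k) + 2 * pi * of_int (turn k)) then 1 else 0 :: real)
      = (if P (y - 2 * pi * of_int (turn k)) then 1 else 0)"
    by (rule periodic_int_mult) (simp add: per)
  moreover have "P (y - 2 * pi * of_int (turn k))"
    by (rule P) (use y in \<open>auto simp: T_def\<close>)
  ultimately show ?thesis by (simp split: if_splits)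
qed

lemma shift_deriv:
  fixes f :: "real \<Rightarrow> real"
  assumes per: "\<And>x. f (x + 2 * pi) = f x"
    and D: "\<forall>y\<in>{t (idx k) + a<..<t (idx k) + b}. (f has_real_derivative c) (at y)"
    and y: "T k + a < y" "y < T k + b"
  shows "(f has_real_derivative c) (at y)"
  by (rule shift_cases[of "\<lambda>y. (f has_real_derivative c) (at y)", OF _ _ y])
    (use D in \<open>auto simp: periodic_DERIV_shift[of f, OF per]\<close>)

lemma shift_value:
  fixes f :: "real \<Rightarrow> real"
  assumes per: "\<And>x. f (x + 2 * pi) = f x"
    and D: "\<forall>y\<in>{t (idx k) + a<..<t (idx k) + b}. f y = c"
    and y: "T k + a < y" "y < T k + b"
  shows "f y = c"
  by (rule shift_cases[of "\<lambda>y. f y = c", OF _ _ y]) (use D per in auto)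

lemma T_value:
  fixes f :: "real \<Rightarrow> real"
  assumes per: "\<And>x. f (x + 2 * pi) = f x"
  shows "f (T k) = f (t (idx k))" "f (T (k + 1)) = f (t (idx k + 1))"
  unfolding T_Suc unfolding T_def using periodic_int_mult[of f, OF per] by auto

end

text \<open>Here the constraint of order \<open>\<rho>\<close> is never active, so the constant \<open>M\<close> of \<open>ramp_spline\<close> is a dummy.\<close>

theorem recovery_W1:
  assumes M: "M > 0" and n: "n \<ge> 1"
    and u: "0 \<le> u 1" "strict_mono_on {1..2 * n} u" "u (2 * n) < 2 * pi" and \<tau>: "\<tau> \<in> {0..<2 * pi}"
    and ideal: "ideal_spline (W1 (Suc (Suc \<rho>)) M) n t \<alpha> \<beta> \<phi>"
    and \<phi>u: "\<forall>k\<in>{1..2 * n}. \<phi> (u k) = 0"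
  defines "X \<equiv> W1 (Suc (Suc \<rho>)) M"
  shows "best_error (class_set X) n u \<tau> = ereal \<bar>\<phi> \<tau>\<bar> \<and>
         recovery_error (class_set X) n u (\<lambda>v. spline_interpolant X n t \<alpha> \<beta> \<phi> u v \<tau>) \<tau>
           = best_error (class_set X) n u \<tau>"
proof -
  interpret knots n t
    using ideal n unfolding ideal_spline_def by unfold_locales auto
  obtain \<epsilon> where \<epsilon>: "\<And>k. k \<in> {1..2 * n} \<Longrightarrow> \<epsilon> k \<in> {1, - 1} \<and> \<alpha> k \<in> {0..t (k + 1) - t k} \<and>
      ideal_block X \<phi> (t k) (t (k + 1)) (\<epsilon> k) (\<alpha> k) (\<beta> k)"
    using ideal unfolding ideal_spline_def X_def by blast
  define A where "A = (\<lambda>k. \<alpha> (idx k))"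
  define E where "E = (\<lambda>k. \<epsilon> (idx k))"
  have A: "0 \<le> A k" "T k + A k \<le> T (k + 1)" and E: "E k \<in> {1, - 1}" for k
    using \<epsilon>[OF idx_range[of k]] T_len[of k] unfolding A_def E_def by auto
  have per: "A (k + 2 * int n) = A k" "E (k + 2 * int n) = E k" for k
    unfolding A_def E_def idx_shift by simp_all
  have \<phi>_class: "\<phi> \<in> class_set X" using ideal unfolding ideal_spline_def X_def by simp
  then have \<phi>L: "\<phi> \<in> L_inf (Suc (Suc \<rho>))" unfolding X_def by simp
  note \<phi>_facts = L_infD[OF \<phi>L]
  let ?\<psi> = "nderiv (Suc \<rho>) \<phi>"
  have \<psi>_per: "?\<psi> (z + 2 * pi) = ?\<psi> z" for z by (rule nderiv_periodic[of \<phi> "2 * pi", OF \<phi>_facts(1)])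
  have block: "ideal_block X \<phi> (t (idx k)) (t (idx k + 1)) (E k) (A k) (\<beta> (idx k))" for k
    using \<epsilon>[OF idx_range[of k]] unfolding A_def E_def by blast
  have D1: "(?\<psi> has_real_derivative E k) (at y)" if "T k < y" "y < T k + A k" for k y
    by (rule shift_deriv[of ?\<psi> k 0 "A k", OF \<psi>_per])
      (use block[of k] that in \<open>auto simp: X_def top_deriv_on_def simp del: funpow.simps\<close>)
  have D2: "(?\<psi> has_real_derivative 0) (at y)" if "T k + A k < y" "y < T (k + 1)" for k y
    by (rule shift_deriv[of ?\<psi> k "A k" "T (k + 1) - T k", OF \<psi>_per])
      (use block[of k] that T_len[of k] in \<open>auto simp: X_def top_deriv_on_def simp del: funpow.simps\<close>)
  have D3: "?\<psi> y = E k * M" if "T k + A k < y" "y < T (k + 1)" for k y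
    by (rule shift_value[of ?\<psi> k "A k" "T (k + 1) - T k", OF \<psi>_per])
      (use block[of k] that T_len[of k] in \<open>auto simp: X_def top_deriv_on_def simp del: funpow.simps\<close>)
  have nonflat: "\<exists>z. a < z \<and> z < b \<and> \<phi> z \<noteq> 0" if ab: "a < b" for a b
  proof (rule ccontr)
    assume no: "\<not> ?thesis"
    have D0: "nderiv j \<phi> z = 0" if "a < z" "z < b" for j z
      by (rule nderiv_zero_on_open[of "{a<..<b}"]) (use no that in auto)
    define m where "m = (a + b) / 2"
    have m: "a < m" "m < b" using ab by (auto simp: m_def)
    obtain k where k: "T k \<le> m" "m < T (k + 1)" using T_block by blast
    show False
    proof (cases "m < T k + A k")
      case True
      obtain z where z: "m < z" "z < min b (T k + A k)" using dense[of m "min b (T k + A k)"] m True by auto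
      have "(?\<psi> has_real_derivative E k) (at z)" using D1 k z by simp
      then have "nderiv (Suc (Suc \<rho>)) \<phi> z = E k" by (simp add: DERIV_imp_deriv)
      then show False using D0[of z "Suc (Suc \<rho>)"] z m E[of k] by auto
    next
      case False
      obtain z where z: "m < z" "z < min b (T (k + 1))" using dense[of m "min b (T (k + 1))"] m k by auto
      then show False using D3[of k z] D0[of z "Suc \<rho>"] m False E[of k] M by auto
    qed
  qed
  \<comment> \<open>At these points the top derivative may fail to exist; \<open>deriv\<close> is
    unspecified there and must not be sampled.\<close>
  define D where "D = range T \<union> range (\<lambda>k. T k + A k)"
  have finD: "finite (D \<inter> {a..b})" for a b
    unfolding D_def Int_Un_distrib2
    using periodic_range_finite[of T "2 * int n"] periodic_range_finite[of "\<lambda>k. T k + A k" "2 * int n"] n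
    by (simp add: T_per per)
  have piece: "T k < y \<and> y < T k + A k \<or> T k + A k < y \<and> y < T (k + 1)"
    if "T k \<le> y" "y < T (k + 1)" "y \<notin> D" for k y
  proof -
    have "y \<noteq> T k" "y \<noteq> T k + A k" using that unfolding D_def by auto
    then show ?thesis using that by linarith
  qed
  obtain c where "alternates (2 * n) (\<lambda>z. \<phi> z - c) {}"
    using zero_set_alternates[OF \<phi>_facts(1) nonflat _ strict_sample_points(1)[OF u], of n]
      strict_sample_points(2)[OF u] \<phi>u n by auto
  then have "alternates (2 * n) (\<lambda>z. ?\<psi> z - (if Suc \<rho> = 0 then c else 0)) {}"
    using n by (intro alternates_nderiv[OF \<phi>_facts(2)]) auto
  then have alt1: "alternates (2 * n) ?\<psi> {}" by (simp del: funpow.simps)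
  \<comment> \<open>A further differentiation is made because the sign of block \<open>k\<close> is
    constant only in the derivative of order \<open>r\<close>, which is \<open>E k\<close> or 0
    there.\<close>
  have alt: "alternates (2 * n) (nderiv (Suc (Suc \<rho>)) \<phi>) D"
  proof (rule alternates_deriv[OF \<phi>_facts(3) finD _ alt1])
    fix y assume y: "y \<notin> D"
    obtain k where k: "T k \<le> y" "y < T (k + 1)" using T_block by blast
    from piece[OF k y] obtain d where "(?\<psi> has_real_derivative d) (at y)" using D1 D2 by blast
    then show "(?\<psi> has_real_derivative nderiv (Suc (Suc \<rho>)) \<phi> y) (at y)" by (simp add: DERIV_imp_deriv)
  qed (use n in simp)
  have sgn: "E k * nderiv (Suc (Suc \<rho>)) \<phi> y \<ge> 0" if "T k \<le> y" "y < T (k + 1)" "y \<notin> D" for k y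
    using piece[OF that] D1[of k y] D2[of k y] E[of k] by (auto simp: DERIV_imp_deriv)
  have E_alt: "E (k + 1) = - E k" for k
    by (rule alternates_all_blocks(1)[where n = n and T = T and e = E and D = D and f = "nderiv (Suc (Suc \<rho>)) \<phi>", OF n T_less T_per per(2) E sgn alt])
  have A_pos: "A k > 0" for k
  proof (rule ccontr)
    assume "\<not> A k > 0"
    then have "A k = 0" using A(1)[of k] by simp
    obtain k' y where ky: "k' mod (2 * int n) = k mod (2 * int n)" "T k' \<le> y" "y < T (k' + 1)" "y \<notin> D"
        "nderiv (Suc (Suc \<rho>)) \<phi> y \<noteq> 0"
      using alternates_all_blocks(2)[where n = n and T = T and e = E and D = D and f = "nderiv (Suc (Suc \<rho>)) \<phi>", OF n T_less T_per per(2) E sgn alt, of k] by blast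
    have "A k' = 0" using period_cong[of A "2 * int n", OF per(1) ky(1)] \<open>A k = 0\<close> by simp
    then have "(?\<psi> has_real_derivative 0) (at y)" using piece[OF ky(2-4)] D2[of k' y] by (auto simp del: funpow.simps)
    then show False using ky(5) by (simp add: DERIV_imp_deriv)
  qed
  \<comment> \<open>The first ramp and the rest interval shrink to the knot; the rising part of the
    block is the second ramp, and the bound \<open>M\<close> of the class takes the place of
    \<open>N\<close>.\<close>
  interpret ramp_spline n \<rho> T T T "\<lambda>k. T k + A k" "\<lambda>_. False" E 1 M \<phi>
  proof
    show "T k \<le> T k + A k" "T k + A k \<le> T (k + 1)" for k using A by auto
  qed (use n M T_per per A_pos E_alt E \<phi>_facts D1 D3 in \<open>auto simp del: funpow.simps\<close>)
  have tame: "tame x" if "x \<in> class_set X" for x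
  proof -
    have x: "x \<in> L_inf (Suc (Suc \<rho>))" "sup_norm (nderiv (Suc (Suc \<rho>)) x) \<le> ereal 1"
      "sup_norm (nderiv (Suc \<rho>) x) \<le> ereal M" using that unfolding X_def by (auto simp: one_ereal_def)
    then show ?thesis
      using L_infD(1,2,3)[OF x(1)] L_inf_lipschitz[OF x(1,2)] sup_norm_continuous_le[OF L_infD(3)[OF x(1)] x(3)]
      unfolding tame_def by (auto simp del: funpow.simps)
  qed
  have neg: "(\<lambda>z. - \<phi> z) \<in> class_set X"
  proof -
    have \<phi>1: "sup_norm (nderiv (Suc (Suc \<rho>)) \<phi>) \<le> ereal 1" "sup_norm (nderiv (Suc \<rho>) \<phi>) \<le> ereal M"
      using \<phi>_class unfolding X_def by (auto simp: one_ereal_def)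
    have "sup_norm (nderiv (Suc \<rho>) (\<lambda>z. - \<phi> z)) = sup_norm ?\<psi>"
      unfolding L_inf_uminus(3)[OF \<phi>L \<phi>1(1) order_refl] sup_norm_def by simp
    then show ?thesis using L_inf_uminus(1,2)[OF \<phi>L \<phi>1(1)] \<phi>1(2)
      unfolding X_def by (simp add: one_ereal_def del: funpow.simps)
  qed
  have "spline_space X n t \<alpha> \<beta> \<phi> = Collect spl"
  proof (intro equalityI subsetI)
    fix s assume "s \<in> spline_space X n t \<alpha> \<beta> \<phi>"
    then have s: "s \<in> L_inf (Suc \<rho>)" and "\<exists>c. \<forall>k\<in>{1..2 * n}.
        top_deriv_on (Suc \<rho>) s (c k) {t k<..<t k + \<alpha> k} \<and>
        top_deriv_on (Suc \<rho>) s 0 {t k + \<alpha> k<..<t (k + 1)}"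
      by (simp_all add: X_def)
    then obtain c where c: "\<And>k. k \<in> {1..2 * n} \<Longrightarrow>
        top_deriv_on (Suc \<rho>) s (c k) {t k<..<t k + \<alpha> k} \<and>
        top_deriv_on (Suc \<rho>) s 0 {t k + \<alpha> k<..<t (k + 1)}"
      by blast
    have w_per: "nderiv \<rho> s (z + 2 * pi) = nderiv \<rho> s z" for z
      by (rule nderiv_periodic[of s "2 * pi", OF L_infD(1)[OF s]])
    have "(nderiv \<rho> s has_real_derivative c (idx k)) (at y)" if "T k < y" "y < T k + A k" for k y
      by (rule shift_deriv[of "nderiv \<rho> s" k 0 "A k", OF w_per])
        (use c[OF idx_range[of k]] that in \<open>auto simp: A_def top_deriv_on_def\<close>)
    moreover have "(nderiv \<rho> s has_real_derivative 0) (at y)" if "T k + A k < y" "y < T (k + 1)" for k y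
      by (rule shift_deriv[of "nderiv \<rho> s" k "A k" "T (k + 1) - T k", OF w_per])
        (use c[OF idx_range[of k]] that T_len[of k] in \<open>auto simp: A_def top_deriv_on_def\<close>)
    ultimately have "spl_pieces (\<lambda>k. c (idx k)) (\<lambda>k. c (idx k)) (nderiv \<rho> s)"
      unfolding spl_pieces_def by (auto simp: idx_shift)
    then show "s \<in> Collect spl" using L_infD(1-3)[OF s] unfolding spl_def by blast
  next
    fix s assume "s \<in> Collect spl"
    then have s: "spl s" by simp
    then obtain c c' where c: "spl_pieces c c' (nderiv \<rho> s)" unfolding spl_def by blast
    have "top_deriv_on (Suc \<rho>) s (c' (int k)) {t k<..<t k + \<alpha> k} \<and>
        top_deriv_on (Suc \<rho>) s 0 {t k + \<alpha> k<..<t (k + 1)}" if "k \<in> {1..2 * n}" for k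
      using spl_piecesD(3,4)[OF c, of "int k"] T_int[OF that] idx_int(1)[OF that]
      unfolding top_deriv_on_def A_def by auto
    then show "s \<in> spline_space X n t \<alpha> \<beta> \<phi>"
      using spl_L_inf[OF s] unfolding X_def by (auto intro!: exI[of _ "\<lambda>k. c' (int k)"])
  qed
  then show ?thesis
    using recovery[OF tame \<phi>_class neg u \<tau>, of ] \<phi>u unfolding spline_interpolant_def by simp
qed

section \<open>The classes with a bounded derivative of order \<open>r - 2\<close>\<close>

lemma bounded_extremum_deriv_zero:
  fixes f :: "real \<Rightarrow> real"
  assumes "(f has_real_derivative d) (at x)" "\<And>y. \<bar>f y\<bar> \<le> M" "\<bar>f x\<bar> = M"
  shows "d = 0"
proof (cases "f x \<ge> 0")
  case True
  then show ?thesis using assms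
    by (intro DERIV_local_max[OF assms(1), of 1]) (auto simp: abs_le_iff)
next
  case False
  have "- M \<le> f y" for y using assms(2)[of y] by linarith
  then show ?thesis using assms False
    by (intro DERIV_local_min[OF assms(1), of 1]) (auto simp: abs_le_iff)
qed

text \<open>\<open>A\<close>, \<open>B\<close> and \<open>E\<close> continue \<alpha>, \<beta> and
  \<epsilon> to integer indices, \<rho> is r - 2, and \<open>flip\<close> is the matching of signs
  at free knots.\<close>

locale ideal_W12 = knots +
  fixes \<rho> :: nat and A B E :: "int \<Rightarrow> real" and M N :: real and \<phi> :: "real \<Rightarrow> real"
  assumes \<rho>: "\<rho> \<ge> 1" and M: "M > 0" and N: "N > 0"
    and A: "T k + A k \<le> T (k + 1)" and B: "0 \<le> B k" "B k \<le> A k" and E: "E k \<in> {1, - 1}"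
    and A_per: "A (k + 2 * int n) = A k" and B_per: "B (k + 2 * int n) = B k" and E_per: "E (k + 2 * int n) = E k"
    and \<phi>_per: "\<phi> (x + 2 * pi) = \<phi> x" and \<phi>_smooth: "smooth_upto (Suc \<rho>) \<phi>"
    and \<phi>_cont: "isCont (nderiv (Suc \<rho>) \<phi>) x"
    and \<phi>_le: "\<bar>nderiv \<rho> \<phi> x\<bar> \<le> M"
    and up_stroke: "T k < y \<Longrightarrow> y < T k + B k / 2 \<Longrightarrow> (nderiv (Suc \<rho>) \<phi> has_real_derivative E k) (at y)"
    and plateau_deriv: "T k + B k / 2 < y \<Longrightarrow> y < T k + A k - B k / 2 \<Longrightarrow> (nderiv (Suc \<rho>) \<phi> has_real_derivative 0) (at y)"
    and plateau: "T k + B k / 2 < y \<Longrightarrow> y < T k + A k - B k / 2 \<Longrightarrow> nderiv (Suc \<rho>) \<phi> y = E k * N"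
    and down_stroke: "T k + A k - B k / 2 < y \<Longrightarrow> y < T k + A k \<Longrightarrow> (nderiv (Suc \<rho>) \<phi> has_real_derivative - E k) (at y)"
    and rest: "T k + A k < y \<Longrightarrow> y < T (k + 1) \<Longrightarrow> nderiv \<rho> \<phi> y = E k * M"
    and flip: "\<bar>nderiv \<rho> \<phi> (T (k + 1))\<bar> < M \<Longrightarrow> E (k + 1) = - E k"
begin

abbreviation "\<psi> \<equiv> nderiv \<rho> \<phi>"
abbreviation "\<psi>' \<equiv> nderiv (Suc \<rho>) \<phi>"

definition active :: "int \<Rightarrow> bool" where "active k \<longleftrightarrow> \<bar>\<psi> (T k)\<bar> = M"

lemma \<psi>_deriv: "(\<psi> has_real_derivative \<psi>' x) (at x)"
  using smooth_uptoD[OF \<phi>_smooth, of \<rho>] by simp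

lemma \<psi>_cont: "isCont \<psi> x"
  by (rule DERIV_isCont[OF \<psi>_deriv])

lemma \<psi>_per: "\<psi> (x + 2 * pi) = \<psi> x" "\<psi>' (x + 2 * pi) = \<psi>' x"
  using nderiv_periodic[of \<phi> "2 * pi", OF \<phi>_per] by blast+

lemma active_per: "active (k + 2 * int n) = active k"
  unfolding active_def T_per \<psi>_per(1) ..

lemma rest_closed: "T k + A k < T (k + 1) \<Longrightarrow> T k + A k \<le> y \<Longrightarrow> y \<le> T (k + 1) \<Longrightarrow> \<psi> y = E k * M"
  by (rule constant_on_closure[OF \<psi>_cont, of "T k + A k" "T (k + 1)"]) (use rest in auto)

lemma free_full: "\<not> active (k + 1) \<Longrightarrow> T k + A k = T (k + 1)"
proof (rule ccontr)
  assume "\<not> active (k + 1)" and "T k + A k \<noteq> T (k + 1)"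
  then have "\<psi> (T (k + 1)) = E k * M" using A[of k] by (intro rest_closed) auto
  then show False using \<open>\<not> active (k + 1)\<close> E[of k] M unfolding active_def by auto
qed

lemma free_flip: "\<not> active (k + 1) \<Longrightarrow> E (k + 1) = - E k"
  using flip \<phi>_le unfolding active_def by (simp add: order.not_eq_order_implies_strict)

lemma cont_on: "continuous_on S \<psi>'"
  using \<phi>_cont by (simp add: continuous_at_imp_continuous_on)

lemma up_value: "T k \<le> y \<Longrightarrow> y \<le> T k + B k / 2 \<Longrightarrow> \<psi>' y = \<psi>' (T k) + E k * (y - T k)"
  using constant_slope[of "T k" "T k" y "T k + B k / 2" "{}" \<psi>' "E k"] cont_on up_stroke
  by (simp del: funpow.simps)

lemma plateau_value: "T k + B k / 2 \<le> y \<Longrightarrow> y \<le> T k + A k - B k / 2 \<Longrightarrow> \<psi>' y = \<psi>' (T k) + E k * (B k / 2)"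
  using constant_slope[of "T k + B k / 2" "T k + B k / 2" y "T k + A k - B k / 2" "{}" \<psi>' 0] cont_on plateau_deriv
    up_value[of k "T k + B k / 2"] B[of k]
  by (simp del: funpow.simps)

lemma down_value: "T k + A k - B k / 2 \<le> y \<Longrightarrow> y \<le> T k + A k \<Longrightarrow> \<psi>' y = \<psi>' (T k) + E k * (T k + A k - y)"
  using constant_slope[of "T k + A k - B k / 2" "T k + A k - B k / 2" y "T k + A k" "{}" \<psi>' "- E k"] cont_on down_stroke
    plateau_value[of k "T k + A k - B k / 2"] B[of k]
  by (simp add: algebra_simps del: funpow.simps)

lemma active_deriv: "active k \<Longrightarrow> \<psi>' (T k) = 0"
  using bounded_extremum_deriv_zero[OF \<psi>_deriv \<phi>_le] unfolding active_def by blast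

text \<open>
  The two strokes of a block have equal length, so the derivative of order \<open>\<rho> + 1\<close> has the same
  value at both ends of the block.
\<close>

lemma knot_deriv:
  assumes "active k0" shows "\<psi>' (T k) = 0"
proof -
  \<comment> \<open>The active knot is moved back by whole periods to or below \<open>k\<close>, and
    the induction runs upwards from there.\<close>
  define k1 where "k1 = k0 + 2 * int n * (- \<bar>k0 - k\<bar>)"
  have "\<bar>k0 - k\<bar> \<le> 2 * int n * \<bar>k0 - k\<bar>" using n by (simp add: mult_le_cancel_right1)
  then have "k1 \<le> k" unfolding k1_def by (simp add: algebra_simps)
  have "k1 mod (2 * int n) = k0 mod (2 * int n)" unfolding k1_def by (rule mod_mult_self2)
  then have "\<psi> (T k1) = \<psi> (T k0)"
    by (rule period_cong[where e = "\<lambda>k. \<psi> (T k)", rotated]) (simp only: T_per \<psi>_per(1))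
  then have "active k1" using assms unfolding active_def by simp
  from \<open>k1 \<le> k\<close> show ?thesis
  proof (induction k rule: int_ge_induct)
    case base
    then show ?case by (rule active_deriv[OF \<open>active k1\<close>])
  next
    case (step k)
    show ?case
    proof (cases "active (k + 1)")
      case False
      then show ?thesis using free_full[of k] down_value[of k "T k + A k"] step B[of k] by (simp del: funpow.simps)
    qed (rule active_deriv)
  qed
qed

lemma \<phi>_nonflat: "a < b \<Longrightarrow> \<exists>z. a < z \<and> z < b \<and> \<phi> z \<noteq> 0"
proof (rule ccontr)
  assume ab: "a < b" and no: "\<not> ?thesis"
  have D0: "nderiv j \<phi> z = 0" if "a < z" "z < b" for j z
    by (rule nderiv_zero_on_open[of "{a<..<b}"]) (use ab no that in auto)
  have no_slope: False if "a < z" "z < b" "(\<psi>' has_real_derivative d) (at z)" "d \<noteq> 0" for z d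
  proof -
    have "nderiv (Suc (Suc \<rho>)) \<phi> z = d" using that(3) by (simp add: DERIV_imp_deriv)
    then show False using D0[OF that(1,2), of "Suc (Suc \<rho>)"] that(4) by simp
  qed
  have E0: "E k \<noteq> 0" for k using E[of k] by auto
  define m where "m = (a + b) / 2"
  have m: "a < m" "m < b" using ab by (auto simp: m_def)
  obtain k where k: "T k \<le> m" "m < T (k + 1)" using T_block by blast
  consider "m < T k + B k / 2" | "T k + B k / 2 \<le> m" "m < T k + A k - B k / 2"
    | "T k + A k - B k / 2 \<le> m" "m < T k + A k" | "T k + A k \<le> m" by linarith
  then show False
  proof cases
    case 1
    obtain z where "m < z" "z < min b (T k + B k / 2)" using dense[of m "min b (T k + B k / 2)"] m 1 by auto
    then show False using no_slope[of z "E k"] up_stroke[of k z] k m E0 by simp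
  next
    case 2
    obtain z where "m < z" "z < min b (T k + A k - B k / 2)" using dense[of m "min b (T k + A k - B k / 2)"] m 2 by auto
    then show False using plateau[of k z] D0[of z "Suc \<rho>"] m 2 E0[of k] N by simp
  next
    case 3
    obtain z where "m < z" "z < min b (T k + A k)" using dense[of m "min b (T k + A k)"] m 3 by auto
    then show False using no_slope[of z "- E k"] down_stroke[of k z] 3 m E0 by simp
  next
    case 4
    obtain z where "m < z" "z < min b (T (k + 1))" using dense[of m "min b (T (k + 1))"] m k by auto
    then show False using rest[of k z] D0[of z \<rho>] m 4 E0[of k] M by simp
  qed
qed

text \<open>Once a single knot is active, \<open>\<psi>'\<close> vanishes at all knots. On block
  \<open>k\<close> it is then \<open>E k\<close> times a nonnegative trapezoid, followed by zero on
  the rest part.\<close>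

lemma block_sign:
  assumes act: "active k0" and y: "T k \<le> y" "y < T (k + 1)"
  shows "E k * \<psi>' y \<ge> 0" "\<psi>' y \<noteq> 0 \<Longrightarrow> A k > 0"
proof -
  note z = knot_deriv[OF act, of k]
  have rest0: "\<psi>' y = 0" if "T k + A k < y"
  proof -
    have "(\<psi> has_real_derivative 0) (at y)"
      by (rule has_field_derivative_transform_within_open[of "\<lambda>z. E k * M" 0 y "{T k + A k<..<T (k + 1)}"])
        (use rest that y in auto)
    then show ?thesis using \<psi>_deriv DERIV_unique by blast
  qed
  consider "y \<le> T k + B k / 2" | "T k + B k / 2 \<le> y" "y \<le> T k + A k - B k / 2"
    | "T k + A k - B k / 2 \<le> y" "y \<le> T k + A k" | "T k + A k < y" by linarith
  then show "E k * \<psi>' y \<ge> 0"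
  proof cases
    case 1
    then show ?thesis using up_value[of k y] z y E[of k] by (auto simp del: funpow.simps)
  next
    case 2
    then show ?thesis using plateau_value[of k y] z B[of k] E[of k] by (auto simp del: funpow.simps)
  next
    case 3
    then show ?thesis using down_value[of k y] z E[of k] by (auto simp del: funpow.simps)
  qed (simp add: rest0 del: funpow.simps)
  show "A k > 0" if "\<psi>' y \<noteq> 0"
  proof (rule ccontr)
    assume "\<not> A k > 0"
    then have "A k = 0" using B[of k] by simp
    then have "y = T k" using rest0 that y(1) by (cases "y = T k") auto
    then show False using z that by simp
  qed
qed

end

locale ideal_W12_zeros = ideal_W12 +
  fixes U :: "real set"
  assumes U: "finite U" "U \<subseteq> {0..<2 * pi}" "card U = 2 * n" "\<And>z. z \<in> U \<Longrightarrow> \<phi> z = 0"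
begin

lemma alternates_\<psi>': "alternates (2 * n) \<psi>' {}"
proof -
  obtain c where c: "alternates (2 * n) (\<lambda>z. \<phi> z - c) {}"
    using zero_set_alternates[of \<phi> U n, OF \<phi>_per \<phi>_nonflat U(1,2,4)] U(3) n by auto
  have "alternates (2 * n) (\<lambda>z. \<psi>' z - (if Suc \<rho> = 0 then c else 0)) {}"
    using n by (intro alternates_nderiv[OF \<phi>_smooth c]) auto
  then show ?thesis by (simp del: funpow.simps)
qed

lemma active_blocks:
  assumes "active k0"
  shows "E (k + 1) = - E k" "A k > 0"
proof -
  note blocks = alternates_all_blocks[where n = n and T = T and e = E and D = "{}" and f = \<psi>',
      OF n T_less T_per E_per E block_sign(1)[OF assms] alternates_\<psi>']
  show "E (k + 1) = - E k" by (rule blocks(1))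
  obtain k' y where ky: "k' mod (2 * int n) = k mod (2 * int n)" "T k' \<le> y" "y < T (k' + 1)" "\<psi>' y \<noteq> 0"
    using blocks(2)[of k] by blast
  then have "A k' > 0" using block_sign(2)[OF assms] by blast
  moreover have "A k' = A k" by (rule period_cong[of A "2 * int n", OF A_per ky(1)])
  ultimately show "A k > 0" by simp
qed

text \<open>Two separate reasons: if some knot is active, the equality case of the count forces
  alternation everywhere; if none is, every knot is free and \<open>free_flip\<close>
  applies.\<close>

lemma E_alt: "E (k + 1) = - E k"
  using active_blocks(1) free_flip by blast

text \<open>Without strokes the plateau would start at the knot, so \<open>\<psi>'\<close> would
  equal \<open>E k * N\<close> there, but next to an active constraint it vanishes at every
  knot.\<close>

lemma B_pos:
  assumes "active k0" shows "B k > 0"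
proof (rule ccontr)
  assume "\<not> B k > 0"
  then have B0: "B k = 0" using B(1)[of k] by simp
  have "\<psi>' (T k) = E k * N"
    by (rule constant_on_closure[OF \<phi>_cont, of "T k" "T k + A k"])
      (use plateau[of k] B0 active_blocks(2)[OF assms, of k] in \<open>auto simp del: funpow.simps\<close>)
  then show False using knot_deriv[OF assms, of k] E[of k] N by auto
qed

text \<open>Gives the ramp at a free knot positive length. With both strokes missing no knot is
  active, so the two plateaus meet at \<open>T k\<close> and \<open>\<psi>'\<close> would jump
  between opposite values.\<close>

lemma B_sum_pos: "B (k - 1) + B k > 0"
proof (rule ccontr)
  assume "\<not> B (k - 1) + B k > 0"
  then have B0: "B (k - 1) = 0" "B k = 0" using B(1)[of k] B(1)[of "k - 1"] by auto
  then have "\<not> active k0" for k0 using B_pos[of k0 k] by auto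
  then have full: "T (k - 1) + A (k - 1) = T k" "T k + A k = T (k + 1)"
    using free_full[of "k - 1"] free_full[of k] by auto
  have "\<psi>' (T k) = E (k - 1) * N"
    by (rule constant_on_closure[OF \<phi>_cont, of "T (k - 1)" "T k"])
      (use plateau[of "k - 1"] B0 full T_less[of "k - 1"] in \<open>auto simp del: funpow.simps\<close>)
  moreover have "\<psi>' (T k) = E k * N"
    by (rule constant_on_closure[OF \<phi>_cont, of "T k" "T (k + 1)"])
      (use plateau[of k] B0 full T_less[of k] in \<open>auto simp del: funpow.simps\<close>)
  ultimately show False using E_alt[of "k - 1"] E[of k] N by auto
qed

text \<open>The stroke after the knot makes \<open>E k * \<psi>\<close> increase while it stays
  below \<open>M\<close>, so its value at the knot is the lower extreme.\<close>

lemma active_value: "active k \<Longrightarrow> \<psi> (T k) = - E k * M"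
proof -
  assume act: "active k"
  have B0: "B k > 0" by (rule B_pos[OF act])
  have "(\<lambda>y. E k * \<psi> y) (T k) < (\<lambda>y. E k * \<psi> y) (T k + B k / 2)"
  proof (rule DERIV_pos_imp_increasing_open[where f = "\<lambda>y. E k * \<psi> y"])
    fix y assume y: "T k < y" "y < T k + B k / 2"
    have "((\<lambda>y. E k * \<psi> y) has_real_derivative E k * \<psi>' y) (at y)"
      by (rule DERIV_cmult[OF \<psi>_deriv])
    moreover have "E k * \<psi>' y > 0"
      using up_value[of k y] active_deriv[OF act] y E[of k] by (auto simp del: funpow.simps)
    ultimately show "\<exists>d. ((\<lambda>y. E k * \<psi> y) has_real_derivative d) (at y) \<and> d > 0" by blast
  qed (use B0 \<psi>_cont in \<open>auto intro!: continuous_intros continuous_at_imp_continuous_on\<close>)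
  moreover have "E k * \<psi> (T k + B k / 2) \<le> M"
    using \<phi>_le[of "T k + B k / 2"] E[of k] by (auto simp: abs_le_iff)
  ultimately show ?thesis using act E[of k] unfolding active_def by (auto simp: abs_if split: if_splits)
qed

text \<open>Ramp blocks are centred at knots: index \<open>k\<close> joins the last stroke of block
  \<open>k - 1\<close> with the first stroke of block \<open>k\<close>. Both have slope
  \<open>E k\<close> because the signs alternate, and the rest interval between them ends at
  \<open>T k\<close>.\<close>

sublocale ramp_spline n \<rho> "\<lambda>k. T (k - 1) + A (k - 1) - B (k - 1) / 2" "\<lambda>k. T (k - 1) + A (k - 1)" T
    "\<lambda>k. T k + B k / 2" active E M N \<phi>
proof
  have shift: "f (k + 2 * int n - 1) = f ((k - 1) + 2 * int n)" for f :: "int \<Rightarrow> real" and k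
    by (simp add: algebra_simps)
  show "T (k + 2 * int n - 1) + A (k + 2 * int n - 1) - B (k + 2 * int n - 1) / 2
      = T (k - 1) + A (k - 1) - B (k - 1) / 2 + 2 * pi"
    "T (k + 2 * int n - 1) + A (k + 2 * int n - 1) = T (k - 1) + A (k - 1) + 2 * pi"
    "T (k + 2 * int n) + B (k + 2 * int n) / 2 = T k + B k / 2 + 2 * pi" for k
    unfolding shift T_per A_per B_per by simp_all
  show "T (k - 1) + A (k - 1) = T k" if "\<not> active k" for k using free_full[of "k - 1"] that by simp
  show "T (k - 1) + A (k - 1) - B (k - 1) / 2 < T k + B k / 2" if "\<not> active k" for k
    using free_full[of "k - 1"] that B_sum_pos[of k] by simp
  show "T k + B k / 2 \<le> T (k + 1 - 1) + A (k + 1 - 1) - B (k + 1 - 1) / 2" for k using B[of k] by simp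
  show "(\<psi>' has_real_derivative E k) (at x)"
    if "T (k - 1) + A (k - 1) - B (k - 1) / 2 < x" "x < T (k - 1) + A (k - 1)" for k x
    using down_stroke[OF that] E_alt[of "k - 1"] by (simp del: funpow.simps)
  show "\<psi>' x = E k * N" if "T k + B k / 2 < x" "x < T (k + 1 - 1) + A (k + 1 - 1) - B (k + 1 - 1) / 2" for k x
    using plateau[of k x] that by (simp del: funpow.simps)
  show "\<psi> x = - E k * M" if "active k" "T (k - 1) + A (k - 1) \<le> x" "x \<le> T k" for k x
  proof (cases "x = T k")
    case True
    then show ?thesis using active_value[OF that(1)] by simp
  next
    case False
    then have "\<psi> x = E (k - 1) * M" using rest_closed[of "k - 1" x] that by simp
    then show ?thesis using E_alt[of "k - 1"] by simp
  qed
  show "T (k - 1) + A (k - 1) \<le> T k" for k using A[of "k - 1"] by simp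
qed (use n M N B B_pos \<rho> T_per active_per E_alt E \<phi>_per \<phi>_smooth \<phi>_cont up_stroke in \<open>auto simp del: funpow.simps\<close>)

end

theorem recovery_W12:
  assumes \<rho>: "\<rho> \<ge> 1" and M: "M > 0" and N: "N > 0" and n: "n \<ge> 1"
    and u: "0 \<le> u 1" "strict_mono_on {1..2 * n} u" "u (2 * n) < 2 * pi" and \<tau>: "\<tau> \<in> {0..<2 * pi}"
    and ideal: "ideal_spline (W12 (Suc (Suc \<rho>)) M N) n t \<alpha> \<beta> \<phi>"
    and \<phi>u: "\<forall>k\<in>{1..2 * n}. \<phi> (u k) = 0"
  defines "X \<equiv> W12 (Suc (Suc \<rho>)) M N"
  shows "best_error (class_set X) n u \<tau> = ereal \<bar>\<phi> \<tau>\<bar> \<and>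
         recovery_error (class_set X) n u (\<lambda>v. spline_interpolant X n t \<alpha> \<beta> \<phi> u v \<tau>) \<tau>
           = best_error (class_set X) n u \<tau>"
proof -
  interpret knots n t
    using ideal n unfolding ideal_spline_def by unfold_locales auto
  let ?\<psi> = "nderiv \<rho> \<phi>" and ?\<psi>' = "nderiv (Suc \<rho>) \<phi>"
  obtain \<epsilon> where \<epsilon>_end: "\<epsilon> (2 * n + 1) = \<epsilon> 1" and \<epsilon>: "\<And>k. k \<in> {1..2 * n} \<Longrightarrow> \<epsilon> k \<in> {1, - 1} \<and> \<alpha> k \<in> {0..t (k + 1) - t k} \<and>
      ideal_block X \<phi> (t k) (t (k + 1)) (\<epsilon> k) (\<alpha> k) (\<beta> k) \<and>
      (free_knot X \<phi> (t (k + 1)) \<longrightarrow> \<epsilon> (k + 1) = - \<epsilon> k)"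
    using ideal unfolding ideal_spline_def X_def by blast
  define A where "A = (\<lambda>k. \<alpha> (idx k))"
  define B where "B = (\<lambda>k. \<beta> (idx k))"
  define E where "E = (\<lambda>k. \<epsilon> (idx k))"
  have block: "ideal_block X \<phi> (t (idx k)) (t (idx k + 1)) (E k) (A k) (B k)" for k
    using \<epsilon>[OF idx_range[of k]] unfolding A_def B_def E_def by blast
  have A: "T k + A k \<le> T (k + 1)" and E: "E k \<in> {1, - 1}" for k
    using \<epsilon>[OF idx_range[of k]] T_len[of k] unfolding A_def E_def by auto
  have B: "0 \<le> B k" "B k \<le> A k" for k using block[of k] unfolding X_def by auto
  have per: "A (k + 2 * int n) = A k" "B (k + 2 * int n) = B k" "E (k + 2 * int n) = E k" for k
    unfolding A_def B_def E_def idx_shift by simp_all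
  have \<phi>_class: "\<phi> \<in> class_set X" using ideal unfolding ideal_spline_def X_def by simp
  then have \<phi>L: "\<phi> \<in> L_inf (Suc (Suc \<rho>))" unfolding X_def by simp
  have \<phi>1: "sup_norm (nderiv (Suc (Suc \<rho>)) \<phi>) \<le> ereal 1" "sup_norm ?\<psi>' \<le> ereal N" "sup_norm ?\<psi> \<le> ereal M"
    using \<phi>_class unfolding X_def by (auto simp: one_ereal_def)
  note \<phi>_facts = L_infD[OF \<phi>L]
  have \<psi>_per: "?\<psi> (z + 2 * pi) = ?\<psi> z" "?\<psi>' (z + 2 * pi) = ?\<psi>' z" for z
    using nderiv_periodic[of \<phi> "2 * pi", OF \<phi>_facts(1)] by blast+
  have blk: "top_deriv_on (Suc (Suc \<rho>)) \<phi> (E k) {t (idx k)<..<t (idx k) + B k / 2}"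
    "top_deriv_on (Suc (Suc \<rho>)) \<phi> 0 {t (idx k) + B k / 2<..<t (idx k) + A k - B k / 2}"
    "\<forall>y\<in>{t (idx k) + B k / 2<..<t (idx k) + A k - B k / 2}. ?\<psi>' y = E k * N"
    "top_deriv_on (Suc (Suc \<rho>)) \<phi> (- E k) {t (idx k) + A k - B k / 2<..<t (idx k) + A k}"
    "\<forall>y\<in>{t (idx k) + A k<..<t (idx k + 1)}. ?\<psi> y = E k * M" for k
    using block[of k] unfolding X_def by (simp_all del: funpow.simps)
  have D1: "(?\<psi>' has_real_derivative E k) (at y)" if "T k < y" "y < T k + B k / 2" for k y
    by (rule shift_deriv[of ?\<psi>' k 0 "B k / 2", OF \<psi>_per(2)])
      (use blk(1)[of k] that in \<open>auto simp: top_deriv_on_def simp del: funpow.simps\<close>)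
  have D2: "(?\<psi>' has_real_derivative 0) (at y)" if "T k + B k / 2 < y" "y < T k + A k - B k / 2" for k y
    by (rule shift_deriv[of ?\<psi>' k "B k / 2" "A k - B k / 2", OF \<psi>_per(2)])
      (use blk(2)[of k] that in \<open>auto simp: top_deriv_on_def simp del: funpow.simps\<close>)
  have D3: "?\<psi>' y = E k * N" if "T k + B k / 2 < y" "y < T k + A k - B k / 2" for k y
    by (rule shift_value[of ?\<psi>' k "B k / 2" "A k - B k / 2", OF \<psi>_per(2)])
      (use blk(3)[of k] that in \<open>auto simp del: funpow.simps\<close>)
  have D4: "(?\<psi>' has_real_derivative - E k) (at y)" if "T k + A k - B k / 2 < y" "y < T k + A k" for k y
    by (rule shift_deriv[of ?\<psi>' k "A k - B k / 2" "A k", OF \<psi>_per(2)])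
      (use blk(4)[of k] that in \<open>auto simp: top_deriv_on_def simp del: funpow.simps\<close>)
  have D5: "?\<psi> y = E k * M" if "T k + A k < y" "y < T (k + 1)" for k y
    by (rule shift_value[of ?\<psi> k "A k" "T (k + 1) - T k", OF \<psi>_per(1)])
      (use blk(5)[of k] that T_len[of k] in auto)
  have flip: "E (k + 1) = - E k" if "\<bar>?\<psi> (T (k + 1))\<bar> < M" for k
  proof -
    have "free_knot X \<phi> (t (idx k + 1))" using that T_value(2)[of ?\<psi> k, OF \<psi>_per(1)] unfolding X_def by simp
    then have "\<epsilon> (idx k + 1) = - \<epsilon> (idx k)" using \<epsilon>[OF idx_range[of k]] by blast
    then show ?thesis unfolding E_def using ext_Suc[of \<epsilon>, OF \<epsilon>_end] by simp
  qed
  have \<psi>_cont: "isCont ?\<psi> z" for z by (rule smooth_upto_isCont[OF \<phi>_facts(2)]) simp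
  interpret ideal_W12_zeros n t \<rho> A B E M N \<phi> "u ` {1..2 * n}"
    by unfold_locales
      (use \<rho> M N A B E per \<phi>_facts sup_norm_continuous_le[OF \<psi>_cont \<phi>1(3)] D1 D2 D3 D4 D5 flip
        strict_sample_points[OF u] \<phi>u in \<open>auto simp del: funpow.simps\<close>)
  have tame: "tame x" if "x \<in> class_set X" for x
  proof -
    have x: "x \<in> L_inf (Suc (Suc \<rho>))" "sup_norm (nderiv (Suc (Suc \<rho>)) x) \<le> ereal 1"
      "sup_norm (nderiv (Suc \<rho>) x) \<le> ereal N" "sup_norm (nderiv \<rho> x) \<le> ereal M"
      using that unfolding X_def by (auto simp: one_ereal_def)
    have "isCont (nderiv \<rho> x) z" for z by (rule smooth_upto_isCont[OF L_infD(2)[OF x(1)]]) simp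
    from sup_norm_continuous_le[OF this x(4)] show ?thesis
      using L_infD(1,2,3)[OF x(1)] L_inf_lipschitz[OF x(1,2)] sup_norm_continuous_le[OF L_infD(3)[OF x(1)] x(3)]
      unfolding tame_def by (auto simp del: funpow.simps)
  qed
  have neg: "(\<lambda>z. - \<phi> z) \<in> class_set X"
  proof -
    have "sup_norm (nderiv (Suc \<rho>) (\<lambda>z. - \<phi> z)) = sup_norm ?\<psi>'"
      unfolding L_inf_uminus(3)[OF \<phi>L \<phi>1(1) order_refl] sup_norm_def by simp
    moreover have "sup_norm (nderiv \<rho> (\<lambda>z. - \<phi> z)) = sup_norm ?\<psi>"
      unfolding L_inf_uminus(3)[OF \<phi>L \<phi>1(1) le_SucI[OF order_refl]] sup_norm_def by simp
    ultimately show ?thesis using L_inf_uminus(1,2)[OF \<phi>L \<phi>1(1)] \<phi>1(2,3)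
      unfolding X_def by (simp add: one_ereal_def del: funpow.simps)
  qed
  have act_iff: "active k \<longleftrightarrow> \<bar>?\<psi> (t (idx k))\<bar> = M" "active (k + 1) \<longleftrightarrow> \<bar>?\<psi> (t (idx k + 1))\<bar> = M" for k
    unfolding active_def using T_value[of ?\<psi> k, OF \<psi>_per(1)] by auto
  have "spline_space X n t \<alpha> \<beta> \<phi> = Collect spl"
  proof (intro equalityI subsetI)
    fix s assume "s \<in> spline_space X n t \<alpha> \<beta> \<phi>"
    then have s: "s \<in> L_inf (Suc \<rho>)" and "\<exists>c1 c2. c1 (2 * n + 1) = c1 1 \<and> (\<forall>k\<in>{1..2 * n}.
        top_deriv_on (Suc \<rho>) s (c1 k) {t k<..<t k + \<beta> k / 2} \<and>
        top_deriv_on (Suc \<rho>) s (c2 k) {t k + \<alpha> k - \<beta> k / 2<..<t k + \<alpha> k} \<and>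
        top_deriv_on (Suc \<rho>) s 0 {t k + \<beta> k / 2<..<t k + \<alpha> k - \<beta> k / 2} \<and>
        top_deriv_on (Suc \<rho>) s 0 {t k + \<alpha> k<..<t (k + 1)} \<and>
        (\<bar>?\<psi> (t k)\<bar> = M \<longrightarrow> nderiv \<rho> s (t k) = 0) \<and>
        (\<bar>?\<psi> (t (k + 1))\<bar> < M \<longrightarrow> c2 k = c1 (k + 1)))"
      by (simp_all add: X_def)
    then obtain c1 c2 where c_end: "c1 (2 * n + 1) = c1 1" and c: "\<And>k. k \<in> {1..2 * n} \<Longrightarrow>
        top_deriv_on (Suc \<rho>) s (c1 k) {t k<..<t k + \<beta> k / 2} \<and>
        top_deriv_on (Suc \<rho>) s (c2 k) {t k + \<alpha> k - \<beta> k / 2<..<t k + \<alpha> k} \<and>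
        top_deriv_on (Suc \<rho>) s 0 {t k + \<beta> k / 2<..<t k + \<alpha> k - \<beta> k / 2} \<and>
        top_deriv_on (Suc \<rho>) s 0 {t k + \<alpha> k<..<t (k + 1)} \<and>
        (\<bar>?\<psi> (t k)\<bar> = M \<longrightarrow> nderiv \<rho> s (t k) = 0) \<and>
        (\<bar>?\<psi> (t (k + 1))\<bar> < M \<longrightarrow> c2 k = c1 (k + 1))"
      by blast
    let ?w = "nderiv \<rho> s"
    have w_per: "?w (z + 2 * pi) = ?w z" for z
      by (rule nderiv_periodic[of s "2 * pi", OF L_infD(1)[OF s]])
    have up: "(?w has_real_derivative c1 (idx k)) (at y)" if "T k < y" "y < T k + B k / 2" for k y
      by (rule shift_deriv[of ?w k 0 "B k / 2", OF w_per])
        (use c[OF idx_range[of k]] that in \<open>auto simp: B_def top_deriv_on_def\<close>)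
    have down: "(?w has_real_derivative c2 (idx k)) (at y)" if "T k + A k - B k / 2 < y" "y < T k + A k" for k y
      by (rule shift_deriv[of ?w k "A k - B k / 2" "A k", OF w_per])
        (use c[OF idx_range[of k]] that in \<open>auto simp: A_def B_def top_deriv_on_def\<close>)
    have plat: "(?w has_real_derivative 0) (at y)" if "T k + B k / 2 < y" "y < T k + A k - B k / 2" for k y
      by (rule shift_deriv[of ?w k "B k / 2" "A k - B k / 2", OF w_per])
        (use c[OF idx_range[of k]] that in \<open>auto simp: A_def B_def top_deriv_on_def\<close>)
    have rst: "(?w has_real_derivative 0) (at y)" if "T k + A k < y" "y < T (k + 1)" for k y
      by (rule shift_deriv[of ?w k "A k" "T (k + 1) - T k", OF w_per])
        (use c[OF idx_range[of k]] that T_len[of k] in \<open>auto simp: A_def top_deriv_on_def\<close>)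
    have w0: "?w (T k) = 0" if "active k" for k
      using c[OF idx_range[of k]] that T_value(1)[of ?w k, OF w_per] unfolding act_iff by simp
    \<comment> \<open>The slope is 0 on the rest part and the value at the knot is 0, so the
      function vanishes on the whole closed rest interval.\<close>
    have w_rest: "?w z = 0" if "active k" "T (k - 1) + A (k - 1) \<le> z" "z \<le> T k" for k z
    proof -
      have "?w (T k) - ?w z = 0 * (T k - z)"
        by (rule constant_slope[OF that(2,3), of "T k" "{}"])
          (use rst[of "k - 1"] L_infD(3)[OF s] in \<open>auto intro: continuous_at_imp_continuous_on\<close>)
      then show ?thesis using w0[OF that(1)] by simp
    qed
    have match: "c2 (idx (k - 1)) = c1 (idx k)" if "\<not> active k" for k
    proof -
      have "\<bar>?\<psi> (t (idx (k - 1) + 1))\<bar> \<noteq> M" using that act_iff(2)[of "k - 1"] by simp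
      then have "\<bar>?\<psi> (t (idx (k - 1) + 1))\<bar> < M" using \<phi>_le by (simp add: order.not_eq_order_implies_strict)
      then have "c2 (idx (k - 1)) = c1 (idx (k - 1) + 1)" using c[OF idx_range[of "k - 1"]] by blast
      then show ?thesis using ext_Suc[of c1 "k - 1", OF c_end] by simp
    qed
    have "idx (k + 2 * int n - 1) = idx (k - 1)" for k
      using idx_shift(1)[of "k - 1"] by (simp add: algebra_simps)
    \<comment> \<open>The slope just before knot \<open>k\<close> belongs to the preceding block,
      hence the shifted index of \<open>c2\<close>.\<close>
    then have "spl_pieces (\<lambda>k. c2 (idx (k - 1))) (\<lambda>k. c1 (idx k)) ?w"
      unfolding spl_pieces_def using up down plat w_rest match by (auto simp: idx_shift)
    then show "s \<in> Collect spl" using L_infD(1-3)[OF s] unfolding spl_def by blast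
  next
    fix s assume "s \<in> Collect spl"
    then have s: "spl s" by simp
    then obtain c c' where c: "spl_pieces c c' (nderiv \<rho> s)" unfolding spl_def by blast
    let ?w = "nderiv \<rho> s"
    have rst: "(?w has_real_derivative 0) (at y)" if y: "T k + A k < y" "y < T (k + 1)" for k y
    proof -
      \<comment> \<open>A nonempty rest part forces an active knot at its right end.\<close>
      have act: "active (k + 1)" using free_full[of k] y by force
      have "?w z = 0" if "T k + A k \<le> z" "z \<le> T (k + 1)" for z
        using spl_piecesD(1)[OF c act] that by simp
      then show ?thesis
        by - (rule has_field_derivative_transform_within_open[of "\<lambda>z. 0" 0 y "{T k + A k<..<T (k + 1)}"],
          use y in auto)
    qed
    \<comment> \<open>The index \<open>2 * n + 1\<close> is set apart to make \<open>c1\<close>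
      cyclic; periodicity of \<open>c'\<close> makes this agree with the matching condition at the
      last knot.\<close>
    define c1 where "c1 = (\<lambda>k. if k = 2 * n + 1 then c' 1 else c' (int k))"
    define c2 where "c2 = (\<lambda>k. c (int k + 1))"
    have c1_Suc: "c1 (k + 1) = c' (int k + 1)" if "k \<in> {1..2 * n}" for k
    proof (cases "k = 2 * n")
      case True
      have "c' (1 + 2 * int n) = c' 1" using c unfolding spl_pieces_def by blast
      then show ?thesis using True unfolding c1_def by (simp add: add.commute)
    next
      case False
      then show ?thesis unfolding c1_def using that by (simp add: add.commute)
    qed
    have "top_deriv_on (Suc \<rho>) s (c1 k) {t k<..<t k + \<beta> k / 2} \<and>
        top_deriv_on (Suc \<rho>) s (c2 k) {t k + \<alpha> k - \<beta> k / 2<..<t k + \<alpha> k} \<and>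
        top_deriv_on (Suc \<rho>) s 0 {t k + \<beta> k / 2<..<t k + \<alpha> k - \<beta> k / 2} \<and>
        top_deriv_on (Suc \<rho>) s 0 {t k + \<alpha> k<..<t (k + 1)} \<and>
        (\<bar>?\<psi> (t k)\<bar> = M \<longrightarrow> ?w (t k) = 0) \<and>
        (\<bar>?\<psi> (t (k + 1))\<bar> < M \<longrightarrow> c2 k = c1 (k + 1))" if k: "k \<in> {1..2 * n}" for k
    proof (intro conjI impI)
      note tk = T_int(1)[OF k, symmetric] T_int(2)[OF k, symmetric]
      have AB: "\<alpha> k = A (int k)" "\<beta> k = B (int k)" unfolding A_def B_def idx_int(1)[OF k] by simp_all
      have c1k: "c1 k = c' (int k)" unfolding c1_def using k by auto
      show "top_deriv_on (Suc \<rho>) s (c1 k) {t k<..<t k + \<beta> k / 2}"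
        unfolding tk AB c1k top_deriv_on_def using spl_piecesD(3)[OF c, of "int k"] by simp
      show "top_deriv_on (Suc \<rho>) s (c2 k) {t k + \<alpha> k - \<beta> k / 2<..<t k + \<alpha> k}"
        unfolding tk AB c2_def top_deriv_on_def using spl_piecesD(2)[OF c, of "int k + 1"] by simp
      show "top_deriv_on (Suc \<rho>) s 0 {t k + \<beta> k / 2<..<t k + \<alpha> k - \<beta> k / 2}"
        unfolding tk AB top_deriv_on_def using spl_piecesD(4)[OF c, of "int k"] by simp
      show "top_deriv_on (Suc \<rho>) s 0 {t k + \<alpha> k<..<t (k + 1)}"
        unfolding tk AB top_deriv_on_def using rst[of "int k"] by simp
      show "?w (t k) = 0" if "\<bar>?\<psi> (t k)\<bar> = M"
      proof -
        have "active (int k)" using that unfolding tk active_def .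
        then show ?thesis unfolding tk using spl_piecesD(1)[OF c, of "int k" "T (int k)"] A[of "int k - 1"] by simp
      qed
      show "c2 k = c1 (k + 1)" if "\<bar>?\<psi> (t (k + 1))\<bar> < M"
      proof -
        have "\<not> active (int k + 1)" using that unfolding tk active_def by simp
        then show ?thesis using spl_piecesD(5)[OF c] c1_Suc[OF k] unfolding c2_def by simp
      qed
    qed
    moreover have "c1 (2 * n + 1) = c1 1" unfolding c1_def by simp
    ultimately have "\<exists>c1 c2. c1 (2 * n + 1) = c1 1 \<and> (\<forall>k\<in>{1..2 * n}.
        top_deriv_on (Suc \<rho>) s (c1 k) {t k<..<t k + \<beta> k / 2} \<and>
        top_deriv_on (Suc \<rho>) s (c2 k) {t k + \<alpha> k - \<beta> k / 2<..<t k + \<alpha> k} \<and>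
        top_deriv_on (Suc \<rho>) s 0 {t k + \<beta> k / 2<..<t k + \<alpha> k - \<beta> k / 2} \<and>
        top_deriv_on (Suc \<rho>) s 0 {t k + \<alpha> k<..<t (k + 1)} \<and>
        (\<bar>?\<psi> (t k)\<bar> = M \<longrightarrow> ?w (t k) = 0) \<and>
        (\<bar>?\<psi> (t (k + 1))\<bar> < M \<longrightarrow> c2 k = c1 (k + 1)))" by blast
    then show "s \<in> spline_space X n t \<alpha> \<beta> \<phi>"
      using spl_L_inf[OF s] unfolding X_def by simp
  qed
  then show ?thesis
    using recovery[OF tame \<phi>_class neg u \<tau>] \<phi>u unfolding spline_interpolant_def by simp
qed

text \<open>The derivative of order \<open>r - 2\<close> is periodic, so the one of order
  \<open>r - 1\<close> has a zero within each period; being 1-Lipschitz, it is bounded by the period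
  length \<open>2 * pi\<close>.\<close>

lemma class_set_W2_eq: "class_set (W2 (Suc (Suc (Suc k))) M) = class_set (W12 (Suc (Suc (Suc k))) M (2 * pi))"
proof -
  have "sup_norm (nderiv (Suc (Suc k)) x) \<le> ereal (2 * pi)"
    if x: "x \<in> L_inf (Suc (Suc (Suc k)))" "sup_norm (nderiv (Suc (Suc (Suc k))) x) \<le> ereal 1" for x
  proof -
    note facts = L_infD[OF x(1)]
    let ?y = "nderiv (Suc k) x" and ?y' = "nderiv (Suc (Suc k)) x"
    have d: "(?y has_real_derivative ?y' z) (at z)" for z
      by (rule smooth_uptoD[OF facts(2)]) simp
    have "\<bar>?y' z\<bar> \<le> 2 * pi" for z
    proof -
      have "?y (z + 2 * pi) = ?y z" by (rule nderiv_periodic[of x "2 * pi", OF facts(1)])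
      moreover obtain \<xi> where \<xi>: "z < \<xi>" "\<xi> < z + 2 * pi" "?y (z + 2 * pi) - ?y z = (z + 2 * pi - z) * ?y' \<xi>"
        using MVT2[of z "z + 2 * pi" ?y ?y'] d by auto
      ultimately have "?y' \<xi> = 0" by (simp del: funpow.simps)
      then have "\<bar>?y' z\<bar> \<le> 1 * \<bar>z - \<xi>\<bar>" using L_inf_lipschitz[OF x, of z \<xi>] by (simp del: funpow.simps)
      then show ?thesis using \<xi> by (simp del: funpow.simps)
    qed
    then show ?thesis using sup_norm_le_iff_continuous[of ?y', OF facts(3)] by blast
  qed
  then show ?thesis by (auto simp: one_ereal_def simp del: funpow.simps)
qed

text \<open>With \<beta> = \<alpha> the plateau between the two strokes is empty, so the blocks,
  free knots and spline space become those of \<open>W12\<close> with the bound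
  \<open>2 * pi\<close>.\<close>

theorem recovery_W2:
  assumes M: "M > 0" and n: "n \<ge> 1"
    and u: "0 \<le> u 1" "strict_mono_on {1..2 * n} u" "u (2 * n) < 2 * pi" and \<tau>: "\<tau> \<in> {0..<2 * pi}"
    and ideal: "ideal_spline (W2 (Suc (Suc (Suc k))) M) n t \<alpha> \<beta> \<phi>"
    and \<phi>u: "\<forall>k\<in>{1..2 * n}. \<phi> (u k) = 0"
  defines "X \<equiv> W2 (Suc (Suc (Suc k))) M"
  shows "best_error (class_set X) n u \<tau> = ereal \<bar>\<phi> \<tau>\<bar> \<and>
         recovery_error (class_set X) n u (\<lambda>v. spline_interpolant X n t \<alpha> \<beta> \<phi> u v \<tau>) \<tau>
           = best_error (class_set X) n u \<tau>"
proof -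
  let ?Y = "W12 (Suc (Suc (Suc k))) M (2 * pi)"
  have half: "p + a - a / 2 = p + a / 2" for p a :: real by simp
  have class_eq: "class_set X = class_set ?Y" unfolding X_def by (rule class_set_W2_eq)
  have block: "ideal_block ?Y x p q e a a" if "ideal_block X x p q e a b" "0 \<le> a" for x p q e a b
    using that unfolding X_def by (simp add: half top_deriv_on_def)
  have knot: "free_knot ?Y x p = free_knot X x p" for x p unfolding X_def by simp
  have space: "spline_space X n t \<alpha> \<beta> \<phi> = spline_space ?Y n t \<alpha> \<alpha> \<phi>"
    unfolding X_def by (simp add: half top_deriv_on_def)
  have "ideal_spline ?Y n t \<alpha> \<alpha> \<phi>"
  proof -
    obtain \<epsilon> :: "nat \<Rightarrow> real" where "\<epsilon> (2 * n + 1) = \<epsilon> 1" and "\<forall>k\<in>{1..2 * n}.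
           \<epsilon> k \<in> {1, - 1} \<and> \<alpha> k \<in> {0..t (k + 1) - t k} \<and>
           ideal_block X \<phi> (t k) (t (k + 1)) (\<epsilon> k) (\<alpha> k) (\<beta> k) \<and>
           (free_knot X \<phi> (t (k + 1)) \<longrightarrow> \<epsilon> (k + 1) = - \<epsilon> k)"
      using ideal unfolding ideal_spline_def X_def by blast
    then have "\<forall>k\<in>{1..2 * n}.
           \<epsilon> k \<in> {1, - 1} \<and> \<alpha> k \<in> {0..t (k + 1) - t k} \<and>
           ideal_block ?Y \<phi> (t k) (t (k + 1)) (\<epsilon> k) (\<alpha> k) (\<alpha> k) \<and>
           (free_knot ?Y \<phi> (t (k + 1)) \<longrightarrow> \<epsilon> (k + 1) = - \<epsilon> k)"
      unfolding knot using block by (meson atLeastAtMost_iff)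
    then show ?thesis
      using ideal \<open>\<epsilon> (2 * n + 1) = \<epsilon> 1\<close> unfolding ideal_spline_def class_eq[unfolded X_def] by blast
  qed
  from recovery_W12[OF _ M _ n u \<tau> this \<phi>u] show ?thesis
    unfolding class_eq spline_interpolant_def space by simp
qed

theorem mainTheorem1:
  fixes X :: fun_class and n :: nat and u t \<alpha> \<beta> :: "nat \<Rightarrow> real"
    and \<tau> :: real and \<phi> :: "real \<Rightarrow> real"
  assumes "admissible X" and "n \<ge> 1"
    and "0 \<le> u 1" and "strict_mono_on {1..2 * n} u" and "u (2 * n) < 2 * pi"
    and "\<tau> \<in> {0..<2 * pi}"
    and "ideal_spline X n t \<alpha> \<beta> \<phi>"
    and "\<forall>k\<in>{1..2 * n}. \<phi> (u k) = 0"
  shows "best_error (class_set X) n u \<tau> = ereal \<bar>\<phi> \<tau>\<bar> \<and>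
         recovery_error (class_set X) n u (\<lambda>v. spline_interpolant X n t \<alpha> \<beta> \<phi> u v \<tau>) \<tau>
           = best_error (class_set X) n u \<tau>"
proof (cases X)
  case (W1 r M)
  with assms(1) have "M > 0" "r = Suc (Suc (r - 2))" by auto
  with recovery_W1[of M n u \<tau> "r - 2" t \<alpha> \<beta> \<phi>] assms(2-8) W1 show ?thesis by simp
next
  case (W2 r M)
  with assms(1) have "M > 0" "r = Suc (Suc (Suc (r - 3)))" by auto
  with recovery_W2[of M n u \<tau> "r - 3" t \<alpha> \<beta> \<phi>] assms(2-8) W2 show ?thesis by simp
next
  case (W12 r M N)
  with assms(1) have "M > 0" "N > 0" "r = Suc (Suc (r - 2))" "r - 2 \<ge> 1" by auto
  with recovery_W12[of "r - 2" M N n u \<tau> t \<alpha> \<beta> \<phi>] assms(2-8) W12 show ?thesis by simp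
qed

end
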